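(* Let $\mathrm P$ be a loopless polymatroid on $E$ of type $\mathbf a$ and rank $r$, and let $S_1,\dots,S_{r-1}$ be nonempty subsets of $E$. Say that they satisfy the dragon Hall–Rado condition if $\operatorname{rk}_{\mathrm P}(\bigcup_{j\in J}S_j)\ge|J|+1$ for all nonempty $J\subseteq\{1,\dots,r-1\}$. Then $$\deg_{X_{\mathbf a}}\big(h_{S_1}\cdots h_{S_{r-1}}\cdot[\Sigma_{\mathrm P}]\cdot[\underline X_{\mathbf a}]\big)=\begin{cases}1&\text{if the dragon Hall--Rado condition is satisfied},\\0&\text{otherwise.}\end{cases}$$
   Context: $E=\{1,\dots,m\}$, $\mathbf a\in\mathbb Z^m_{\ge0}$, $n=\sum a_i$. Polymatroid of type $\mathbf a$: submodular monotone $\operatorname{rk}_{\mathrm P}:2^E\to\mathbb Z_{\ge0}$, $\operatorname{rk}_{\mathrm P}(\emptyset)=0$, $\operatorname{rk}_{\mathrm P}(\{i\})\le a_i$; loopless means $\operatorname{rk}_{\mathrm P}(\{i\})>0$ for all $i$; flats $F$: $\operatorname{rk}(F\cup e)>\operatorname{rk}(F)$ for $e\notin F$. $\widetilde E$ an $n$-element set, $\pi:\widetilde E\to E$ with $|\pi^{-1}(i)|=a_i$, $\mathbf e_U=\sum_{j\in U}\mathbf e_j$. Polystellahedral fan $\Sigma_{\mathbf a}\subset\mathbb R^{\widetilde E}$: cones $\sigma_{I\le\mathcal F}=\operatorname{cone}(-\mathbf e_{\widetilde E\setminus\pi^{-1}(F_1)},\dots,-\mathbf e_{\widetilde E\setminus\pi^{-1}(F_k)},\mathbf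 e_j:j\in I)$ for $I\subseteq\widetilde E$ and chains $F_1\subsetneq\dots\subsetneq F_{k+1}=E$ ($k\ge0$) with $\pi^{-1}(A)\subseteq I\Rightarrow A\subseteq F_1$; $X_{\mathbf a}$ its smooth projective toric variety, $\deg_{X_{\mathbf a}}:A^n(X_{\mathbf a})\to\mathbb Z$. $x_S$ ($\emptyset\subseteq S\subsetneq E$) is the divisor class of ray $\rho_S=\mathbb R_{\ge0}(-\mathbf e_{\widetilde E\setminus\pi^{-1}(S)})$; $h_S=\sum_{T\subsetneq E,\,T\not\supseteq S}x_T$ for nonempty $S$. $\underline X_{\mathbf a}$ is the torus-invariant divisor of $\rho_\emptyset$, so $[\underline X_{\mathbf a}]=x_\emptyset$. Augmented Bergman fan $\Sigma_{\mathrm P}$: cones $\sigma_{S\le\mathcal F}$ with $F_1,\dots,F_k$ proper flats of $\mathrm P$, $\operatorname{rk}_{\mathrm P}(\pi(T))\ge|T|$ for $T\subseteq S$, and $\operatorname{rk}_{\mathrm P}(F\cup\pi(T))>\operatorname{rk}_{\mathrm P}(F)+|T|$ for $F\in\mathcal F$, nonempty $T\subseteq S\setminus\pi^{-1}(F)$; $[\Sigma_{\mathrm P}]\in A^{n-r}(X_{\mathbf a})$ is the class with $\deg([\Sigma_{\mathrm P}][Z_\sigma])=1$ if $\sigma\in\Sigma_{\mathrm P}$, $0$ otherwise, for $r$-dimensional $\sigma\in\Sigma_{\mathbf a}$ ($Z_\sigma$ orbit closure). *)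

theory Defs
  imports "HOL-Library.Poly_Mapping"
begin

definition polymatroid :: "'a set \<Rightarrow> ('a \<Rightarrow> nat) \<Rightarrow> ('a set \<Rightarrow> nat) \<Rightarrow> bool" where
  "polymatroid E a rk \<longleftrightarrow>
     finite E \<and> rk {} = 0 \<and>
     (\<forall>A B. A \<subseteq> B \<and> B \<subseteq> E \<longrightarrow> rk A \<le> rk B) \<and>
     (\<forall>A B. A \<subseteq> E \<and> B \<subseteq> E \<longrightarrow> rk (A \<union> B) + rk (A \<inter> B) \<le> rk A + rk B) \<and>
     (\<forall>i\<in>E. rk {i} \<le> a i)"

definition loopless :: "'a set \<Rightarrow> ('a set \<Rightarrow> nat) \<Rightarrow> bool" where
  "loopless E rk \<longleftrightarrow> (\<forall>i\<in>E. rk {i} > 0)"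

definition is_flat :: "'a set \<Rightarrow> ('a set \<Rightarrow> nat) \<Rightarrow> 'a set \<Rightarrow> bool" where
  "is_flat E rk F \<longleftrightarrow> F \<subseteq> E \<and> (\<forall>e\<in>E - F. rk (F \<union> {e}) > rk F)"

text \<open>Ray labels: RS S stands for the ray rho_S spanned by minus e of (Et minus pi^-1(S)),
  for S a proper subset of E; RE j stands for the ray spanned by e_j, for j in Et.\<close>
datatype ('a, 'b) ray = RS "'a set" | RE 'b

definition rays :: "'a set \<Rightarrow> 'b set \<Rightarrow> ('a, 'b) ray set" where
  "rays E Et = RS ` {S. S \<subset> E} \<union> RE ` Et"

definition preim :: "'b set \<Rightarrow> ('b \<Rightarrow> 'a) \<Rightarrow> 'a set \<Rightarrow> 'b set" where
  "preim Et \<pi> A = {j \<in> Et. \<pi> j \<in> A}"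

text \<open>A chain F_1 < ... < F_k of proper subsets of E (the last element F_{k+1} = E is implicit).\<close>
definition proper_chain :: "'a set \<Rightarrow> 'a set set \<Rightarrow> bool" where
  "proper_chain E \<F> \<longleftrightarrow> (\<forall>F\<in>\<F>. F \<subset> E) \<and> (\<forall>F\<in>\<F>. \<forall>G\<in>\<F>. F \<subseteq> G \<or> G \<subseteq> F)"

text \<open>The smallest member F_1 of the chain F_1 < ... < F_k < F_{k+1} = E.\<close>
definition first_set :: "'a set \<Rightarrow> 'a set set \<Rightarrow> 'a set" where
  "first_set E \<F> = E \<inter> \<Inter> \<F>"

text \<open>The cone sigma_{I <= F}, represented by its set of rays (the fan is simplicial).\<close>
definition cone_rays :: "'b set \<Rightarrow> 'a set set \<Rightarrow> ('a, 'b) ray set" where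
  "cone_rays I \<F> = RS ` \<F> \<union> RE ` I"

definition admissible_a :: "'a set \<Rightarrow> 'b set \<Rightarrow> ('b \<Rightarrow> 'a) \<Rightarrow> 'b set \<Rightarrow> 'a set set \<Rightarrow> bool" where
  "admissible_a E Et \<pi> I \<F> \<longleftrightarrow> I \<subseteq> Et \<and> proper_chain E \<F> \<and>
     (\<forall>A. A \<subseteq> E \<and> preim Et \<pi> A \<subseteq> I \<longrightarrow> A \<subseteq> first_set E \<F>)"

definition cone_a :: "'a set \<Rightarrow> 'b set \<Rightarrow> ('b \<Rightarrow> 'a) \<Rightarrow> ('a, 'b) ray set \<Rightarrow> bool" where
  "cone_a E Et \<pi> \<tau> \<longleftrightarrow> (\<exists>I \<F>. admissible_a E Et \<pi> I \<F> \<and> \<tau> = cone_rays I \<F>)"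

definition cone_P :: "'a set \<Rightarrow> 'b set \<Rightarrow> ('b \<Rightarrow> 'a) \<Rightarrow> ('a set \<Rightarrow> nat) \<Rightarrow> ('a, 'b) ray set \<Rightarrow> bool" where
  "cone_P E Et \<pi> rk \<tau> \<longleftrightarrow> (\<exists>I \<F>. admissible_a E Et \<pi> I \<F> \<and> \<tau> = cone_rays I \<F> \<and>
     (\<forall>F\<in>\<F>. is_flat E rk F) \<and>
     (\<forall>T. T \<subseteq> I \<longrightarrow> rk (\<pi> ` T) \<ge> card T) \<and>
     (\<forall>F\<in>\<F>. \<forall>T. T \<subseteq> I - preim Et \<pi> F \<and> T \<noteq> {} \<longrightarrow> rk (F \<union> \<pi> ` T) > rk F + card T))"

type_synonym ('a, 'b) chow_poly = "((('a, 'b) ray \<Rightarrow>\<^sub>0 nat) \<Rightarrow>\<^sub>0 int)"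

definition var :: "('a, 'b) ray \<Rightarrow> ('a, 'b) chow_poly" where
  "var \<rho> = Poly_Mapping.single (Poly_Mapping.single \<rho> 1) 1"

definition mono :: "('a, 'b) ray set \<Rightarrow> ('a, 'b) chow_poly" where
  "mono \<tau> = (\<Prod>\<rho>\<in>\<tau>. var \<rho>)"

definition total_deg :: "('c \<Rightarrow>\<^sub>0 nat) \<Rightarrow> nat" where
  "total_deg m = (\<Sum>x\<in>Poly_Mapping.keys m. Poly_Mapping.lookup m x)"

definition homogeneous :: "nat \<Rightarrow> ('a, 'b) chow_poly \<Rightarrow> bool" where
  "homogeneous k f \<longleftrightarrow> (\<forall>m\<in>Poly_Mapping.keys f. total_deg m = k)"

definition ideal_gen :: "'r::comm_ring_1 set \<Rightarrow> 'r set" where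
  "ideal_gen G = {\<Sum>g\<in>F. c g * g | F c. finite F \<and> F \<subseteq> G}"

text \<open>Linear relation attached to the coordinate functional e_j^* (j in Et):
  sum over rays rho of <e_j^*, v_rho> x_rho.\<close>
definition lin_rel :: "'a set \<Rightarrow> ('b \<Rightarrow> 'a) \<Rightarrow> 'b \<Rightarrow> ('a, 'b) chow_poly" where
  "lin_rel E \<pi> j = var (RE j) - (\<Sum>S\<in>{S. S \<subset> E \<and> \<pi> j \<notin> S}. var (RS S))"

text \<open>The ideal: Stanley--Reisner monomials of non-faces, linear relations, and
  (harmlessly) the variables not corresponding to rays of the fan.\<close>
definition chow_ideal :: "'a set \<Rightarrow> 'b set \<Rightarrow> ('b \<Rightarrow> 'a) \<Rightarrow> ('a, 'b) chow_poly set" where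
  "chow_ideal E Et \<pi> = ideal_gen
     ({mono \<tau> | \<tau>. finite \<tau> \<and> \<tau> \<subseteq> rays E Et \<and> \<not> cone_a E Et \<pi> \<tau>} \<union>
      lin_rel E \<pi> ` Et \<union>
      var ` (- rays E Et))"

text \<open>deg: A^n(X_a) -> Z, the isomorphism sending the class of a torus-fixed point
  (the monomial of a maximal cone) to 1.\<close>
definition deg_X :: "'a set \<Rightarrow> 'b set \<Rightarrow> ('b \<Rightarrow> 'a) \<Rightarrow> ('a, 'b) chow_poly \<Rightarrow> int" where
  "deg_X E Et \<pi> f = (THE d. \<exists>\<sigma>. cone_a E Et \<pi> \<sigma> \<and> card \<sigma> = card Et \<and>
       f - of_int d * mono \<sigma> \<in> chow_ideal E Et \<pi>)"

definition x_cls :: "'a set \<Rightarrow> ('a, 'b) chow_poly" where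
  "x_cls S = var (RS S)"

definition h_cls :: "'a set \<Rightarrow> 'a set \<Rightarrow> ('a, 'b) chow_poly" where
  "h_cls E S = (\<Sum>T\<in>{T. T \<subset> E \<and> \<not> S \<subseteq> T}. x_cls T)"

text \<open>The class [Sigma_P] in A^{n-r}(X_a), characterised by its degrees against
  the orbit closures [Z_sigma] = x^sigma of r-dimensional cones.\<close>
definition sigmaP_cls :: "'a set \<Rightarrow> 'b set \<Rightarrow> ('b \<Rightarrow> 'a) \<Rightarrow> ('a set \<Rightarrow> nat) \<Rightarrow> ('a, 'b) chow_poly" where
  "sigmaP_cls E Et \<pi> rk = (SOME c. homogeneous (card Et - rk E) c \<and>
     (\<forall>\<sigma>. cone_a E Et \<pi> \<sigma> \<and> card \<sigma> = rk E \<longrightarrow>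
        deg_X E Et \<pi> (c * mono \<sigma>) = (if cone_P E Et \<pi> rk \<sigma> then 1 else 0)))"

definition dragon_hall_rado :: "('a set \<Rightarrow> nat) \<Rightarrow> nat \<Rightarrow> (nat \<Rightarrow> 'a set) \<Rightarrow> bool" where
  "dragon_hall_rado rk r S \<longleftrightarrow>
     (\<forall>J. J \<subseteq> {1..r-1} \<and> J \<noteq> {} \<longrightarrow> rk (\<Union>j\<in>J. S j) \<ge> card J + 1)"

end

theory Submission
  imports Defs "HOL-Library.Multiset"
begin

text \<open>
  In terms of the classes \<open>h_S\<close> one has \<open>x_T = - \<Sum> (-1)^|S - T| h_S\<close> (sum over \<open>T \<subseteq> S \<subseteq> E\<close>), so the
  polynomial ring acts on integer functions of multisets of subsets, with \<open>h_S\<close> acting by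
  \<open>\<phi> \<mapsto> (\<lambda>m. \<phi> (m + S))\<close>. For a polymatroid \<open>P\<close> of rank \<open>r\<close> let \<open>\<phi>_P\<close> be the indicator function
  of the multisets of size \<open>r\<close> that satisfy the Hall-Rado condition. The tight submultisets of a
  Hall-Rado multiset \<open>m\<close> have a largest closure \<open>G\<close>, and adding \<open>S\<close> preserves the condition iff
  \<open>S\<close> is not contained in \<open>G\<close>; hence by Moebius inversion \<open>x_T \<phi>_P (m)\<close> is 1 iff \<open>T = G\<close>.
  Consequently the Chow ideal annihilates \<open>\<phi>_P\<close>, the monomial of a cone maps \<open>\<phi>_P\<close> to the function
  whose value at the empty multiset tells whether the cone lies in \<open>\<Sigma>_P\<close>, and \<open>x_{} \<phi>_P\<close> is the
  indicator function of the dragon condition. For the free polymatroid this functional is the degree map.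
  If \<open>P\<close> is an elementary quotient of \<open>P'\<close>, then the sum of the \<open>x_T\<close> with \<open>rk T = rk' T\<close> maps
  \<open>\<phi>_P'\<close> to \<open>\<phi>_P\<close>. The Higgs lifts connect \<open>P\<close> with the free polymatroid, so a product of such sums
  represents \<open>[\<Sigma>_P]\<close> and the degree of \<open>f [\<Sigma>_P]\<close> is \<open>f \<phi>_P\<close> at the empty multiset.
\<close>

section \<open>Linear extension, substitution and the action on functions\<close>

text \<open>Two definitions shape the proof. \<open>deg_X\<close> is a definite description:
  existence of its value asks that every polynomial of top degree be an integer multiple of a point
  modulo the ideal, and uniqueness asks for a functional that vanishes on the ideal and is 1 on each
  maximal cone. \<open>sigmaP_cls\<close> is a choice among the polynomials with prescribed degrees,
  so one such polynomial has to be exhibited, and the result must not depend on the choice. The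
  moving lemma serves both ends: modulo the ideal, a homogeneous polynomial is an integer
  combination of square-free monomials of cones, and on these the degrees are prescribed. Functions
  of multisets serve as an inverse system: to detect a class it is enough to apply it to a function
  that the ideal annihilates, which is checked on generators. The formula for x_T inverts h_S = (sum
  of the x_T with T not above S). It rests on h_{} = 0 and on the additional value x_E = - h_E, with
  which the sum of x_T over all T \<subseteq> E vanishes.\<close>

definition lin :: "('k \<Rightarrow> 'r::comm_ring_1) \<Rightarrow> ('k \<Rightarrow>\<^sub>0 int) \<Rightarrow> 'r" where
  "lin w f = (\<Sum>k\<in>Poly_Mapping.keys f. of_int (Poly_Mapping.lookup f k) * w k)"

lemma lin_superset:
  assumes "finite A" "Poly_Mapping.keys f \<subseteq> A"
  shows "lin w f = (\<Sum>k\<in>A. of_int (Poly_Mapping.lookup f k) * w k)"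
  unfolding lin_def
  by (rule sum.mono_neutral_left) (use assms in \<open>auto simp: in_keys_iff\<close>)

lemma lin_zero [simp]: "lin w 0 = 0"
  by (simp add: lin_def)

lemma lin_diff: "lin w (f - g) = lin w f - lin w g"
proof -
  let ?A = "Poly_Mapping.keys f \<union> Poly_Mapping.keys g"
  have "lin w (f - g) = (\<Sum>k\<in>?A. of_int (Poly_Mapping.lookup (f - g) k) * w k)"
    by (rule lin_superset) (auto simp: in_keys_iff lookup_minus)
  also have "\<dots> = (\<Sum>k\<in>?A. of_int (Poly_Mapping.lookup f k) * w k)
      - (\<Sum>k\<in>?A. of_int (Poly_Mapping.lookup g k) * w k)"
    by (simp add: lookup_minus sum_subtractf[symmetric] algebra_simps)
  also have "\<dots> = lin w f - lin w g"
    by (simp add: lin_superset[of ?A])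
  finally show ?thesis .
qed

lemma lin_uminus: "lin w (- f) = - lin w f"
  using lin_diff[of w 0 f] by simp

lemma lin_add: "lin w (f + g) = lin w f + lin w g"
  using lin_diff[of w f "- g"] by (simp add: lin_uminus)

lemma lin_sum: "lin w (\<Sum>i\<in>A. f i) = (\<Sum>i\<in>A. lin w (f i))"
  by (induction A rule: infinite_finite_induct) (simp_all add: lin_add)

lemma lin_frag_of [simp]: "lin w (frag_of k) = w k"
  by (simp add: lin_def keys_frag_of)

lemma lin_mult_left: "lin (\<lambda>k. c * w k) f = c * lin w f"
  by (simp add: lin_def sum_distrib_left mult.left_commute)

lemma lin_mult_right: "lin (\<lambda>k. w k * c) f = lin w f * c"
  by (simp add: lin_def sum_distrib_right mult.assoc)

lemma frag_of_mult: "frag_of a * frag_of b = (frag_of (a + b) :: 'k::comm_monoid_add \<Rightarrow>\<^sub>0 int)"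
  by (simp add: mult_single)

lemma lin_mult:
  fixes f g :: "'k::comm_monoid_add \<Rightarrow>\<^sub>0 int"
  shows "lin w (f * g) = lin (\<lambda>a. lin (\<lambda>b. w (a + b)) g) f"
proof (induction f rule: frag_induction[OF subset_UNIV])
  case (2 a)
  show ?case
  proof (induction g rule: frag_induction[OF subset_UNIV])
    case (2 b)
    show ?case by (simp add: frag_of_mult)
  qed (simp_all add: lin_diff right_diff_distrib)
qed (simp_all add: lin_diff left_diff_distrib)

definition mon_subst :: "('c \<Rightarrow> 'r::comm_ring_1) \<Rightarrow> ('c \<Rightarrow>\<^sub>0 nat) \<Rightarrow> 'r" where
  "mon_subst v m = (\<Prod>x\<in>Poly_Mapping.keys m. v x ^ Poly_Mapping.lookup m x)"

lemma mon_subst_superset: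
  assumes "finite A" "Poly_Mapping.keys m \<subseteq> A"
  shows "mon_subst v m = (\<Prod>x\<in>A. v x ^ Poly_Mapping.lookup m x)"
  unfolding mon_subst_def
  by (rule prod.mono_neutral_left) (use assms in \<open>auto simp: in_keys_iff\<close>)

lemma mon_subst_zero [simp]: "mon_subst v 0 = 1"
  by (simp add: mon_subst_def)

lemma mon_subst_add: "mon_subst v (a + b) = mon_subst v a * mon_subst v b"
proof -
  let ?A = "Poly_Mapping.keys a \<union> Poly_Mapping.keys b"
  have "mon_subst v (a + b) = (\<Prod>x\<in>?A. v x ^ Poly_Mapping.lookup (a + b) x)"
    by (rule mon_subst_superset) (auto simp: in_keys_iff lookup_add)
  also have "\<dots> = (\<Prod>x\<in>?A. v x ^ Poly_Mapping.lookup a x) * (\<Prod>x\<in>?A. v x ^ Poly_Mapping.lookup b x)"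
    by (simp add: lookup_add power_add prod.distrib)
  also have "\<dots> = mon_subst v a * mon_subst v b"
    by (simp add: mon_subst_superset[of ?A])
  finally show ?thesis .
qed

lemma mon_subst_single: "mon_subst v (Poly_Mapping.single x (Suc 0)) = v x"
  by (simp add: mon_subst_def)

definition poly_subst :: "('c \<Rightarrow> 'r::comm_ring_1) \<Rightarrow> (('c \<Rightarrow>\<^sub>0 nat) \<Rightarrow>\<^sub>0 int) \<Rightarrow> 'r" where
  "poly_subst v = lin (mon_subst v)"

lemma poly_subst_mult: "poly_subst v (f * g) = poly_subst v f * poly_subst v g"
  by (simp add: poly_subst_def lin_mult mon_subst_add lin_mult_left lin_mult_right)

lemma poly_subst_one [simp]: "poly_subst v 1 = 1"
  using lin_frag_of[of "mon_subst v" 0] by (simp add: poly_subst_def)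

lemma poly_subst_zero [simp]: "poly_subst v 0 = 0"
  by (simp add: poly_subst_def)

lemma poly_subst_diff: "poly_subst v (f - g) = poly_subst v f - poly_subst v g"
  by (simp add: poly_subst_def lin_diff)

lemma poly_subst_sum: "poly_subst v (\<Sum>i\<in>A. f i) = (\<Sum>i\<in>A. poly_subst v (f i))"
  by (simp add: poly_subst_def lin_sum)

lemma poly_subst_prod: "poly_subst v (\<Prod>i\<in>A. f i) = (\<Prod>i\<in>A. poly_subst v (f i))"
  by (induction A rule: infinite_finite_induct) (simp_all add: poly_subst_mult)

lemma poly_subst_var [simp]: "poly_subst v (var x) = v x"
  by (simp add: poly_subst_def var_def mon_subst_single)

text \<open>Shifting the argument makes multiplication a composition (\<open>act_mult\<close>), so a
  product of ray variables can be evaluated one factor at a time.\<close>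

definition act :: "('k::comm_monoid_add \<Rightarrow>\<^sub>0 int) \<Rightarrow> ('k \<Rightarrow> int) \<Rightarrow> 'k \<Rightarrow> int" where
  "act g \<phi> m = lin (\<lambda>k. \<phi> (m + k)) g"

lemma act_zero [simp]: "act 0 \<phi> m = 0"
  by (simp add: act_def)

lemma act_zero_fun [simp]: "act g (\<lambda>_. 0) = (\<lambda>_. 0)"
  by (simp add: act_def lin_def fun_eq_iff)

lemma act_frag_of: "act (frag_of k) \<phi> m = \<phi> (m + k)"
  by (simp add: act_def)

lemma act_one [simp]: "act 1 \<phi> = \<phi>"
  using act_frag_of[of 0 \<phi>] by auto

lemma act_mult: "act (f * g) \<phi> = act f (act g \<phi>)"
  by (simp add: act_def lin_mult add.assoc fun_eq_iff)

lemma act_diff: "act (f - g) \<phi> m = act f \<phi> m - act g \<phi> m"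
  by (simp add: act_def lin_diff)

lemma act_uminus: "act (- g) \<phi> m = - act g \<phi> m"
  by (simp add: act_def lin_uminus)

lemma act_sum: "act (\<Sum>i\<in>A. g i) \<phi> m = (\<Sum>i\<in>A. act (g i) \<phi> m)"
  by (simp add: act_def lin_sum)

lemma act_sign: "act ((-1) ^ k * g) \<phi> m = (-1) ^ k * act g \<phi> m"
  by (induction k) (simp_all add: act_uminus)

lemma act_prod_frag_of:
  assumes "finite A"
  shows "act (\<Prod>i\<in>A. frag_of {#f i#}) \<phi> m = \<phi> (m + image_mset f (mset_set A))"
  using assms
proof (induction A arbitrary: m rule: finite_induct)
  case (insert x A)
  then show ?case
    by (simp add: act_mult act_frag_of)
qed simp

section \<open>Alternating sums over intervals of subsets\<close>

lemma alternating_sum_eq_0: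
  fixes u :: "'a set \<Rightarrow> 'r::comm_ring_1"
  assumes fin: "finite E" and f: "f \<in> E" "f \<notin> T"
    and u: "\<And>U. T \<subseteq> U \<Longrightarrow> U \<subseteq> E \<Longrightarrow> f \<notin> U \<Longrightarrow> u (insert f U) = u U"
  shows "(\<Sum>U\<in>{U. T \<subseteq> U \<and> U \<subseteq> E}. (-1) ^ card (U - T) * u U) = 0"
proof -
  let ?A = "{U. T \<subseteq> U \<and> U \<subseteq> E \<and> f \<notin> U}"
  have finA: "finite ?A" using fin by (auto intro: finite_subset[of _ "Pow E"])
  have inj: "inj_on (insert f) ?A" by (auto simp: inj_on_def)
  have eq: "{U. T \<subseteq> U \<and> U \<subseteq> E} = ?A \<union> insert f ` ?A"
  proof (intro equalityI subsetI)
    fix U assume U: "U \<in> {U. T \<subseteq> U \<and> U \<subseteq> E}"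
    show "U \<in> ?A \<union> insert f ` ?A"
    proof (cases "f \<in> U")
      case True
      then have "U = insert f (U - {f})" "U - {f} \<in> ?A" using U f by auto
      then show ?thesis by blast
    qed (use U in auto)
  qed (use f in auto)
  \<comment> \<open>Adding f flips the sign and keeps the value of u, so U and
    \<open>insert f U\<close> cancel.\<close>
  have step: "(-1) ^ card (insert f U - T) * u (insert f U) = - ((-1) ^ card (U - T) * u U)"
    if "U \<in> ?A" for U
  proof -
    have "insert f U - T = insert f (U - T)" "finite (U - T)" "f \<notin> U - T"
      using that f fin finite_subset by auto
    then show ?thesis using that u by simp
  qed
  have "(\<Sum>U\<in>{U. T \<subseteq> U \<and> U \<subseteq> E}. (-1) ^ card (U - T) * u U)
      = (\<Sum>U\<in>?A. (-1) ^ card (U - T) * u U) + (\<Sum>U\<in>insert f ` ?A. (-1) ^ card (U - T) * u U)"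
    unfolding eq by (rule sum.union_disjoint) (use finA in auto)
  also have "(\<Sum>U\<in>insert f ` ?A. (-1) ^ card (U - T) * u U) = (\<Sum>U\<in>?A. - ((-1) ^ card (U - T) * u U))"
    using inj step by (simp add: sum.reindex)
  finally show ?thesis by (simp add: sum_negf)
qed

lemma alternating_sum_subsets:
  assumes "finite E" "T \<subseteq> E"
  shows "(\<Sum>U\<in>{U. T \<subseteq> U \<and> U \<subseteq> E}. (-1) ^ card (U - T)) = (of_bool (T = E) :: 'r::comm_ring_1)"
proof (cases "T = E")
  case True
  then have "{U. T \<subseteq> U \<and> U \<subseteq> E} = {E}" by auto
  then show ?thesis using True by simp
next
  case False
  then obtain f where "f \<in> E" "f \<notin> T" using assms by auto
  from alternating_sum_eq_0[of E f T "\<lambda>_. 1", OF assms(1) this] False show ?thesis by simp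
qed

text \<open>Only the interval from T to G contributes. This is how a closure G is recovered from the
  knowledge of which sets lie in it.\<close>

lemma alternating_sum_indicator:
  assumes "finite E" "G \<subseteq> E"
  shows "(\<Sum>U\<in>{U. T \<subseteq> U \<and> U \<subseteq> E}. (-1) ^ card (U - T) * of_bool (U \<subseteq> G)) = (of_bool (T = G) :: 'r::comm_ring_1)"
proof -
  have "(\<Sum>U\<in>{U. T \<subseteq> U \<and> U \<subseteq> E}. (-1) ^ card (U - T) * of_bool (U \<subseteq> G)) =
    (\<Sum>U\<in>{U. T \<subseteq> U \<and> U \<subseteq> G}. (-1) ^ card (U - T) :: 'r)"
    by (rule sum.mono_neutral_cong_right) (use assms in \<open>auto intro: finite_subset[of _ "Pow E"]\<close>)
  also have "\<dots> = of_bool (T = G)"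
  proof (cases "T \<subseteq> G")
    case True
    from alternating_sum_subsets[OF finite_subset[OF assms(2,1)] this] show ?thesis .
  next
    case False
    then have "{U. T \<subseteq> U \<and> U \<subseteq> G} = {}" by auto
    then have "(\<Sum>U\<in>{U. T \<subseteq> U \<and> U \<subseteq> G}. (-1) ^ card (U - T) :: 'r) = 0" by (simp only: sum.empty)
    moreover have "T \<noteq> G" using False by auto
    ultimately show ?thesis by simp
  qed
  finally show ?thesis .
qed

section \<open>Hall-Rado and dragon conditions\<close>

abbreviation un :: "'a set multiset \<Rightarrow> 'a set" where
  "un J \<equiv> \<Union> (set_mset J)"

abbreviation inside :: "'a set \<Rightarrow> 'a set multiset \<Rightarrow> 'a set multiset" where
  "inside F m \<equiv> filter_mset (\<lambda>S. S \<subseteq> F) m"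

abbreviation outside :: "'a set \<Rightarrow> 'a set multiset \<Rightarrow> 'a set multiset" where
  "outside F m \<equiv> filter_mset (\<lambda>S. \<not> S \<subseteq> F) m"

text \<open>Submultisets replace index sets, so equal sets with different indices are counted
  separately.\<close>

definition hall_rado :: "('a set \<Rightarrow> nat) \<Rightarrow> 'a set multiset \<Rightarrow> bool" where
  "hall_rado \<rho> m \<longleftrightarrow> (\<forall>J. J \<subseteq># m \<longrightarrow> size J \<le> \<rho> (un J))"

text \<open>The dragon condition for the contraction by T. At \<open>T = {}\<close> it is the
  condition of the theorem; at a flat F and a multiset of singletons it is the last condition on the
  cones of \<Sigma>_P.\<close>

definition dragon :: "('a set \<Rightarrow> nat) \<Rightarrow> 'a set \<Rightarrow> 'a set multiset \<Rightarrow> bool" where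
  "dragon \<rho> T m \<longleftrightarrow> (\<forall>J. J \<subseteq># m \<and> J \<noteq> {#} \<longrightarrow> \<rho> T + size J < \<rho> (T \<union> un J))"

text \<open>A product of \<open>x_F\<close> over a chain maps \<open>\<phi>_P\<close> to a function of this shape, where \<open>F\<close> is the
  smallest member of the chain and \<open>\<chi>\<close> depends on the sets modulo \<open>F\<close> only.\<close>

definition loc :: "('a set \<Rightarrow> nat) \<Rightarrow> 'a set \<Rightarrow> ('a set multiset \<Rightarrow> bool) \<Rightarrow> 'a set multiset \<Rightarrow> bool" where
  "loc \<rho> F \<chi> m \<longleftrightarrow> hall_rado \<rho> (inside F m) \<and> size (inside F m) = \<rho> F \<and> \<chi> (outside F m)"

lemma hall_rado_subset: "hall_rado \<rho> m \<Longrightarrow> m' \<subseteq># m \<Longrightarrow> hall_rado \<rho> m'"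
  unfolding hall_rado_def using subset_mset.order_trans by blast

lemma hall_radoD: "hall_rado \<rho> m \<Longrightarrow> J \<subseteq># m \<Longrightarrow> size J \<le> \<rho> (un J)"
  by (simp add: hall_rado_def)

lemma dragonD: "dragon \<rho> T m \<Longrightarrow> J \<subseteq># m \<Longrightarrow> J \<noteq> {#} \<Longrightarrow> \<rho> T + size J < \<rho> (T \<union> un J)"
  by (simp add: dragon_def)

lemma dragon_subset: "dragon \<rho> T m \<Longrightarrow> m' \<subseteq># m \<Longrightarrow> dragon \<rho> T m'"
  unfolding dragon_def using subset_mset.order_trans by blast

lemma inside_outside: "m = inside F m + outside F m"
  by simp

lemma un_mono: "J \<subseteq># m \<Longrightarrow> un J \<subseteq> un m"
  by (meson Union_mono set_mset_mono)

lemma subset_add_msetE: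
  assumes "J \<subseteq># add_mset S m"
  obtains "J \<subseteq># m" | J' where "J = add_mset S J'" "J' \<subseteq># m"
proof (cases "S \<in># J")
  case True
  then obtain J' where "J = add_mset S J'" by (meson multi_member_split)
  then show ?thesis using assms that(2) by auto
next
  case False
  then show ?thesis using assms that(1)
    by (metis add_mset_remove_trivial diff_single_trivial subset_eq_diff_conv add_mset_add_single)
qed

text \<open>Flats of the restriction to F. The restriction matters because chains are built
  downwards, so that a new member is at first tested only inside the current smallest one.\<close>

definition flat_in :: "('a set \<Rightarrow> nat) \<Rightarrow> 'a set \<Rightarrow> 'a set \<Rightarrow> bool" where
  "flat_in \<rho> F T \<longleftrightarrow> T \<subseteq> F \<and> (\<forall>e\<in>F - T. \<rho> T < \<rho> (insert e T))"

text \<open>The rank axioms carry no side condition \<open>A \<subseteq> E\<close>, so unions of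
  arbitrary multisets can be inserted; E supplies finiteness and the top element.\<close>

locale polyrank =
  fixes E :: "'a set" and \<rho> :: "'a set \<Rightarrow> nat"
  assumes finite_E: "finite E"
    and rk_empty: "\<rho> {} = 0"
    and rk_mono: "A \<subseteq> B \<Longrightarrow> \<rho> A \<le> \<rho> B"
    and rk_submod: "\<rho> (A \<union> B) + \<rho> (A \<inter> B) \<le> \<rho> A + \<rho> B"
begin

lemma rk_diminishing:
  assumes "A \<subseteq> B"
  shows "\<rho> (B \<union> C) + \<rho> A \<le> \<rho> (A \<union> C) + \<rho> B"
proof -
  have "(A \<union> C) \<union> B = B \<union> C" "A \<subseteq> (A \<union> C) \<inter> B" using assms by auto
  then show ?thesis using rk_submod[of "A \<union> C" B] rk_mono[of A "(A \<union> C) \<inter> B"] by simp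
qed

lemma rk_absorb:
  assumes "finite A" "\<And>e. e \<in> A \<Longrightarrow> \<rho> (insert e B) = \<rho> B"
  shows "\<rho> (B \<union> A) = \<rho> B"
  using assms
proof (induction A rule: finite_induct)
  case (insert e A)
  have "\<rho> (B \<union> A \<union> {e}) + \<rho> B \<le> \<rho> (B \<union> {e}) + \<rho> (B \<union> A)"
    by (rule rk_diminishing) simp
  then have "\<rho> (B \<union> insert e A) \<le> \<rho> B" using insert by simp
  moreover have "\<rho> B \<le> \<rho> (B \<union> insert e A)" by (rule rk_mono) auto
  ultimately show ?case by (rule antisym)
qed simp

lemma flat_in_rk_less:
  assumes "flat_in \<rho> F T" "S \<subseteq> F" "\<not> S \<subseteq> T"
  shows "\<rho> T < \<rho> (T \<union> S)"
proof -
  obtain e where "e \<in> S" "e \<notin> T" using assms by auto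
  then have "\<rho> T < \<rho> (insert e T)" using assms by (auto simp: flat_in_def)
  also have "\<dots> \<le> \<rho> (T \<union> S)" by (rule rk_mono) (use \<open>e \<in> S\<close> in auto)
  finally show ?thesis .
qed

lemma hall_rado_empty_notin: "hall_rado \<rho> m \<Longrightarrow> {} \<notin># m"
  using hall_radoD[of \<rho> m "{#{}#}"] by (auto simp: rk_empty)

text \<open>G is the closure in F of the union of the largest tight submultiset \<open>J0\<close>. A
  set inside G would overfill \<open>J0\<close>; a nonempty J outside G that violates the strict
  inequality would make \<open>J0 + J\<close> tight, against maximality.\<close>

lemma hall_rado_closure:
  assumes hr: "hall_rado \<rho> m" and sub: "\<And>S. S \<in># m \<Longrightarrow> S \<subseteq> F" and FE: "F \<subseteq> E"
    and size: "size m < \<rho> F"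
  obtains G where "G \<subset> F" "flat_in \<rho> F G" "size (inside G m) = \<rho> G" "dragon \<rho> G (outside G m)"
    "\<And>S. S \<subseteq> F \<Longrightarrow> hall_rado \<rho> (add_mset S m) \<longleftrightarrow> \<not> S \<subseteq> G"
proof -
  define tight where "tight J \<longleftrightarrow> J \<subseteq># m \<and> size J = \<rho> (un J)" for J
  have "tight {#}" by (simp add: tight_def rk_empty)
  moreover have "\<forall>J. tight J \<longrightarrow> size J < Suc (size m)"
    unfolding tight_def less_Suc_eq_le by (intro allI impI, elim conjE) (rule size_mset_mono)
  ultimately obtain J0 where J0: "tight J0" "\<And>J. tight J \<Longrightarrow> size J \<le> size J0"
    using ex_has_greatest_nat[of tight "{#}" size "Suc (size m)"] by blast
  have J0m: "J0 \<subseteq># m" and J0s: "size J0 = \<rho> (un J0)" using J0(1) by (auto simp: tight_def)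
  \<comment> \<open>Uncrossing: by submodularity the sizes of union and intersection add up to at
    least the sum of their ranks, so the Hall-Rado bounds are attained and the union is tight. Since
    \<open>J0\<close> has maximal size, the union is \<open>J0\<close>.\<close>
  have max: "J \<subseteq># J0" if "tight J" for J
  proof -
    have Jm: "J \<subseteq># m" and Js: "size J = \<rho> (un J)" using that by (auto simp: tight_def)
    have um: "J \<union># J0 \<subseteq># m" using Jm J0m by simp
    have im: "J \<inter># J0 \<subseteq># m" using Jm by (simp add: subset_mset.le_infI1)
    have "size (J \<union># J0) + size (J \<inter># J0) = size J + size J0"
    proof -
      have "J \<union># J0 + J \<inter># J0 = J + J0" by (rule multiset_eqI) simp
      then show ?thesis by (metis size_union)
    qed
    moreover have "\<rho> (un (J \<union># J0)) + \<rho> (un J \<inter> un J0) \<le> size J + size J0"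
    proof -
      have "un (J \<union># J0) = un J \<union> un J0" by auto
      then show ?thesis unfolding Js J0s using rk_submod[of "un J" "un J0"] by (simp only:)
    qed
    moreover have "\<rho> (un (J \<inter># J0)) \<le> \<rho> (un J \<inter> un J0)" by (rule rk_mono) auto
    ultimately have "\<rho> (un (J \<union># J0)) + \<rho> (un (J \<inter># J0)) \<le> size (J \<union># J0) + size (J \<inter># J0)"
      by linarith
    with hall_radoD[OF hr um] hall_radoD[OF hr im] have "size (J \<union># J0) = \<rho> (un (J \<union># J0))"
      by linarith
    then have "tight (J \<union># J0)" using um by (simp add: tight_def)
    from J0(2)[OF this] have "\<not> J0 \<subset># J \<union># J0"
      using mset_subset_size leD by blast
    then have "J \<union># J0 = J0" by (simp add: subset_mset.less_le)
    then show ?thesis by (metis subset_mset.sup_ge1)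
  qed
  define G where "G = {e \<in> F. \<rho> (insert e (un J0)) = \<rho> (un J0)}"
  have unF: "un J0 \<subseteq> F" using sub mset_subset_eqD[OF J0m] by blast
  have unG: "un J0 \<subseteq> G"
  proof
    fix e assume e: "e \<in> un J0"
    then have "insert e (un J0) = un J0" by (rule insert_absorb)
    then show "e \<in> G" using e unF by (simp add: G_def subset_iff)
  qed
  have finG: "finite G" using FE finite_E by (auto simp: G_def intro: finite_subset)
  have "\<rho> (un J0 \<union> G) = \<rho> (un J0)"
    by (rule rk_absorb) (use finG G_def in simp_all)
  then have rkG: "\<rho> G = \<rho> (un J0)" using unG by (simp add: sup_absorb2)
  have "J0 \<subseteq># inside G m"
  proof -
    have "inside G J0 = J0" using unG by (auto simp: filter_mset_eq_conv)
    then show ?thesis using multiset_filter_mono[OF J0m, of "\<lambda>S. S \<subseteq> G"] by simp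
  qed
  note J0in = this
  have szG: "size (inside G m) = \<rho> G"
  proof -
    have "size (inside G m) \<le> \<rho> (un (inside G m))" by (rule hall_radoD[OF hr]) simp
    also have "\<dots> \<le> \<rho> G" by (rule rk_mono) auto
    finally show ?thesis using size_mset_mono[OF J0in] J0s rkG by simp
  qed
  have flat: "flat_in \<rho> F G"
    unfolding flat_in_def
  proof (intro conjI ballI)
    show "G \<subseteq> F" by (auto simp: G_def)
    fix e assume e: "e \<in> F - G"
    show "\<rho> G < \<rho> (insert e G)"
    proof (rule ccontr)
      assume "\<not> ?thesis"
      moreover have "\<rho> (insert e (un J0)) \<le> \<rho> (insert e G)" by (rule rk_mono) (use unG in auto)
      moreover have "\<rho> (un J0) \<le> \<rho> (insert e (un J0))" by (rule rk_mono) auto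
      ultimately have "e \<in> G" using e rkG by (auto simp: G_def)
      then show False using e by simp
    qed
  qed
  have iff: "hall_rado \<rho> (add_mset S m) \<longleftrightarrow> \<not> S \<subseteq> G" if SF: "S \<subseteq> F" for S
  proof
    assume h: "hall_rado \<rho> (add_mset S m)"
    show "\<not> S \<subseteq> G"
    proof
      assume SG: "S \<subseteq> G"
      have "size (add_mset S J0) \<le> \<rho> (un (add_mset S J0))"
        by (rule hall_radoD[OF h]) (use J0m in simp)
      also have "\<dots> \<le> \<rho> G" by (rule rk_mono) (use SG unG in auto)
      finally show False using J0s rkG by simp
    qed
  next
    assume SG: "\<not> S \<subseteq> G"
    show "hall_rado \<rho> (add_mset S m)"
      unfolding hall_rado_def
    proof (intro allI impI)
      fix J assume "J \<subseteq># add_mset S m"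
      then show "size J \<le> \<rho> (un J)"
      proof (cases rule: subset_add_msetE)
        case 1
        then show ?thesis by (rule hall_radoD[OF hr])
      next
        case (2 J')
        show ?thesis
        proof (rule ccontr)
          assume "\<not> ?thesis"
          then have lt: "\<rho> (un J' \<union> S) < size J' + 1" using 2(1) by (simp add: Un_commute)
          moreover have "size J' \<le> \<rho> (un J')" by (rule hall_radoD[OF hr 2(2)])
          moreover have "\<rho> (un J') \<le> \<rho> (un J' \<union> S)" by (rule rk_mono) auto
          \<comment> \<open>A violation after adding S squeezes all four quantities together: J' was
            tight and S adds no rank to it. Then J' lies in \<open>J0\<close>, S adds no rank to
            \<open>un J0\<close> either, and so S lies in G.\<close>
          ultimately have t: "size J' = \<rho> (un J')" and eq: "\<rho> (un J' \<union> S) = \<rho> (un J')" by auto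
          then have "J' \<subseteq># J0" using max 2(2) by (simp add: tight_def)
          then have sub': "un J' \<subseteq> un J0" by (rule un_mono)
          from rk_diminishing[OF sub', of S] eq have le: "\<rho> (un J0 \<union> S) \<le> \<rho> (un J0)" by simp
          have "S \<subseteq> G"
          proof
            fix e assume "e \<in> S"
            then have "\<rho> (insert e (un J0)) \<le> \<rho> (un J0 \<union> S)" by (intro rk_mono) auto
            moreover have "\<rho> (un J0) \<le> \<rho> (insert e (un J0))" by (rule rk_mono) auto
            ultimately show "e \<in> G" using le SF \<open>e \<in> S\<close> by (auto simp: G_def)
          qed
          then show False using SG by simp
        qed
      qed
    qed
  qed
  have drag: "dragon \<rho> G (outside G m)"
    unfolding dragon_def
  proof (intro allI impI, elim conjE)
    fix J assume J: "J \<subseteq># outside G m" "J \<noteq> {#}"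
    show "\<rho> G + size J < \<rho> (G \<union> un J)"
    proof (rule ccontr)
      assume n: "\<not> ?thesis"
      have sub2: "J0 + J \<subseteq># m"
        using subset_mset.add_mono[OF J0in J(1)] inside_outside[of m G] by simp
      have "\<rho> (un (J0 + J)) \<le> \<rho> (G \<union> un J)" by (rule rk_mono) (use unG in auto)
      then have "\<rho> (un (J0 + J)) \<le> size (J0 + J)" using n J0s rkG by simp
      with hall_radoD[OF hr sub2] have "tight (J0 + J)" using sub2 by (simp add: tight_def)
      from size_mset_mono[OF max[OF this]] J(2) show False by simp
    qed
  qed
  have "G \<noteq> F" using size rkG J0s size_mset_mono[OF J0m] by auto
  then have "G \<subset> F" by (auto simp: G_def)
  from that[OF this flat szG drag iff] show thesis .
qed

text \<open>The part of J outside T gains more than its size over T, and by submodularity it gains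
  at least as much over the smaller set \<open>un ?A\<close>.\<close>

lemma hall_rado_split:
  assumes i: "hall_rado \<rho> (inside T m)" and d: "dragon \<rho> T (outside T m)"
  shows "hall_rado \<rho> m"
  unfolding hall_rado_def
proof (intro allI impI)
  fix J assume J: "J \<subseteq># m"
  let ?A = "inside T J" and ?B = "outside T J"
  have A: "size ?A \<le> \<rho> (un ?A)" by (rule hall_radoD[OF i]) (rule multiset_filter_mono[OF J])
  have szJ: "size J = size ?A + size ?B" by (metis inside_outside size_union)
  have unJ: "un J = un ?A \<union> un ?B" by auto
  show "size J \<le> \<rho> (un J)"
  proof (cases "?B = {#}")
    case True
    then have "un ?A = un J" "size J = size ?A" using unJ szJ by auto
    then show ?thesis using A by simp
  next
    case False
    have "\<rho> T + size ?B < \<rho> (T \<union> un ?B)"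
      by (rule dragonD[OF d multiset_filter_mono[OF J] False])
    moreover have "\<rho> (T \<union> un ?B) + \<rho> (un ?A) \<le> \<rho> (un ?A \<union> un ?B) + \<rho> T"
      by (rule rk_diminishing) auto
    ultimately show ?thesis using A szJ unJ by simp
  qed
qed

text \<open>Converse to \<open>hall_rado_closure\<close>: any T with these properties decides which
  sets may be added, and therefore has to be the closure G. The strict inequality in
  \<open>dragon\<close> leaves room for one more set.\<close>

lemma hall_rado_add_iff:
  assumes flat: "flat_in \<rho> F T" and i: "hall_rado \<rho> (inside T m)" and sz: "size (inside T m) = \<rho> T"
    and d: "dragon \<rho> T (outside T m)" and SF: "S \<subseteq> F"
  shows "hall_rado \<rho> (add_mset S m) \<longleftrightarrow> \<not> S \<subseteq> T"
proof
  assume h: "hall_rado \<rho> (add_mset S m)"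
  show "\<not> S \<subseteq> T"
  proof
    assume S: "S \<subseteq> T"
    have "size (add_mset S (inside T m)) \<le> \<rho> (un (add_mset S (inside T m)))"
      by (rule hall_radoD[OF h]) simp
    also have "\<dots> \<le> \<rho> T" by (rule rk_mono) (use S in auto)
    finally show False using sz by simp
  qed
next
  assume S: "\<not> S \<subseteq> T"
  show "hall_rado \<rho> (add_mset S m)"
    unfolding hall_rado_def
  proof (intro allI impI)
    fix J assume "J \<subseteq># add_mset S m"
    then show "size J \<le> \<rho> (un J)"
    proof (cases rule: subset_add_msetE)
      case 1
      then show ?thesis using hall_rado_split[OF i d] hall_radoD by blast
    next
      case (2 J')
      let ?A = "inside T J'" and ?B = "outside T J'"
      have A: "size ?A \<le> \<rho> (un ?A)" by (rule hall_radoD[OF i]) (rule multiset_filter_mono[OF 2(2)])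
      have szJ: "size J = size ?A + size ?B + 1" using 2(1) by (metis inside_outside size_union size_add_mset Suc_eq_plus1)
      \<comment> \<open>If no member of J' lies outside T, the strictness comes from S, which raises
        the rank of the flat T.\<close>
      have "\<rho> T + size ?B < \<rho> (T \<union> (un ?B \<union> S))"
      proof (cases "?B = {#}")
        case True
        show ?thesis unfolding True using flat_in_rk_less[OF flat SF S] by simp
      next
        case False
        have "\<rho> T + size ?B < \<rho> (T \<union> un ?B)"
          by (rule dragonD[OF d multiset_filter_mono[OF 2(2)] False])
        also have "\<dots> \<le> \<rho> (T \<union> (un ?B \<union> S))" by (rule rk_mono) auto
        finally show ?thesis .
      qed
      moreover have "\<rho> (T \<union> (un ?B \<union> S)) + \<rho> (un ?A) \<le> \<rho> (un ?A \<union> (un ?B \<union> S)) + \<rho> T"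
        by (rule rk_diminishing) auto
      moreover have "un ?A \<union> (un ?B \<union> S) = un J" using 2(1) by auto
      ultimately show ?thesis using A szJ by simp
    qed
  qed
qed

text \<open>For m of Hall-Rado type and size one below the rank, the indicator in the sum is 1 -
  [S \<subseteq> G]. The constant 1 contributes nothing as T \<noteq> F, and the rest yields
  [T = G]; the conditions on the right characterise G. For every other m both sides are 0.\<close>

lemma alternating_hall_rado:
  assumes TF: "T \<subset> F" and FE: "F \<subseteq> E" and sub: "\<And>S. S \<in># m \<Longrightarrow> S \<subseteq> F"
  shows "- (\<Sum>S\<in>{S. T \<subseteq> S \<and> S \<subseteq> F}. (-1) ^ card (S - T) *
            of_bool (hall_rado \<rho> (add_mset S m) \<and> size m + 1 = \<rho> F)) =
         (of_bool (size m + 1 = \<rho> F \<and> flat_in \<rho> F T \<and> hall_rado \<rho> (inside T m) \<and>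
            size (inside T m) = \<rho> T \<and> dragon \<rho> T (outside T m)) :: int)"
proof (cases "size m + 1 = \<rho> F \<and> hall_rado \<rho> m")
  case False
  then have n: "\<not> (hall_rado \<rho> (add_mset S m) \<and> size m + 1 = \<rho> F)" for S
    using hall_rado_subset[of \<rho> "add_mset S m" m] by auto
  have "(\<Sum>S\<in>{S. T \<subseteq> S \<and> S \<subseteq> F}. (-1) ^ card (S - T) *
            of_bool (hall_rado \<rho> (add_mset S m) \<and> size m + 1 = \<rho> F)) = (0 :: int)"
    by (rule sum.neutral) (simp only: n of_bool_eq mult_zero_right ball_triv simp_thms)
  moreover have "\<not> (size m + 1 = \<rho> F \<and> flat_in \<rho> F T \<and> hall_rado \<rho> (inside T m) \<and>
            size (inside T m) = \<rho> T \<and> dragon \<rho> T (outside T m))"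
    using False hall_rado_split by blast
  ultimately show ?thesis by (simp only: of_bool_eq minus_zero simp_thms)
next
  case True
  have finF: "finite F" using FE finite_E finite_subset by blast
  have lt: "size m < \<rho> F" using True by simp
  obtain G where G: "G \<subset> F" "flat_in \<rho> F G" "size (inside G m) = \<rho> G" "dragon \<rho> G (outside G m)"
    "\<And>S. S \<subseteq> F \<Longrightarrow> hall_rado \<rho> (add_mset S m) \<longleftrightarrow> \<not> S \<subseteq> G"
    using hall_rado_closure[OF _ sub FE lt] True by metis
  have "(\<Sum>S\<in>{S. T \<subseteq> S \<and> S \<subseteq> F}. (-1) ^ card (S - T) *
            of_bool (hall_rado \<rho> (add_mset S m) \<and> size m + 1 = \<rho> F)) =
      (\<Sum>S\<in>{S. T \<subseteq> S \<and> S \<subseteq> F}. (-1) ^ card (S - T) - (-1) ^ card (S - T) * of_bool (S \<subseteq> G) :: int)"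
    by (rule sum.cong) (use True G(5) in auto)
  also have "\<dots> = of_bool (T = F) - of_bool (T = G)"
    unfolding sum_subtractf using alternating_sum_subsets[OF finF, of T, where 'r = int] alternating_sum_indicator[OF finF, of G T, where 'r = int] TF G(1)
    by auto
  finally have L: "- (\<Sum>S\<in>{S. T \<subseteq> S \<and> S \<subseteq> F}. (-1) ^ card (S - T) *
            of_bool (hall_rado \<rho> (add_mset S m) \<and> size m + 1 = \<rho> F)) = (of_bool (T = G) :: int)"
    using TF by auto
  have "T = G" if c: "flat_in \<rho> F T" "hall_rado \<rho> (inside T m)"
            "size (inside T m) = \<rho> T" "dragon \<rho> T (outside T m)"
  proof -
    have "S \<subseteq> T \<longleftrightarrow> S \<subseteq> G" if "S \<subseteq> F" for S
      using hall_rado_add_iff[OF c that] G(5)[OF that] by blast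
    from this[of T] this[of G] TF G(1) show ?thesis by auto
  qed
  moreover have "hall_rado \<rho> (inside T m)"
    by (rule hall_rado_subset[OF conjunct2[OF True]]) simp
  ultimately have eq: "(T = G) \<longleftrightarrow> (size m + 1 = \<rho> F \<and> flat_in \<rho> F T \<and> hall_rado \<rho> (inside T m) \<and>
            size (inside T m) = \<rho> T \<and> dragon \<rho> T (outside T m))"
    using G True by blast
  show ?thesis unfolding L eq ..
qed

text \<open>One application of x_T below F. Sets S not contained in F cancel in pairs, because
  \<chi> sees S only modulo F and an element of F - T can be toggled. Sets S inside F concern only
  \<open>inside F m\<close>, where \<open>alternating_hall_rado\<close> applies.\<close>

lemma alternating_loc:
  assumes TF: "T \<subset> F" and FE: "F \<subseteq> E"
    and inv: "\<And>S S' m. \<not> S \<subseteq> F \<Longrightarrow> \<not> S' \<subseteq> F \<Longrightarrow> S \<union> F = S' \<union> F \<Longrightarrow> \<chi> (add_mset S m) = \<chi> (add_mset S' m)"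
  shows "- (\<Sum>S\<in>{S. T \<subseteq> S \<and> S \<subseteq> E}. (-1) ^ card (S - T) * of_bool (loc \<rho> F \<chi> (add_mset S m))) =
         (of_bool (loc \<rho> T (\<lambda>m. flat_in \<rho> F T \<and> dragon \<rho> T (inside F m) \<and>
            size (inside F m) + \<rho> T + 1 = \<rho> F \<and> \<chi> (outside F m)) m) :: int)"
proof -
  let ?\<mu> = "inside F m"
  define c where "c = (of_bool (\<chi> (outside F m)) :: int)"
  define A where "A S = (of_bool (hall_rado \<rho> (add_mset S ?\<mu>) \<and> size ?\<mu> + 1 = \<rho> F) :: int)" for S
  define B where "B S = (of_bool (\<not> S \<subseteq> F \<and> hall_rado \<rho> ?\<mu> \<and> size ?\<mu> = \<rho> F \<and> \<chi> (add_mset S (outside F m))) :: int)" for S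
  let ?s = "\<lambda>S. (-1) ^ card (S - T) :: int"
  have split: "of_bool (loc \<rho> F \<chi> (add_mset S m)) = of_bool (S \<subseteq> F) * A S * c + B S" for S
    by (auto simp: loc_def A_def B_def c_def)
  have "(\<Sum>S\<in>{S. T \<subseteq> S \<and> S \<subseteq> E}. ?s S * of_bool (loc \<rho> F \<chi> (add_mset S m))) =
    (\<Sum>S\<in>{S. T \<subseteq> S \<and> S \<subseteq> E}. ?s S * (of_bool (S \<subseteq> F) * A S * c)) + (\<Sum>S\<in>{S. T \<subseteq> S \<and> S \<subseteq> E}. ?s S * B S)"
    unfolding split by (simp add: distrib_left sum.distrib)
  also have "(\<Sum>S\<in>{S. T \<subseteq> S \<and> S \<subseteq> E}. ?s S * B S) = 0"
  proof -
    obtain f where f: "f \<in> F" "f \<notin> T" using TF by auto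
    show ?thesis
    proof (rule alternating_sum_eq_0[OF finite_E _ f(2)])
      show "f \<in> E" using f FE by auto
      fix U assume "T \<subseteq> U" "U \<subseteq> E" "f \<notin> U"
      have "insert f U \<subseteq> F \<longleftrightarrow> U \<subseteq> F" using f by auto
      moreover have "\<chi> (add_mset (insert f U) (outside F m)) = \<chi> (add_mset U (outside F m))" if "\<not> U \<subseteq> F"
        by (rule inv) (use that f in auto)
      ultimately show "B (insert f U) = B U" by (auto simp: B_def)
    qed
  qed
  also have "(\<Sum>S\<in>{S. T \<subseteq> S \<and> S \<subseteq> E}. ?s S * (of_bool (S \<subseteq> F) * A S * c)) =
      (\<Sum>S\<in>{S. T \<subseteq> S \<and> S \<subseteq> F}. ?s S * A S * c)"
    by (rule sum.mono_neutral_cong_right)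
      (use FE finite_E in \<open>auto intro: finite_subset[of _ "Pow E"]\<close>)
  also have "\<dots> = (\<Sum>S\<in>{S. T \<subseteq> S \<and> S \<subseteq> F}. ?s S * A S) * c"
    by (simp add: sum_distrib_right)
  finally have "- (\<Sum>S\<in>{S. T \<subseteq> S \<and> S \<subseteq> E}. ?s S * of_bool (loc \<rho> F \<chi> (add_mset S m))) =
      - (\<Sum>S\<in>{S. T \<subseteq> S \<and> S \<subseteq> F}. ?s S * A S) * c" by simp
  also have "- (\<Sum>S\<in>{S. T \<subseteq> S \<and> S \<subseteq> F}. ?s S * A S) =
     of_bool (size ?\<mu> + 1 = \<rho> F \<and> flat_in \<rho> F T \<and> hall_rado \<rho> (inside T ?\<mu>) \<and>
            size (inside T ?\<mu>) = \<rho> T \<and> dragon \<rho> T (outside T ?\<mu>))"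
    unfolding A_def by (rule alternating_hall_rado[OF TF FE]) simp
  also have "inside T ?\<mu> = inside T m"
    using TF by (auto simp: filter_filter_mset intro!: filter_mset_cong)
  also have "outside T ?\<mu> = inside F (outside T m)"
    by (auto simp: filter_filter_mset intro!: filter_mset_cong)
  also have "of_bool (size ?\<mu> + 1 = \<rho> F \<and> flat_in \<rho> F T \<and> hall_rado \<rho> (inside T m) \<and>
            size (inside T m) = \<rho> T \<and> dragon \<rho> T (inside F (outside T m))) * c =
     of_bool (loc \<rho> T (\<lambda>m. flat_in \<rho> F T \<and> dragon \<rho> T (inside F m) \<and>
            size (inside F m) + \<rho> T + 1 = \<rho> F \<and> \<chi> (outside F m)) m)"
  proof -
    have o: "outside F (outside T m) = outside F m"
      using TF by (auto simp: filter_filter_mset intro!: filter_mset_cong)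
    \<comment> \<open>The predicate inside \<open>loc\<close> is evaluated at
      \<open>outside T m\<close>. The sets inside T, which \<open>?\<mu>\<close> still counts,
      number \<rho> T and account for that summand in the size condition.\<close>
    have "?\<mu> = inside T ?\<mu> + outside T ?\<mu>" by simp
    then have "size ?\<mu> = size (inside T ?\<mu>) + size (outside T ?\<mu>)" by (metis size_union)
    also have "inside T ?\<mu> = inside T m"
      using TF by (auto simp: filter_filter_mset intro!: filter_mset_cong)
    also have "outside T ?\<mu> = inside F (outside T m)"
      by (auto simp: filter_filter_mset intro!: filter_mset_cong)
    finally show ?thesis unfolding loc_def o c_def by auto
  qed
  finally show ?thesis .
qed

end

section \<open>Chains of flats and elementary quotients\<close>

lemma first_set_empty [simp]: "first_set E {} = E"
  by (simp add: first_set_def)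

lemma first_set_subset: "first_set E \<F> \<subseteq> E"
  by (auto simp: first_set_def)

lemma first_set_lower: "F \<in> \<F> \<Longrightarrow> first_set E \<F> \<subseteq> F"
  by (auto simp: first_set_def)

lemma first_set_insert: "T \<subset> first_set E \<F> \<Longrightarrow> first_set E (insert T \<F>) = T"
  by (auto simp: first_set_def)

lemma proper_chain_finite:
  assumes "finite E" "proper_chain E \<F>"
  shows "finite \<F>"
  by (rule finite_subset[of _ "Pow E"]) (use assms in \<open>auto simp: proper_chain_def\<close>)

lemma proper_chain_subset: "proper_chain E \<F> \<Longrightarrow> \<G> \<subseteq> \<F> \<Longrightarrow> proper_chain E \<G>"
  unfolding proper_chain_def by (simp add: subset_iff)

lemma first_set_in:
  assumes "finite E" "proper_chain E \<F>" "\<F> \<noteq> {}"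
  shows "first_set E \<F> \<in> \<F>"
proof -
  obtain T where T: "T \<in> \<F>" "\<And>F. F \<in> \<F> \<Longrightarrow> F \<subseteq> T \<Longrightarrow> T = F"
    using finite_has_minimal[OF proper_chain_finite[OF assms(1,2)] assms(3)] by auto
  have "T \<subseteq> F" if "F \<in> \<F>" for F
  proof -
    have "T \<subseteq> F \<or> F \<subseteq> T" using assms(2) T(1) that by (simp add: proper_chain_def)
    then show ?thesis using T(2)[OF that] by auto
  qed
  moreover have "T \<subseteq> E" using T(1) assms(2) by (auto simp: proper_chain_def)
  ultimately have "first_set E \<F> = T" using T(1) by (auto simp: first_set_def)
  then show ?thesis using T(1) by simp
qed

lemma first_set_Diff:
  assumes "finite E" "proper_chain E \<F>" "\<F> \<noteq> {}"
  shows "first_set E \<F> \<subset> first_set E (\<F> - {first_set E \<F>})"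
proof (cases "\<F> - {first_set E \<F>} = {}")
  case True
  have "first_set E \<F> \<subset> E"
    using first_set_in[OF assms] assms(2) by (auto simp: proper_chain_def)
  then show ?thesis unfolding True by simp
next
  case False
  have "first_set E (\<F> - {first_set E \<F>}) \<in> \<F> - {first_set E \<F>}"
    by (rule first_set_in[OF assms(1) proper_chain_subset[OF assms(2)] False]) auto
  moreover from this have "first_set E \<F> \<subseteq> first_set E (\<F> - {first_set E \<F>})"
    by (auto intro!: first_set_lower)
  ultimately show ?thesis by auto
qed

text \<open>Chains grow downwards from E, in the order in which the operators x_T are applied: each
  new member lies strictly below all earlier ones.\<close>

lemma proper_chain_induct [consumes 2, case_names empty insert]:
  assumes fin: "finite E" and chain: "proper_chain E \<F>"
    and empty: "P {}"
    and step: "\<And>\<F> T. proper_chain E \<F> \<Longrightarrow> T \<subset> first_set E \<F> \<Longrightarrow> P \<F> \<Longrightarrow> P (insert T \<F>)"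
  shows "P \<F>"
  using chain
proof (induction "card \<F>" arbitrary: \<F>)
  case 0
  then show ?case using proper_chain_finite[OF fin] empty by auto
next
  case (Suc n)
  let ?T = "first_set E \<F>"
  have ne: "\<F> \<noteq> {}" using Suc by auto
  note T = first_set_in[OF fin Suc(3) ne]
  have ch: "proper_chain E (\<F> - {?T})" by (rule proper_chain_subset[OF Suc(3)]) auto
  have "P (\<F> - {?T})"
    by (rule Suc(1)[OF _ ch]) (use Suc(2) T proper_chain_finite[OF fin Suc(3)] in auto)
  then have "P (insert ?T (\<F> - {?T}))"
    by (rule step[OF ch first_set_Diff[OF fin Suc(3) ne]])
  then show ?case using T by (simp add: insert_absorb)
qed

lemma first_set_below_notin: "T \<subset> first_set E \<F> \<Longrightarrow> T \<notin> \<F>"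
  by (auto dest: first_set_lower)

text \<open>Contraction by T cannot tell S from S'. This is the invariance that
  \<open>alternating_loc\<close> requires of \<chi>.\<close>

lemma dragon_cong_add:
  assumes "S \<union> T = S' \<union> T"
  shows "dragon \<rho> T (add_mset S m) \<longleftrightarrow> dragon \<rho> T (add_mset S' m)"
proof -
  have *: "dragon \<rho> T (add_mset S' m)"
    if d: "dragon \<rho> T (add_mset S m)" and eq: "S \<union> T = S' \<union> T" for S S'
    unfolding dragon_def
  proof (intro allI impI, elim conjE)
    fix J assume J: "J \<subseteq># add_mset S' m" "J \<noteq> {#}"
    from J(1) show "\<rho> T + size J < \<rho> (T \<union> un J)"
    proof (cases rule: subset_add_msetE)
      case 1
      have "J \<subseteq># add_mset S m" by (rule subset_mset.order_trans[OF 1]) simp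
      then show ?thesis using dragonD[OF d] J(2) by blast
    next
      case (2 J')
      have "add_mset S J' \<subseteq># add_mset S m" using 2 by simp
      from dragonD[OF d this] have "\<rho> T + size J < \<rho> (T \<union> un (add_mset S J'))"
        using 2(1) by simp
      also have "T \<union> un (add_mset S J') = (S \<union> T) \<union> un J'" by auto
      also have "\<dots> = T \<union> un J" unfolding eq 2(1) by auto
      finally show ?thesis .
    qed
  qed
  show ?thesis using *[OF _ assms] *[OF _ assms[symmetric]] by blast
qed

lemma outside_outside: "F \<subseteq> F' \<Longrightarrow> outside F' (outside F m) = outside F' m"
  by (auto simp: filter_filter_mset intro!: filter_mset_cong)

text \<open>For \<open>T = {}\<close> the sum contains the term \<open>S = {}\<close>, although h_{}
  = 0. This is harmless on functions that vanish at every multiset containing the empty set, and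
  only those occur.\<close>

definition xop :: "'a set \<Rightarrow> 'a set \<Rightarrow> ('a set multiset \<Rightarrow> int) \<Rightarrow> 'a set multiset \<Rightarrow> int" where
  "xop E T \<psi> m = - (\<Sum>S\<in>{S. T \<subseteq> S \<and> S \<subseteq> E}. (-1) ^ card (S - T) * \<psi> (add_mset S m))"

context polyrank
begin

text \<open>The \<chi> that belongs to a chain. Each x_F lowers the size of the multisets by one,
  which \<open>card \<F>\<close> records; \<rho> of the smallest member accounts for the sets inside
  it.\<close>

definition upper :: "'a set set \<Rightarrow> 'a set multiset \<Rightarrow> bool" where
  "upper \<F> m \<longleftrightarrow> (\<forall>S\<in>#m. S \<subseteq> E) \<and> size m + card \<F> + \<rho> (first_set E \<F>) = \<rho> E \<and>
     (\<forall>F\<in>\<F>. flat_in \<rho> E F \<and> dragon \<rho> F (outside F m))"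

text \<open>For the empty chain this is \<phi>_P, and for a general chain it is the product of the
  x_F applied to \<phi>_P (\<open>pact_prod_RS\<close>).\<close>

definition chain_fun :: "'a set set \<Rightarrow> 'a set multiset \<Rightarrow> int" where
  "chain_fun \<F> m = of_bool (loc \<rho> (first_set E \<F>) (upper \<F>) m)"

lemma upper_empty [simp]: "upper {} m \<longleftrightarrow> m = {#}"
  by (auto simp: upper_def)

text \<open>The extra 1 comes from the dragon condition for m itself, or from flatness of T if m is
  empty.\<close>

lemma rk_first_gap:
  assumes T: "T \<subset> F" "flat_in \<rho> F T" and d: "dragon \<rho> T m"
    and m: "\<And>S. S \<in># m \<Longrightarrow> S \<subseteq> F"
  shows "size m + \<rho> T + 1 \<le> \<rho> F"
proof (cases "m = {#}")
  case True
  have "\<rho> T < \<rho> (T \<union> F)" by (rule flat_in_rk_less[OF T(2)]) (use T(1) in auto)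
  moreover have "T \<union> F = F" using T(1) by auto
  ultimately show ?thesis using True by simp
next
  case False
  have "\<rho> T + size m < \<rho> (T \<union> un m)" by (rule dragonD[OF d _ False]) simp
  also have "\<dots> \<le> \<rho> F" by (rule rk_mono) (use T(1) m in auto)
  finally show ?thesis by simp
qed

lemma flat_in_subset: "flat_in \<rho> E T \<Longrightarrow> T \<subseteq> F \<Longrightarrow> F \<subseteq> E \<Longrightarrow> flat_in \<rho> F T"
  by (auto simp: flat_in_def)

text \<open>The gaps of \<open>rk_first_gap\<close> telescope along the chain. The bound is needed
  to turn one equation for the total size into an equation for each part.\<close>

lemma upper_size_bound:
  assumes "proper_chain E \<F>" "\<And>S. S \<in># m \<Longrightarrow> S \<subseteq> E \<and> \<not> S \<subseteq> first_set E \<F>"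
    "\<And>F. F \<in> \<F> \<Longrightarrow> flat_in \<rho> E F \<and> dragon \<rho> F (outside F m)"
  shows "size m + card \<F> + \<rho> (first_set E \<F>) \<le> \<rho> E"
  using finite_E assms
proof (induction \<F> arbitrary: m rule: proper_chain_induct)
  case empty
  then have "set_mset m = {}" by fastforce
  then show ?case by simp
next
  case (insert \<F> T)
  let ?F = "first_set E \<F>"
  have fin: "finite \<F>" by (rule proper_chain_finite[OF finite_E insert(1)])
  note first = first_set_insert[OF insert(2)]
  have FE: "?F \<subseteq> E" by (rule first_set_subset)
  have 1: "size (outside ?F m) + card \<F> + \<rho> ?F \<le> \<rho> E"
  proof (rule insert(3))
    show "S \<subseteq> E \<and> \<not> S \<subseteq> ?F" if "S \<in># outside ?F m" for S
      using that insert(4) by auto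
    show "flat_in \<rho> E F \<and> dragon \<rho> F (outside F (outside ?F m))" if "F \<in> \<F>" for F
      using insert(5)[of F] that outside_outside[OF first_set_lower[OF that]] by simp
  qed
  have d: "dragon \<rho> T (inside ?F m)"
  proof (rule dragon_subset)
    show "dragon \<rho> T (outside T m)" using insert(5)[of T] by simp
    have "outside T m = m" using insert(4) first by (auto simp: filter_mset_eq_conv)
    then show "inside ?F m \<subseteq># outside T m" by simp
  qed
  have fl: "flat_in \<rho> ?F T"
    by (rule flat_in_subset) (use insert(5)[of T] insert(2) FE in auto)
  have 2: "size (inside ?F m) + \<rho> T + 1 \<le> \<rho> ?F"
    by (rule rk_first_gap[OF insert(2) fl d]) simp
  have "size m = size (inside ?F m) + size (outside ?F m)" by (metis inside_outside size_union)
  moreover have "card (insert T \<F>) = card \<F> + 1"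
    using fin first_set_below_notin[OF insert(2)] by simp
  ultimately show ?case using 1 2 unfolding first by linarith
qed

text \<open>The argument of \<open>hall_rado_split\<close>, relative to T. Strictness is taken from
  the outside part of J if there is one, and otherwise from the inside part.\<close>

lemma dragon_split:
  assumes TF: "T \<subseteq> F" and d1: "dragon \<rho> T (inside F m)" and d2: "dragon \<rho> F (outside F m)"
  shows "dragon \<rho> T m"
  unfolding dragon_def
proof (intro allI impI, elim conjE)
  fix J assume J: "J \<subseteq># m" "J \<noteq> {#}"
  let ?A = "inside F J" and ?B = "outside F J"
  have szJ: "size J = size ?A + size ?B" by (metis inside_outside size_union)
  have A: "\<rho> T + size ?A \<le> \<rho> (T \<union> un ?A)"
  proof (cases "?A = {#}")
    case True
    show ?thesis unfolding True by simp
  next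
    case False
    show ?thesis using dragonD[OF d1 multiset_filter_mono[OF J(1)] False] by linarith
  qed
  show "\<rho> T + size J < \<rho> (T \<union> un J)"
  proof (cases "?B = {#}")
    case True
    then have "?A = J" by (metis inside_outside add.right_neutral)
    then have "J \<subseteq># inside F m" using multiset_filter_mono[OF J(1), of "\<lambda>S. S \<subseteq> F"] by simp
    then show ?thesis using dragonD[OF d1] J(2) by blast
  next
    case False
    have "\<rho> F + size ?B < \<rho> (F \<union> un ?B)"
      by (rule dragonD[OF d2 multiset_filter_mono[OF J(1)] False])
    moreover have "\<rho> (F \<union> un ?B) + \<rho> (T \<union> un ?A) \<le> \<rho> ((T \<union> un ?A) \<union> un ?B) + \<rho> F"
      by (rule rk_diminishing) (use TF in auto)
    moreover have "(T \<union> un ?A) \<union> un ?B = T \<union> un J" by auto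
    ultimately show ?thesis using A szJ by (simp only:)
  qed
qed

lemma flat_in_trans:
  assumes "flat_in \<rho> F T" "flat_in \<rho> E F"
  shows "flat_in \<rho> E T"
  unfolding flat_in_def
proof (intro conjI ballI)
  have TF: "T \<subseteq> F" using assms by (simp add: flat_in_def)
  then show "T \<subseteq> E" using assms by (auto simp: flat_in_def)
  fix e assume e: "e \<in> E - T"
  show "\<rho> T < \<rho> (insert e T)"
  proof (cases "e \<in> F")
    case True
    then show ?thesis using e assms(1) by (auto simp: flat_in_def)
  next
    case False
    then have "\<rho> F < \<rho> (F \<union> {e})" using e assms(2) by (auto simp: flat_in_def)
    then show ?thesis using rk_diminishing[OF TF, of "{e}"] by simp
  qed
qed

lemma first_set_flat:
  assumes "proper_chain E \<F>" "\<And>F. F \<in> \<F> \<Longrightarrow> flat_in \<rho> E F"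
  shows "flat_in \<rho> E (first_set E \<F>)"
proof (cases "\<F> = {}")
  case True
  show ?thesis unfolding True by (simp add: flat_in_def)
next
  case False
  then show ?thesis using first_set_in[OF finite_E assms(1)] assms(2) by blast
qed

lemma upper_first_dragon:
  assumes "proper_chain E \<F>" "\<And>S. S \<in># m \<Longrightarrow> S \<subseteq> E"
    "\<And>F. F \<in> \<F> \<Longrightarrow> dragon \<rho> F (outside F m)"
  shows "dragon \<rho> (first_set E \<F>) (outside (first_set E \<F>) m)"
proof (cases "\<F> = {}")
  case True
  have e: "outside E m = {#}" using assms(2) by auto
  show ?thesis unfolding True first_set_empty e by (simp add: dragon_def)
next
  case False
  then show ?thesis using first_set_in[OF finite_E assms(1)] assms(3) by blast
qed

text \<open>Reconciles the local conditions that \<open>alternating_loc\<close> produces between T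
  and F with the global description of the longer chain.\<close>

lemma upper_insert_iff:
  assumes ch: "proper_chain E \<F>" and T: "T \<subset> first_set E \<F>"
    and m: "\<And>S. S \<in># m \<Longrightarrow> \<not> S \<subseteq> T"
  defines "F \<equiv> first_set E \<F>"
  shows "flat_in \<rho> F T \<and> dragon \<rho> T (inside F m) \<and> size (inside F m) + \<rho> T + 1 = \<rho> F \<and>
      upper \<F> (outside F m) \<longleftrightarrow> upper (insert T \<F>) m"
    (is "?L \<longleftrightarrow> ?R")
proof -
  have fin: "finite \<F>" by (rule proper_chain_finite[OF finite_E ch])
  have card: "card (insert T \<F>) = card \<F> + 1"
    using fin first_set_below_notin[OF T] by simp
  have first: "first_set E (insert T \<F>) = T" by (rule first_set_insert[OF T])
  have FE: "F \<subseteq> E" unfolding F_def by (rule first_set_subset)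
  have TF: "T \<subset> F" using T by (simp add: F_def)
  have sz: "size m = size (inside F m) + size (outside F m)" by (metis inside_outside size_union)
  have oT: "outside T m = m" using m by (auto simp: filter_mset_eq_conv)
  have oF: "outside F' (outside F m) = outside F' m" if "F' \<in> \<F>" for F'
    by (rule outside_outside) (unfold F_def, rule first_set_lower[OF that])
  have firstF: "first_set E \<F> = F" by (simp add: F_def)
  show ?thesis
  proof
    assume L: ?L
    then have u: "upper \<F> (outside F m)" by simp
    have fl: "flat_in \<rho> E F'" and dr: "dragon \<rho> F' (outside F' m)" if "F' \<in> \<F>" for F'
      using u that oF[OF that] by (auto simp: upper_def)
    have sub: "S \<subseteq> E" if "S \<in># m" for S
      using u that FE by (cases "S \<subseteq> F") (auto simp: upper_def)
    have "dragon \<rho> F (outside F m)"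
      unfolding F_def by (rule upper_first_dragon[OF ch sub dr])
    moreover have "dragon \<rho> T (inside F m)" using L by blast
    moreover have "T \<subseteq> F" using TF by blast
    ultimately have dT: "dragon \<rho> T (outside T m)"
      unfolding oT using dragon_split by blast
    have flT: "flat_in \<rho> E T"
      using L first_set_flat[OF ch fl] flat_in_trans unfolding firstF by blast
    have "size (outside F m) + card \<F> + \<rho> F = \<rho> E"
      using u unfolding upper_def firstF by blast
    moreover have "size (inside F m) + \<rho> T + 1 = \<rho> F" using L by blast
    ultimately have "size m + (card \<F> + 1) + \<rho> T = \<rho> E" using sz by linarith
    then show ?R
      unfolding upper_def first card using fl dr sub dT flT by blast
  next
    assume R: ?R
    have fl: "flat_in \<rho> E F'" and dr: "dragon \<rho> F' (outside F' m)" if "F' \<in> insert T \<F>" for F'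
      using R that unfolding upper_def by blast+
    have sub: "S \<subseteq> E" if "S \<in># m" for S using R that unfolding upper_def by blast
    have total: "size m + (card \<F> + 1) + \<rho> T = \<rho> E" using R unfolding upper_def first card by blast
    have flT: "flat_in \<rho> F T" by (rule flat_in_subset[OF fl]) (use TF FE in auto)
    have dT: "dragon \<rho> T (inside F m)"
      by (rule dragon_subset[OF dr[of T, unfolded oT]]) auto
    have b1: "size (inside F m) + \<rho> T + 1 \<le> \<rho> F"
      by (rule rk_first_gap[OF TF flT dT]) simp
    have b2: "size (outside F m) + card \<F> + \<rho> F \<le> \<rho> E"
      unfolding F_def
      by (rule upper_size_bound[OF ch]) (use sub fl dr oF in \<open>auto simp: F_def\<close>)
    \<comment> \<open>Only the total size is known. The two bounds add up to it, so both are
      equalities.\<close>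
    have e1: "size (inside F m) + \<rho> T + 1 = \<rho> F" using b1 b2 total sz by linarith
    have "size (outside F m) + card \<F> + \<rho> F = \<rho> E" using b1 b2 total sz by linarith
    then have "upper \<F> (outside F m)"
      unfolding upper_def firstF using sub fl dr by (simp add: oF)
    then show ?L using flT dT e1 by blast
  qed
qed

text \<open>The inductive step for products of x_F over a chain, obtained from
  \<open>alternating_loc\<close> with \<chi> = \<open>upper \<F>\<close>.\<close>

lemma xop_chain_fun:
  assumes ch: "proper_chain E \<F>" and T: "T \<subset> first_set E \<F>"
  shows "xop E T (chain_fun \<F>) m = chain_fun (insert T \<F>) m"
proof -
  let ?F = "first_set E \<F>"
  have first: "first_set E (insert T \<F>) = T" by (rule first_set_insert[OF T])
  \<comment> \<open>Every member of the chain contains the smallest one, so changing S inside the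
    latter is invisible to all dragon conditions.\<close>
  have inv: "upper \<F> (add_mset S m) = upper \<F> (add_mset S' m)"
    if h: "\<not> S \<subseteq> ?F" "\<not> S' \<subseteq> ?F" "S \<union> ?F = S' \<union> ?F" for S S' m
  proof -
    have eq: "S \<union> F = S' \<union> F" if "?F \<subseteq> F" for F using h(3) that by blast
    have sub: "S \<subseteq> F \<longleftrightarrow> S' \<subseteq> F" if "?F \<subseteq> F" for F using eq[OF that] by blast
    have d: "dragon \<rho> F (outside F (add_mset S m)) = dragon \<rho> F (outside F (add_mset S' m))"
      if "F \<in> \<F>" for F
      using sub[OF first_set_lower[OF that]] dragon_cong_add[OF eq[OF first_set_lower[OF that]]]
      by auto
    show ?thesis unfolding upper_def using d sub[OF first_set_subset] by simp
  qed
  have "xop E T (chain_fun \<F>) m = of_bool (loc \<rho> T (\<lambda>m. flat_in \<rho> ?F T \<and> dragon \<rho> T (inside ?F m) \<and>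
            size (inside ?F m) + \<rho> T + 1 = \<rho> ?F \<and> upper \<F> (outside ?F m)) m)"
    unfolding xop_def chain_fun_def
    by (rule alternating_loc[where \<chi> = "upper \<F>", OF T first_set_subset inv])
  also have "\<dots> = chain_fun (insert T \<F>) m"
  proof -
    have "flat_in \<rho> ?F T \<and> dragon \<rho> T (inside ?F (outside T m)) \<and>
            size (inside ?F (outside T m)) + \<rho> T + 1 = \<rho> ?F \<and> upper \<F> (outside ?F (outside T m))
        \<longleftrightarrow> upper (insert T \<F>) (outside T m)"
      by (rule upper_insert_iff[OF ch T]) simp
    then show ?thesis unfolding chain_fun_def first loc_def by (simp only:)
  qed
  finally show ?thesis .
qed

text \<open>A description that does not single out the smallest member, and thus matches the
  definition of \<Sigma>_P. The Hall-Rado condition is glued together by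
  \<open>hall_rado_split\<close>; in the other direction the total size again forces both partial
  counts.\<close>

lemma chain_fun_eq:
  assumes ch: "proper_chain E \<F>"
  shows "chain_fun \<F> m = of_bool ((\<forall>S\<in>#m. S \<subseteq> E) \<and> size m + card \<F> = \<rho> E \<and> hall_rado \<rho> m \<and>
     (\<forall>F\<in>\<F>. flat_in \<rho> E F \<and> dragon \<rho> F (outside F m)))"
    (is "_ = of_bool ?R")
proof -
  let ?F = "first_set E \<F>"
  have FE: "?F \<subseteq> E" by (rule first_set_subset)
  have sz: "size m = size (inside ?F m) + size (outside ?F m)" by (metis inside_outside size_union)
  have oF: "outside F' (outside ?F m) = outside F' m" if "F' \<in> \<F>" for F'
    by (rule outside_outside[OF first_set_lower[OF that]])
  have "loc \<rho> ?F (upper \<F>) m \<longleftrightarrow> ?R"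
  proof
    assume L: "loc \<rho> ?F (upper \<F>) m"
    then have u: "upper \<F> (outside ?F m)" by (simp add: loc_def)
    have fl: "flat_in \<rho> E F'" and dr: "dragon \<rho> F' (outside F' m)" if "F' \<in> \<F>" for F'
      using u that oF[OF that] by (auto simp: upper_def)
    have sub: "S \<subseteq> E" if "S \<in># m" for S
      using u that FE by (cases "S \<subseteq> ?F") (auto simp: upper_def)
    have "hall_rado \<rho> m"
      by (rule hall_rado_split[of ?F])
        (use L upper_first_dragon[OF ch sub dr] in \<open>auto simp: loc_def\<close>)
    moreover have "size m + card \<F> = \<rho> E"
    proof -
      have "size (outside ?F m) + card \<F> + \<rho> ?F = \<rho> E" using u unfolding upper_def by blast
      moreover have "size (inside ?F m) = \<rho> ?F" using L unfolding loc_def by blast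
      ultimately show ?thesis using sz by linarith
    qed
    ultimately show ?R using fl dr sub by blast
  next
    assume R: ?R
    have b2: "size (outside ?F m) + card \<F> + \<rho> ?F \<le> \<rho> E"
      by (rule upper_size_bound[OF ch]) (use R oF in auto)
    have i: "hall_rado \<rho> (inside ?F m)" by (rule hall_rado_subset[of _ m]) (use R in auto)
    have "size (inside ?F m) \<le> \<rho> (un (inside ?F m))" by (rule hall_radoD[OF i]) simp
    also have "\<dots> \<le> \<rho> ?F" by (rule rk_mono) auto
    finally have b1: "size (inside ?F m) \<le> \<rho> ?F" .
    have total: "size m + card \<F> = \<rho> E" using R by blast
    have "size (inside ?F m) = \<rho> ?F" using b1 b2 total sz by linarith
    moreover have "size (outside ?F m) + card \<F> + \<rho> ?F = \<rho> E" using b1 b2 total sz by linarith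
    then have "upper \<F> (outside ?F m)" unfolding upper_def using R oF by auto
    ultimately show "loc \<rho> ?F (upper \<F>) m" using i by (simp add: loc_def)
  qed
  then show ?thesis by (simp add: chain_fun_def)
qed

lemma chain_fun_add_empty [simp]: "chain_fun \<F> (add_mset {} m) = 0"
proof -
  have "\<not> hall_rado \<rho> (inside (first_set E \<F>) (add_mset {} m))"
    using hall_rado_empty_notin by fastforce
  then show ?thesis by (simp add: chain_fun_def loc_def)
qed

text \<open>No S above T lies inside F, so every S is seen modulo F only, and toggling an element of
  F - T cancels the sum.\<close>

lemma xop_incomparable:
  assumes F: "F \<subset> E" and T: "T \<subseteq> E" "\<not> T \<subseteq> F" "\<not> F \<subseteq> T"
  shows "xop E T (chain_fun {F}) m = 0"
proof -
  obtain f where f: "f \<in> F" "f \<notin> T" using T by blast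
  have ch: "proper_chain E {F}" using F by (auto simp: proper_chain_def)
  have "(\<Sum>S\<in>{S. T \<subseteq> S \<and> S \<subseteq> E}. (-1) ^ card (S - T) * chain_fun {F} (add_mset S m)) = 0"
  proof (rule alternating_sum_eq_0[OF finite_E _ f(2)])
    show "f \<in> E" using f F by blast
    fix U assume U: "T \<subseteq> U" "U \<subseteq> E" "f \<notin> U"
    have n: "\<not> U \<subseteq> F" "\<not> insert f U \<subseteq> F" using U T by auto
    have first: "first_set E {F} = F" using F by (auto simp: first_set_def)
    have "upper {F} (add_mset (insert f U) (outside F m)) = upper {F} (add_mset U (outside F m))"
    proof -
      have "insert f U \<subseteq> E \<longleftrightarrow> U \<subseteq> E" using f F by blast
      moreover have "dragon \<rho> F (add_mset (insert f U) (outside F (outside F m))) =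
          dragon \<rho> F (add_mset U (outside F (outside F m)))"
        by (rule dragon_cong_add) (use f in blast)
      ultimately show ?thesis using n by (simp add: upper_def)
    qed
    then show "chain_fun {F} (add_mset (insert f U) m) = chain_fun {F} (add_mset U m)"
      using n by (simp add: chain_fun_def loc_def first)
  qed
  then show ?thesis by (simp add: xop_def)
qed

text \<open>The k copies of {i} would have to raise the rank of F by more than k, but {i} raises it
  by at most \<rho> {i}. With k the size of the fibre over i, this disposes of the non-cones that
  contain a full fibre.\<close>

lemma chain_fun_truncated_power:
  assumes F: "F \<subset> E" and i: "i \<notin> F" and k: "\<rho> {i} \<le> k" "0 < k"
  shows "chain_fun {F} (m + replicate_mset k {i}) = 0"
proof -
  have ch: "proper_chain E {F}" using F by (auto simp: proper_chain_def)
  have "\<not> dragon \<rho> F (outside F (m + replicate_mset k {i}))"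
  proof
    assume d: "dragon \<rho> F (outside F (m + replicate_mset k {i}))"
    have "outside F (replicate_mset k {i}) = replicate_mset k {i}"
      using i by (auto simp: filter_mset_eq_conv)
    then have "replicate_mset k {i} \<subseteq># outside F (m + replicate_mset k {i})" by simp
    from dragonD[OF d this] k(2) have "\<rho> F + k < \<rho> (F \<union> {i})" by auto
    moreover have "\<rho> (F \<union> {i}) + \<rho> {} \<le> \<rho> ({} \<union> {i}) + \<rho> F" by (rule rk_diminishing) simp
    ultimately show False using k(1) by simp
  qed
  then show ?thesis by (simp add: chain_fun_eq[OF ch])
qed

text \<open>A member of J outside G would, by the strict inequality in \<open>dragon\<close>, push
  the rank of \<open>un J\<close> above the size of J.\<close>

lemma hall_rado_tight_subset:
  assumes hr: "hall_rado \<rho> m" and d: "dragon \<rho> G (outside G m)"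
    and J: "J \<subseteq># m" "size J = \<rho> (un J)"
  shows "un J \<subseteq> G"
proof -
  let ?A = "inside G J" and ?B = "outside G J"
  have "?B = {#}"
  proof (rule ccontr)
    assume B: "?B \<noteq> {#}"
    have A: "size ?A \<le> \<rho> (un ?A)"
      by (rule hall_radoD[OF hr]) (rule subset_mset.order_trans[OF multiset_filter_subset J(1)])
    have "\<rho> G + size ?B < \<rho> (G \<union> un ?B)"
      by (rule dragonD[OF d multiset_filter_mono[OF J(1)] B])
    moreover have "\<rho> (G \<union> un ?B) + \<rho> (un ?A) \<le> \<rho> (un ?A \<union> un ?B) + \<rho> G"
      by (rule rk_diminishing) auto
    moreover have "un ?A \<union> un ?B = un J" by auto
    moreover have "size J = size ?A + size ?B" by (metis inside_outside size_union)
    ultimately show False using A J(2) by (simp only:)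
  qed
  then show ?thesis by auto
qed

end

text \<open>The hypotheses say that \<rho>' - \<rho> is monotone with values 0 and 1, and 1 at E.
  Each x_T contributes [T = G] with G the closure for \<rho>', so the sum tests whether the two
  ranks agree at G.\<close>

lemma elementary_quotient:
  assumes "polyrank E \<rho>" "polyrank E \<rho>'"
    and le: "\<And>A. \<rho> A \<le> \<rho>' A" "\<And>A. \<rho>' A \<le> \<rho> A + 1"
    and mono: "\<And>A B. A \<subseteq> B \<Longrightarrow> \<rho>' A = \<rho> A + 1 \<Longrightarrow> \<rho>' B = \<rho> B + 1"
    and top: "\<rho>' E = \<rho> E + 1"
  shows "(\<Sum>T\<in>{T. T \<subset> E \<and> \<rho>' T = \<rho> T}. xop E T (polyrank.chain_fun E \<rho>' {}) m) = polyrank.chain_fun E \<rho> {} m"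
proof -
  interpret P: polyrank E \<rho> by fact
  interpret P': polyrank E \<rho>' by fact
  have fin: "finite {T. T \<subset> E \<and> \<rho>' T = \<rho> T}"
    by (rule finite_subset[of _ "Pow E"]) (use P.finite_E in auto)
  have ch0: "proper_chain E {}" by (simp add: proper_chain_def)
  have x: "xop E T (P'.chain_fun {}) m = P'.chain_fun {T} m" if "T \<subset> E" for T
    using P'.xop_chain_fun[OF ch0, of T m] that by simp
  have ch1: "proper_chain E {T}" if "T \<subset> E" for T using that by (auto simp: proper_chain_def)
  have hr': "hall_rado \<rho>' m" if "hall_rado \<rho> m"
    using that le(1) unfolding hall_rado_def by (meson order_trans)
  show ?thesis
  proof (cases "(\<forall>S\<in>#m. S \<subseteq> E) \<and> size m + 1 = \<rho>' E \<and> hall_rado \<rho>' m")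
    case False
    have "P'.chain_fun {T} m = 0" if "T \<subset> E" for T
      using False by (auto simp: P'.chain_fun_eq[OF ch1[OF that]])
    then have "(\<Sum>T\<in>{T. T \<subset> E \<and> \<rho>' T = \<rho> T}. xop E T (P'.chain_fun {}) m) = 0"
      using x by (intro sum.neutral) auto
    moreover have "P.chain_fun {} m = 0"
      using False hr' top by (auto simp: P.chain_fun_eq[OF ch0])
    ultimately show ?thesis by simp
  next
    case True
    have hrm: "hall_rado \<rho>' m" and sub: "\<And>S. S \<in># m \<Longrightarrow> S \<subseteq> E" using True by blast+
    have lt: "size m < \<rho>' E" using True by linarith
    obtain G where G: "G \<subset> E" "flat_in \<rho>' E G" "size (inside G m) = \<rho>' G" "dragon \<rho>' G (outside G m)"
      "\<And>S. S \<subseteq> E \<Longrightarrow> hall_rado \<rho>' (add_mset S m) \<longleftrightarrow> \<not> S \<subseteq> G"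
      using P'.hall_rado_closure[OF hrm sub subset_refl lt] by metis
    have one: "P'.chain_fun {T} m = of_bool (T = G)" if T: "T \<subset> E" for T
    proof -
      have first: "first_set E {T} = T" using T by (auto simp: first_set_def)
      have "T = G" if "loc \<rho>' T (P'.upper {T}) m"
      proof -
        have *: "flat_in \<rho>' E T" "hall_rado \<rho>' (inside T m)"
            "size (inside T m) = \<rho>' T" "dragon \<rho>' T (outside T m)"
          using that by (auto simp: loc_def P'.upper_def outside_outside)
        have "S \<subseteq> T \<longleftrightarrow> S \<subseteq> G" if "S \<subseteq> E" for S
          using P'.hall_rado_add_iff[OF * that] G(5)[OF that] by blast
        from this[of T] this[of G] T G(1) show ?thesis by blast
      qed
      then have "P'.chain_fun {T} m = 0" if "T \<noteq> G"
        unfolding P'.chain_fun_def first using that by (simp only: of_bool_eq_0_iff) blast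
      moreover have "P'.chain_fun {G} m = 1"
        using True G by (simp add: P'.chain_fun_eq[OF ch1[OF G(1)]])
      ultimately show ?thesis by (cases "T = G") simp_all
    qed
    have "(\<Sum>T\<in>{T. T \<subset> E \<and> \<rho>' T = \<rho> T}. xop E T (P'.chain_fun {}) m) =
        (\<Sum>T\<in>{T. T \<subset> E \<and> \<rho>' T = \<rho> T}. if T = G then 1 else 0)"
      by (rule sum.cong) (use x one in auto)
    also have "\<dots> = of_bool (\<rho>' G = \<rho> G)" using fin G(1) by simp
    \<comment> \<open>A violation J for \<rho> is tight for \<rho>', hence lies in G, and the two
      ranks differ there; by monotonicity they differ at G. Conversely, \<rho>' G sets lie inside G,
      which forces \<rho> G to be as large.\<close>
    also have "\<rho>' G = \<rho> G \<longleftrightarrow> hall_rado \<rho> m"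
    proof
      assume eq: "\<rho>' G = \<rho> G"
      show "hall_rado \<rho> m"
        unfolding hall_rado_def
      proof (intro allI impI, rule ccontr)
        fix J assume J: "J \<subseteq># m" and n: "\<not> size J \<le> \<rho> (un J)"
        have "size J \<le> \<rho>' (un J)" by (rule hall_radoD[OF hrm J])
        then have t: "size J = \<rho>' (un J)" "\<rho>' (un J) = \<rho> (un J) + 1"
          using n le(2)[of "un J"] by linarith+
        have "un J \<subseteq> G" by (rule P'.hall_rado_tight_subset[OF hrm G(4) J t(1)])
        from mono[OF this t(2)] eq show False by simp
      qed
    next
      assume hr: "hall_rado \<rho> m"
      have "\<rho>' G \<le> \<rho> (un (inside G m))"
        unfolding G(3)[symmetric] by (rule hall_radoD[OF hr]) simp
      also have "\<dots> \<le> \<rho> G" by (rule P.rk_mono) auto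
      finally show "\<rho>' G = \<rho> G" using le(1)[of G] by simp
    qed
    also have "of_bool (hall_rado \<rho> m) = P.chain_fun {} m"
      using True top by (simp add: P.chain_fun_eq[OF ch0])
    finally show ?thesis .
  qed
qed

section \<open>The Chow ring acts\<close>

lemma subset_image_mset_set_iff:
  assumes "finite I"
  shows "J \<subseteq># image_mset f (mset_set I) \<longleftrightarrow> (\<exists>T\<subseteq>I. J = image_mset f (mset_set T))"
proof
  assume "J \<subseteq># image_mset f (mset_set I)"
  with assms show "\<exists>T\<subseteq>I. J = image_mset f (mset_set T)"
  proof (induction I arbitrary: J rule: finite_induct)
    case (insert x I)
    have "J \<subseteq># add_mset (f x) (image_mset f (mset_set I))" using insert by simp
    then show ?case
    proof (cases rule: subset_add_msetE)
      case 1
      then show ?thesis using insert.IH by blast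
    next
      case (2 J')
      then obtain T where T: "T \<subseteq> I" "J' = image_mset f (mset_set T)" using insert.IH by blast
      have "finite T" "x \<notin> T" using T(1) insert finite_subset by auto
      then have "J = image_mset f (mset_set (insert x T))" using 2 T by simp
      then show ?thesis using T(1) by blast
    qed
  qed simp
next
  assume "\<exists>T\<subseteq>I. J = image_mset f (mset_set T)"
  then obtain T where "T \<subseteq> I" "J = image_mset f (mset_set T)" by blast
  then show "J \<subseteq># image_mset f (mset_set I)"
    using assms by (simp add: image_mset_subseteq_mono subset_imp_msubset_mset_set)
qed

lemma un_image_mset_set:
  "finite T \<Longrightarrow> un (image_mset f (mset_set T)) = (\<Union>j\<in>T. f j)"
  by simp

lemma hall_rado_image_iff:
  assumes fin: "finite I"
  shows "hall_rado \<rho> (image_mset f (mset_set I)) \<longleftrightarrow> (\<forall>T\<subseteq>I. card T \<le> \<rho> (\<Union>j\<in>T. f j))"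
proof -
  have "hall_rado \<rho> (image_mset f (mset_set I)) \<longleftrightarrow>
     (\<forall>T\<subseteq>I. size (image_mset f (mset_set T)) \<le> \<rho> (un (image_mset f (mset_set T))))"
    unfolding hall_rado_def subset_image_mset_set_iff[OF fin] by blast
  also have "\<dots> \<longleftrightarrow> (\<forall>T\<subseteq>I. card T \<le> \<rho> (\<Union>j\<in>T. f j))"
  proof (intro all_cong1 imp_cong refl)
    fix T assume "T \<subseteq> I"
    then have "finite T" using fin finite_subset by blast
    then show "size (image_mset f (mset_set T)) \<le> \<rho> (un (image_mset f (mset_set T))) \<longleftrightarrow>
        card T \<le> \<rho> (\<Union>j\<in>T. f j)"
      by (simp only: un_image_mset_set size_image_mset size_mset_set)
  qed
  finally show ?thesis .
qed

lemma dragon_image_iff: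
  assumes fin: "finite I"
  shows "dragon \<rho> F (image_mset f (mset_set I)) \<longleftrightarrow>
     (\<forall>T\<subseteq>I. T \<noteq> {} \<longrightarrow> \<rho> F + card T < \<rho> (F \<union> (\<Union>j\<in>T. f j)))"
proof -
  have "dragon \<rho> F (image_mset f (mset_set I)) \<longleftrightarrow>
     (\<forall>T\<subseteq>I. image_mset f (mset_set T) \<noteq> {#} \<longrightarrow>
       \<rho> F + size (image_mset f (mset_set T)) < \<rho> (F \<union> un (image_mset f (mset_set T))))"
    unfolding dragon_def subset_image_mset_set_iff[OF fin] by blast
  also have "\<dots> \<longleftrightarrow> (\<forall>T\<subseteq>I. T \<noteq> {} \<longrightarrow> \<rho> F + card T < \<rho> (F \<union> (\<Union>j\<in>T. f j)))"
  proof (intro all_cong1 imp_cong refl)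
    fix T assume "T \<subseteq> I"
    then have T: "finite T" using fin finite_subset by blast
    then show "image_mset f (mset_set T) \<noteq> {#} \<longleftrightarrow> T \<noteq> {}" by (simp add: mset_set_empty_iff)
    show "\<rho> F + size (image_mset f (mset_set T)) < \<rho> (F \<union> un (image_mset f (mset_set T))) \<longleftrightarrow>
        \<rho> F + card T < \<rho> (F \<union> (\<Union>j\<in>T. f j))"
      using T by (simp only: un_image_mset_set size_image_mset size_mset_set)
  qed
  finally show ?thesis .
qed

section \<open>Cones as sets of rays\<close>

lemma cone_rays_RS_iff [simp]: "RS F \<in> cone_rays I \<F> \<longleftrightarrow> F \<in> \<F>"
  by (auto simp: cone_rays_def)

lemma cone_rays_RE_iff [simp]: "RE j \<in> cone_rays I \<F> \<longleftrightarrow> j \<in> I"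
  by (auto simp: cone_rays_def)

lemma cone_rays_eq_iff: "cone_rays I \<F> = cone_rays I' \<F>' \<longleftrightarrow> I = I' \<and> \<F> = \<F>'"
  by (metis cone_rays_RS_iff cone_rays_RE_iff set_eqI)

lemma cone_rays_decomp: "\<tau> = cone_rays {j. RE j \<in> \<tau>} {F. RS F \<in> \<tau>}"
proof (rule set_eqI)
  fix x
  show "x \<in> \<tau> \<longleftrightarrow> x \<in> cone_rays {j. RE j \<in> \<tau>} {F. RS F \<in> \<tau>}"
    by (cases x) simp_all
qed

lemma cone_a_iff: "cone_a E Et \<pi> \<tau> \<longleftrightarrow> admissible_a E Et \<pi> {j. RE j \<in> \<tau>} {F. RS F \<in> \<tau>}"
proof
  assume "cone_a E Et \<pi> \<tau>"
  then obtain I \<F> where *: "admissible_a E Et \<pi> I \<F>" "\<tau> = cone_rays I \<F>" by (auto simp: cone_a_def)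
  then show "admissible_a E Et \<pi> {j. RE j \<in> \<tau>} {F. RS F \<in> \<tau>}" by simp
next
  assume "admissible_a E Et \<pi> {j. RE j \<in> \<tau>} {F. RS F \<in> \<tau>}"
  then show "cone_a E Et \<pi> \<tau>" using cone_rays_decomp unfolding cone_a_def by blast
qed

text \<open>The preimage of A is the union of the fibres over A, so singletons decide. Hence a
  non-cone contains two incomparable sets, or a set F with a full fibre over a point outside
  F.\<close>

lemma admissible_a_iff:
  "admissible_a E Et \<pi> I \<F> \<longleftrightarrow> I \<subseteq> Et \<and> proper_chain E \<F> \<and>
     (\<forall>F\<in>\<F>. \<forall>i\<in>E - F. \<not> preim Et \<pi> {i} \<subseteq> I)"
    (is "?L \<longleftrightarrow> ?R")
proof
  assume L: ?L
  have "\<not> preim Et \<pi> {i} \<subseteq> I" if "F \<in> \<F>" "i \<in> E - F" for F i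
  proof
    assume "preim Et \<pi> {i} \<subseteq> I"
    then have "{i} \<subseteq> first_set E \<F>" using L that(2) unfolding admissible_a_def by blast
    then show False using first_set_lower[OF that(1)] that(2) by blast
  qed
  then show ?R using L by (simp add: admissible_a_def)
next
  assume R: ?R
  have "A \<subseteq> first_set E \<F>" if A: "A \<subseteq> E" "preim Et \<pi> A \<subseteq> I" for A
  proof
    fix i assume "i \<in> A"
    then have "preim Et \<pi> {i} \<subseteq> I" "i \<in> E" using A by (auto simp: preim_def)
    then show "i \<in> first_set E \<F>" using R by (auto simp: first_set_def)
  qed
  then show ?L using R by (simp add: admissible_a_def)
qed

lemma non_cone_cases:
  assumes "\<tau> \<subseteq> rays E Et" "\<not> cone_a E Et \<pi> \<tau>"
  obtains (incomparable) F T where "RS F \<in> \<tau>" "RS T \<in> \<tau>" "\<not> F \<subseteq> T" "\<not> T \<subseteq> F"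
  | (fibre) F i where "RS F \<in> \<tau>" "i \<in> E" "i \<notin> F" "RE ` preim Et \<pi> {i} \<subseteq> \<tau>"
proof -
  have I: "{j. RE j \<in> \<tau>} \<subseteq> Et" and F: "\<And>F. RS F \<in> \<tau> \<Longrightarrow> F \<subset> E"
    using assms(1) by (auto simp: rays_def)
  have "\<not> (proper_chain E {F. RS F \<in> \<tau>} \<and>
     (\<forall>F\<in>{F. RS F \<in> \<tau>}. \<forall>i\<in>E - F. \<not> preim Et \<pi> {i} \<subseteq> {j. RE j \<in> \<tau>}))"
    using assms(2) I unfolding cone_a_iff admissible_a_iff by blast
  then consider "\<not> proper_chain E {F. RS F \<in> \<tau>}" |
     F i where "RS F \<in> \<tau>" "i \<in> E - F" "preim Et \<pi> {i} \<subseteq> {j. RE j \<in> \<tau>}" by blast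
  then show thesis
  proof cases
    case 1
    then show ?thesis using F incomparable unfolding proper_chain_def by blast
  next
    case 2
    then show ?thesis using fibre[of F i] by blast
  qed
qed

lemma card_cone_rays:
  assumes "finite I" "finite \<F>"
  shows "card (cone_rays I \<F>) = card I + card \<F>"
  unfolding cone_rays_def using assms
  by (subst card_Un_disjoint) (auto simp: card_image inj_on_def)

lemma mono_split:
  assumes "finite \<tau>" "\<sigma> \<subseteq> \<tau>"
  shows "mono \<tau> = mono (\<tau> - \<sigma>) * mono \<sigma>"
  unfolding mono_def by (rule prod.subset_diff[OF assms(2,1)])

lemma mono_cone_rays:
  assumes "finite I" "finite \<F>"
  shows "mono (cone_rays I \<F>) = (\<Prod>j\<in>I. var (RE j)) * (\<Prod>F\<in>\<F>. var (RS F))"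
proof -
  have "mono (cone_rays I \<F>) = (\<Prod>x\<in>RE ` I. var x) * (\<Prod>x\<in>RS ` \<F>. var x)"
    unfolding mono_def cone_rays_def using assms
    by (subst prod.union_disjoint) (auto simp: mult.commute)
  also have "(\<Prod>x\<in>RE ` I. var x) = (\<Prod>j\<in>I. var (RE j))"
    by (subst prod.reindex) (auto simp: inj_on_def)
  also have "(\<Prod>x\<in>RS ` \<F>. var x) = (\<Prod>F\<in>\<F>. var (RS F))"
    by (subst prod.reindex) (auto simp: inj_on_def)
  finally show ?thesis .
qed

section \<open>The classes h_S and x_T in the ring of shifts\<close>

definition hgen :: "'a set \<Rightarrow> ('a set multiset \<Rightarrow>\<^sub>0 int)" where
  "hgen S = (if S = {} then 0 else frag_of {#S#})"

definition xgen :: "'a set \<Rightarrow> 'a set \<Rightarrow> ('a set multiset \<Rightarrow>\<^sub>0 int)" where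
  "xgen E T = - (\<Sum>S\<in>{S. T \<subseteq> S \<and> S \<subseteq> E}. (-1) ^ card (S - T) * hgen S)"

text \<open>Exchange the summations: for fixed U the alternating sum over T between A and U vanishes
  unless U = A.\<close>

lemma sum_xgen_above:
  assumes fin: "finite E" and A: "A \<subseteq> E"
  shows "(\<Sum>T\<in>{T. A \<subseteq> T \<and> T \<subseteq> E}. xgen E T) = - hgen A"
proof -
  let ?R = "{T. A \<subseteq> T \<and> T \<subseteq> E}"
  have finR: "finite ?R" by (rule finite_subset[of _ "Pow E"]) (use fin in auto)
  have "(\<Sum>T\<in>?R. \<Sum>U\<in>{U. T \<subseteq> U \<and> U \<subseteq> E}. (-1) ^ card (U - T) * hgen U)
      = (\<Sum>T\<in>?R. \<Sum>U\<in>{U \<in> ?R. T \<subseteq> U}. (-1) ^ card (U - T) * hgen U)"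
    by (intro sum.cong) auto
  also have "\<dots> = (\<Sum>U\<in>?R. \<Sum>T\<in>{T \<in> ?R. T \<subseteq> U}. (-1) ^ card (U - T) * hgen U)"
    by (rule sum.swap_restrict[OF finR finR])
  also have "\<dots> = (\<Sum>U\<in>?R. if U = A then hgen A else 0)"
  proof (rule sum.cong[OF refl])
    fix U assume U: "U \<in> ?R"
    have finU: "finite U" using U fin finite_subset by auto
    \<comment> \<open>The sign is rewritten relative to A, so that the inner sum takes the form of
      \<open>alternating_sum_subsets\<close>.\<close>
    have "(-1) ^ card (U - T) * hgen U = (-1) ^ card (U - A) * ((-1) ^ card (T - A)) * hgen U"
      if "T \<in> {T. A \<subseteq> T \<and> T \<subseteq> U}" for T
    proof -
      have "card (U - A) = card (U - T) + card (T - A)"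
        using that finU finite_subset[of T U]
        by (subst card_Un_disjoint[symmetric]) (auto intro: arg_cong[where f = card])
      then have "(-1) ^ card (U - A) * (-1) ^ card (T - A) =
          ((-1) ^ card (U - T) :: 'a set multiset \<Rightarrow>\<^sub>0 int) * ((-1) ^ card (T - A) * (-1) ^ card (T - A))"
        by (simp add: power_add mult.assoc)
      also have "(-1 :: 'a set multiset \<Rightarrow>\<^sub>0 int) ^ card (T - A) * (-1) ^ card (T - A) = 1"
        by (simp flip: power_mult_distrib)
      finally show ?thesis by simp
    qed
    then have "(\<Sum>T\<in>{T \<in> ?R. T \<subseteq> U}. (-1) ^ card (U - T) * hgen U) =
        (\<Sum>T\<in>{T. A \<subseteq> T \<and> T \<subseteq> U}. (-1) ^ card (U - A) * ((-1) ^ card (T - A)) * hgen U)"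
      by (intro sum.cong) (use U in auto)
    also have "\<dots> = (-1) ^ card (U - A) * (\<Sum>T\<in>{T. A \<subseteq> T \<and> T \<subseteq> U}. (-1) ^ card (T - A)) * hgen U"
      by (simp only: sum_distrib_left sum_distrib_right)
    also have "(\<Sum>T\<in>{T. A \<subseteq> T \<and> T \<subseteq> U}. (-1) ^ card (T - A)) = (of_bool (A = U) :: 'a set multiset \<Rightarrow>\<^sub>0 int)"
      by (rule alternating_sum_subsets[OF finU]) (use U in auto)
    also have "(-1) ^ card (U - A) * of_bool (A = U) * hgen U = (if U = A then hgen A else 0)"
      by auto
    finally show "(\<Sum>T\<in>{T \<in> ?R. T \<subseteq> U}. (-1) ^ card (U - T) * hgen U) = (if U = A then hgen A else 0)" .
  qed
  also have "\<dots> = hgen A" using finR A by simp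
  finally show ?thesis by (simp add: xgen_def sum_negf)
qed

text \<open>The sum over all T \<subseteq> E is - h_{} = 0, so the terms not above A are the
  negative of those above A.\<close>

lemma sum_xgen_not_above:
  assumes fin: "finite E" and A: "A \<subseteq> E"
  shows "(\<Sum>T\<in>{T. T \<subset> E \<and> \<not> A \<subseteq> T}. xgen E T) = hgen A"
proof -
  have "(\<Sum>T\<in>{T. {} \<subseteq> T \<and> T \<subseteq> E}. xgen E T) =
      (\<Sum>T\<in>{T. T \<subset> E \<and> \<not> A \<subseteq> T} \<union> {T. A \<subseteq> T \<and> T \<subseteq> E}. xgen E T)"
    by (rule sum.cong) (use A in auto)
  also have "\<dots> = (\<Sum>T\<in>{T. T \<subset> E \<and> \<not> A \<subseteq> T}. xgen E T) + (\<Sum>T\<in>{T. A \<subseteq> T \<and> T \<subseteq> E}. xgen E T)"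
    by (rule sum.union_disjoint) (use fin in \<open>auto intro: finite_subset[of _ "Pow E"]\<close>)
  finally show ?thesis using sum_xgen_above[OF fin A] sum_xgen_above[OF fin, of "{}"]
    by (simp add: hgen_def)
qed

lemma act_hgen:
  assumes "\<And>m. \<psi> (add_mset {} m) = 0"
  shows "act (hgen S) \<psi> m = \<psi> (add_mset S m)"
  using assms by (simp add: hgen_def act_frag_of)

lemma act_xgen:
  assumes "\<And>m. \<psi> (add_mset {} m) = 0"
  shows "act (xgen E T) \<psi> = xop E T \<psi>"
  by (simp add: fun_eq_iff xgen_def xop_def act_uminus act_sum act_sign act_hgen[of \<psi>, OF assms])

text \<open>The linear relation of j identifies the variable of e_j with the class h of the
  singleton {\<pi> j}. Labels that are not rays are sent to 0, as in the ideal.\<close>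

fun ray_val :: "'a set \<Rightarrow> 'b set \<Rightarrow> ('b \<Rightarrow> 'a) \<Rightarrow> ('a, 'b) ray \<Rightarrow> ('a set multiset \<Rightarrow>\<^sub>0 int)" where
  "ray_val E Et \<pi> (RS T) = (if T \<subset> E then xgen E T else 0)"
| "ray_val E Et \<pi> (RE j) = (if j \<in> Et then hgen {\<pi> j} else 0)"

definition pact :: "'a set \<Rightarrow> 'b set \<Rightarrow> ('b \<Rightarrow> 'a) \<Rightarrow> ('a, 'b) chow_poly \<Rightarrow> ('a set multiset \<Rightarrow> int) \<Rightarrow> 'a set multiset \<Rightarrow> int" where
  "pact E Et \<pi> f = act (poly_subst (ray_val E Et \<pi>) f)"

lemma pact_mult: "pact E Et \<pi> (f * g) \<phi> = pact E Et \<pi> f (pact E Et \<pi> g \<phi>)"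
  by (simp add: pact_def poly_subst_mult act_mult)

lemma pact_one [simp]: "pact E Et \<pi> 1 \<phi> = \<phi>"
  by (simp add: pact_def)

lemma pact_diff: "pact E Et \<pi> (f - g) \<phi> m = pact E Et \<pi> f \<phi> m - pact E Et \<pi> g \<phi> m"
  by (simp add: pact_def poly_subst_diff act_diff)

lemma pact_sum: "pact E Et \<pi> (\<Sum>i\<in>A. f i) \<phi> m = (\<Sum>i\<in>A. pact E Et \<pi> (f i) \<phi> m)"
  by (simp add: pact_def poly_subst_sum act_sum)

lemma pact_zero [simp]: "pact E Et \<pi> 0 \<phi> m = 0"
  by (simp add: pact_def)

lemma pact_zero_fun [simp]: "pact E Et \<pi> f (\<lambda>_. 0) = (\<lambda>_. 0)"
  by (simp add: pact_def)

lemma pact_add: "pact E Et \<pi> (f + g) \<phi> m = pact E Et \<pi> f \<phi> m + pact E Et \<pi> g \<phi> m"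
  using pact_diff[of E Et \<pi> "f + g" g \<phi> m] by simp

lemma pact_of_int: "pact E Et \<pi> (of_int d) \<phi> m = d * \<phi> m"
proof (induction d rule: int_induct[of _ 0])
  case (step1 i)
  then show ?case by (simp add: pact_add algebra_simps)
next
  case (step2 i)
  then show ?case by (simp add: pact_diff algebra_simps)
qed simp

lemma pact_var_RS:
  assumes "T \<subset> E" "\<And>m. \<psi> (add_mset {} m) = 0"
  shows "pact E Et \<pi> (var (RS T)) \<psi> = xop E T \<psi>"
  using assms by (simp add: pact_def act_xgen)

lemma pact_h_cls:
  assumes "finite E" "S \<subseteq> E" "\<And>m. \<psi> (add_mset {} m) = 0"
  shows "pact E Et \<pi> (h_cls E S) \<psi> m = \<psi> (add_mset S m)"
proof -
  have "poly_subst (ray_val E Et \<pi>) (h_cls E S) = (\<Sum>T\<in>{T. T \<subset> E \<and> \<not> S \<subseteq> T}. xgen E T)"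
    by (simp add: h_cls_def x_cls_def poly_subst_sum)
  then show ?thesis
    using sum_xgen_not_above[OF assms(1,2)] act_hgen[of \<psi>, OF assms(3)] by (simp add: pact_def)
qed

lemma pact_prod_h_cls:
  assumes "finite E" "finite A" "\<And>k. k \<in> A \<Longrightarrow> S k \<subseteq> E" "\<And>m. \<psi> (add_mset {} m) = 0"
  shows "pact E Et \<pi> (\<Prod>k\<in>A. h_cls E (S k)) \<psi> m = \<psi> (m + image_mset S (mset_set A))"
  using assms(2,3)
proof (induction A arbitrary: m rule: finite_induct)
  case (insert k A)
  let ?f = "pact E Et \<pi> (\<Prod>k\<in>A. h_cls E (S k)) \<psi>"
  have IH: "?f m = \<psi> (m + image_mset S (mset_set A))" for m
    by (rule insert.IH) (use insert in auto)
  have "pact E Et \<pi> (h_cls E (S k)) ?f m = ?f (add_mset (S k) m)"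
    by (rule pact_h_cls[OF assms(1)]) (use insert IH assms(4) in auto)
  then show ?case using insert IH by (simp add: pact_mult)
qed simp

lemma pact_prod_RE:
  assumes "finite I" "I \<subseteq> Et" "\<And>m. \<psi> (add_mset {} m) = 0"
  shows "pact E Et \<pi> (\<Prod>j\<in>I. var (RE j)) \<psi> m = \<psi> (m + image_mset (\<lambda>j. {\<pi> j}) (mset_set I))"
proof -
  have "poly_subst (ray_val E Et \<pi>) (\<Prod>j\<in>I. var (RE j)) = (\<Prod>j\<in>I. frag_of {#{\<pi> j}#})"
    unfolding poly_subst_prod by (rule prod.cong) (use assms(2) in \<open>auto simp: hgen_def\<close>)
  then show ?thesis using act_prod_frag_of[OF assms(1)] by (simp add: pact_def)
qed

lemma poly_subst_lin_rel:
  assumes "finite E" "\<pi> ` Et \<subseteq> E" "j \<in> Et"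
  shows "poly_subst (ray_val E Et \<pi>) (lin_rel E \<pi> j) = 0"
proof -
  have "poly_subst (ray_val E Et \<pi>) (\<Sum>S\<in>{S. S \<subset> E \<and> \<pi> j \<notin> S}. var (RS S)) =
      (\<Sum>T\<in>{T. T \<subset> E \<and> \<not> {\<pi> j} \<subseteq> T}. xgen E T)"
    unfolding poly_subst_sum by (rule sum.cong) auto
  also have "\<dots> = hgen {\<pi> j}" by (rule sum_xgen_not_above[OF assms(1)]) (use assms in auto)
  finally show ?thesis using assms(3) by (simp add: lin_rel_def poly_subst_diff)
qed

lemma mono_var_mult:
  assumes "finite \<tau>" "x \<notin> \<tau>"
  shows "mono (insert x \<tau>) = var x * mono \<tau>"
  using assms by (simp add: mono_def)

context polyrank
begin

lemma pact_prod_RS: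
  assumes "proper_chain E \<F>"
  shows "pact E Et \<pi> (\<Prod>F\<in>\<F>. var (RS F)) (chain_fun {}) = chain_fun \<F>"
  using finite_E assms
proof (induction \<F> rule: proper_chain_induct)
  case (insert \<F> T)
  have T: "T \<subset> E" by (rule psubset_subset_trans[OF insert(2) first_set_subset])
  have fin: "finite \<F>" "T \<notin> \<F>"
    by (rule proper_chain_finite[OF finite_E insert(1)], rule first_set_below_notin[OF insert(2)])
  have "pact E Et \<pi> (\<Prod>F\<in>insert T \<F>. var (RS F)) (chain_fun {}) =
      pact E Et \<pi> (var (RS T)) (chain_fun \<F>)"
    by (simp add: fin pact_mult insert(3))
  also have "\<dots> = xop E T (chain_fun \<F>)" by (rule pact_var_RS[OF T]) simp
  also have "\<dots> = chain_fun (insert T \<F>)" by (rule ext) (rule xop_chain_fun[OF insert(1,2)])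
  finally show ?case .
qed simp

lemma pact_cone_rays:
  assumes "proper_chain E \<F>" "finite I" "I \<subseteq> Et"
  shows "pact E Et \<pi> (mono (cone_rays I \<F>)) (chain_fun {}) m =
     chain_fun \<F> (m + image_mset (\<lambda>j. {\<pi> j}) (mset_set I))"
  using assms by (simp add: mono_cone_rays proper_chain_finite[OF finite_E] pact_mult pact_prod_RS pact_prod_RE)

text \<open>The fibres must be nonempty and at least as large as the ranks of the points below them,
  so that \<open>chain_fun_truncated_power\<close> applies to a full fibre.\<close>

lemma pact_non_cone:
  assumes Et: "finite Et" "\<pi> ` Et \<subseteq> E"
    and a: "\<And>i. i \<in> E \<Longrightarrow> \<rho> {i} \<le> card (preim Et \<pi> {i})" "\<And>i. i \<in> E \<Longrightarrow> 0 < card (preim Et \<pi> {i})"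
    and \<tau>: "finite \<tau>" "\<tau> \<subseteq> rays E Et" "\<not> cone_a E Et \<pi> \<tau>"
  shows "pact E Et \<pi> (mono \<tau>) (chain_fun {}) = (\<lambda>_. 0)"
proof -
  have proper: "F \<subset> E" if "RS F \<in> \<tau>" for F using that \<tau>(2) by (auto simp: rays_def)
  \<comment> \<open>It suffices to find a factor of the monomial that already annihilates
    \<phi>_P.\<close>
  have sub: ?thesis if "\<sigma> \<subseteq> \<tau>" "pact E Et \<pi> (mono \<sigma>) (chain_fun {}) = (\<lambda>_. 0)" for \<sigma>
    unfolding mono_split[OF \<tau>(1) that(1)] pact_mult that(2) by simp
  from \<tau>(2,3) show ?thesis
  proof (cases rule: non_cone_cases)
    case (incomparable F T)
    have FT: "F \<subset> E" "T \<subset> E" using proper incomparable by auto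
    have "mono {RS T, RS F} = (var (RS T) * var (RS F) :: ('a, 'b) chow_poly)"
      using incomparable by (auto simp: mono_def)
    moreover have "pact E Et \<pi> (var (RS F)) (chain_fun {}) = chain_fun {F}"
      using pact_prod_RS[of "{F}"] FT by (auto simp: proper_chain_def)
    moreover have "pact E Et \<pi> (var (RS T)) (chain_fun {F}) = xop E T (chain_fun {F})"
      by (rule pact_var_RS[OF FT(2)]) simp
    moreover have "xop E T (chain_fun {F}) = (\<lambda>_. 0)"
      using xop_incomparable[OF FT(1)] FT(2) incomparable by blast
    ultimately have "pact E Et \<pi> (mono {RS T, RS F}) (chain_fun {}) = (\<lambda>_. 0)"
      by (simp add: pact_mult)
    then show ?thesis by (rule sub[rotated]) (use incomparable in auto)
  next
    case (fibre F i)
    let ?P = "preim Et \<pi> {i}"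
    have F: "F \<subset> E" using proper fibre by auto
    have P: "finite ?P" "?P \<subseteq> Et" using Et by (auto simp: preim_def)
    have "image_mset (\<lambda>j. {\<pi> j}) (mset_set ?P) = image_mset (\<lambda>j. {i}) (mset_set ?P)"
      by (rule image_mset_cong) (use P in \<open>auto simp: preim_def\<close>)
    also have "\<dots> = replicate_mset (card ?P) {i}" by (simp add: image_mset_const_eq)
    finally have rep: "image_mset (\<lambda>j. {\<pi> j}) (mset_set ?P) = replicate_mset (card ?P) {i}" .
    have "pact E Et \<pi> (mono (cone_rays ?P {F})) (chain_fun {}) = (\<lambda>_. 0)"
    proof
      fix m
      have "proper_chain E {F}" using F by (auto simp: proper_chain_def)
      from pact_cone_rays[OF this P, of \<pi> m] show "pact E Et \<pi> (mono (cone_rays ?P {F})) (chain_fun {}) m = 0"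
        unfolding rep using chain_fun_truncated_power[OF F fibre(3) a(1)[OF fibre(2)] a(2)[OF fibre(2)]] by simp
    qed
    then show ?thesis by (rule sub[rotated]) (use fibre in \<open>auto simp: cone_rays_def\<close>)
  qed
qed

text \<open>The annihilator of \<phi>_P is an ideal, so only the three families of generators have
  to be examined.\<close>

lemma pact_chow_ideal:
  assumes Et: "finite Et" "\<pi> ` Et \<subseteq> E"
    and a: "\<And>i. i \<in> E \<Longrightarrow> \<rho> {i} \<le> card (preim Et \<pi> {i})" "\<And>i. i \<in> E \<Longrightarrow> 0 < card (preim Et \<pi> {i})"
    and f: "f \<in> chow_ideal E Et \<pi>"
  shows "pact E Et \<pi> f (chain_fun {}) = (\<lambda>_. 0)"
proof -
  let ?G = "{mono \<tau> | \<tau>. finite \<tau> \<and> \<tau> \<subseteq> rays E Et \<and> \<not> cone_a E Et \<pi> \<tau>} \<union>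
      lin_rel E \<pi> ` Et \<union> var ` (- rays E Et)"
  have gen: "pact E Et \<pi> g (chain_fun {}) = (\<lambda>_. 0)" if "g \<in> ?G" for g
  proof -
    from that consider \<tau> where "g = mono \<tau>" "finite \<tau>" "\<tau> \<subseteq> rays E Et" "\<not> cone_a E Et \<pi> \<tau>" |
      j where "g = lin_rel E \<pi> j" "j \<in> Et" | x where "g = var x" "x \<notin> rays E Et" by blast
    then show ?thesis
    proof cases
      case 1
      show ?thesis unfolding 1(1) by (rule pact_non_cone[OF Et a 1(2-4)])
    next
      case 2
      then show ?thesis using poly_subst_lin_rel[OF finite_E Et(2)] by (simp add: pact_def fun_eq_iff)
    next
      case 3
      then have "ray_val E Et \<pi> x = 0" by (cases x) (auto simp: rays_def)
      then show ?thesis using 3 by (simp add: pact_def fun_eq_iff)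
    qed
  qed
  from f obtain A c where f_eq: "f = (\<Sum>g\<in>A. c g * g)" and A: "A \<subseteq> ?G"
    unfolding chow_ideal_def ideal_gen_def by blast
  have "pact E Et \<pi> (c g * g) (chain_fun {}) m = 0" if "g \<in> A" for g m
    using gen[of g] A that by (simp add: pact_mult subset_iff)
  then show ?thesis unfolding f_eq by (simp add: fun_eq_iff pact_sum)
qed

end

section \<open>The moving lemma\<close>

lemma ideal_genI: "finite A \<Longrightarrow> A \<subseteq> G \<Longrightarrow> (\<Sum>g\<in>A. c g * g) \<in> ideal_gen G"
  unfolding ideal_gen_def by blast

lemma ideal_gen_base: "g \<in> G \<Longrightarrow> g \<in> ideal_gen G"
  using ideal_genI[of "{g}" G "\<lambda>_. 1"] by simp

lemma ideal_gen_add: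
  assumes "f \<in> ideal_gen G" "g \<in> ideal_gen G"
  shows "f + g \<in> ideal_gen G"
proof -
  obtain A c where A: "finite A" "A \<subseteq> G" "f = (\<Sum>x\<in>A. c x * x)"
    using assms(1) unfolding ideal_gen_def by blast
  obtain B d where B: "finite B" "B \<subseteq> G" "g = (\<Sum>x\<in>B. d x * x)"
    using assms(2) unfolding ideal_gen_def by blast
  have "f = (\<Sum>x\<in>A \<union> B. (if x \<in> A then c x else 0) * x)"
    unfolding A(3) by (rule sum.mono_neutral_cong_left) (use A B in auto)
  moreover have "g = (\<Sum>x\<in>A \<union> B. (if x \<in> B then d x else 0) * x)"
    unfolding B(3) by (rule sum.mono_neutral_cong_left) (use A B in auto)
  ultimately have "f + g = (\<Sum>x\<in>A \<union> B. ((if x \<in> A then c x else 0) + (if x \<in> B then d x else 0)) * x)"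
    by (simp only: sum.distrib distrib_right)
  then show ?thesis using A B by (simp only: ideal_genI finite_UnI Un_least)
qed

lemma ideal_gen_mult:
  assumes "f \<in> ideal_gen G"
  shows "h * f \<in> ideal_gen G"
proof -
  obtain A c where A: "finite A" "A \<subseteq> G" "f = (\<Sum>x\<in>A. c x * x)"
    using assms unfolding ideal_gen_def by blast
  have "h * f = (\<Sum>x\<in>A. (h * c x) * x)"
    unfolding A(3) by (simp add: sum_distrib_left mult.assoc)
  then show ?thesis using A by (simp only: ideal_genI)
qed

lemma ideal_gen_zero: "0 \<in> ideal_gen G"
  using ideal_genI[of "{}"] by simp

lemma ideal_gen_uminus: "f \<in> ideal_gen G \<Longrightarrow> - f \<in> ideal_gen G"
  using ideal_gen_mult[of f G "- 1"] by simp

lemma ideal_gen_diff: "f \<in> ideal_gen G \<Longrightarrow> g \<in> ideal_gen G \<Longrightarrow> f - g \<in> ideal_gen G"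
  using ideal_gen_add[OF _ ideal_gen_uminus, of f G g] by simp

lemma ideal_gen_sum: "(\<And>i. i \<in> A \<Longrightarrow> f i \<in> ideal_gen G) \<Longrightarrow> (\<Sum>i\<in>A. f i) \<in> ideal_gen G"
  by (induction A rule: infinite_finite_induct) (simp_all add: ideal_gen_zero ideal_gen_add)

definition chow_gens :: "'a set \<Rightarrow> 'b set \<Rightarrow> ('b \<Rightarrow> 'a) \<Rightarrow> ('a, 'b) chow_poly set" where
  "chow_gens E Et \<pi> = {mono \<tau> | \<tau>. finite \<tau> \<and> \<tau> \<subseteq> rays E Et \<and> \<not> cone_a E Et \<pi> \<tau>} \<union>
      lin_rel E \<pi> ` Et \<union> var ` (- rays E Et)"

lemma chow_ideal_eq: "chow_ideal E Et \<pi> = ideal_gen (chow_gens E Et \<pi>)"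
  by (simp add: chow_ideal_def chow_gens_def)

text \<open>\<open>mono\<close> covers square-free monomials only; rewriting a repeated factor needs
  multisets of rays.\<close>

definition monom_of :: "('a, 'b) ray multiset \<Rightarrow> ('a, 'b) chow_poly" where
  "monom_of M = (\<Prod>x\<in>#M. var x)"

lemma monom_of_add [simp]: "monom_of (add_mset x M) = var x * monom_of M"
  by (simp add: monom_of_def)

lemma mono_eq_monom_of: "finite \<tau> \<Longrightarrow> mono \<tau> = monom_of (mset_set \<tau>)"
  by (simp add: mono_def monom_of_def prod_unfold_prod_mset)

fun is_RS :: "('a, 'b) ray \<Rightarrow> bool" where
  "is_RS (RS _) = True"
| "is_RS (RE _) = False"

definition num_RS :: "('a, 'b) ray multiset \<Rightarrow> nat" where
  "num_RS M = size (filter_mset is_RS M)"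

definition size_RS :: "('a, 'b) ray multiset \<Rightarrow> nat" where
  "size_RS M = (\<Sum>x\<in>#M. case x of RS F \<Rightarrow> card F | RE j \<Rightarrow> 0)"

definition supp_RS :: "('a, 'b) ray multiset \<Rightarrow> 'a set set" where
  "supp_RS M = {F. RS F \<in># M}"

definition supp_RE :: "('a, 'b) ray multiset \<Rightarrow> 'b set" where
  "supp_RE M = {j. RE j \<in># M}"

locale polystellahedral =
  fixes E :: "'a set" and Et :: "'b set" and \<pi> :: "'b \<Rightarrow> 'a"
  assumes finite_ground: "finite E" and finite_Et: "finite Et" and \<pi>_Et: "\<pi> ` Et \<subseteq> E"
begin

abbreviation "CI \<equiv> chow_ideal E Et \<pi>"

lemmas CI_add = ideal_gen_add[where G = "chow_gens E Et \<pi>", folded chow_ideal_eq]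
lemmas CI_mult = ideal_gen_mult[where G = "chow_gens E Et \<pi>", folded chow_ideal_eq]
lemmas CI_zero = ideal_gen_zero[where G = "chow_gens E Et \<pi>", folded chow_ideal_eq]
lemmas CI_uminus = ideal_gen_uminus[where G = "chow_gens E Et \<pi>", folded chow_ideal_eq]
lemmas CI_diff = ideal_gen_diff[where G = "chow_gens E Et \<pi>", folded chow_ideal_eq]
lemmas CI_sum = ideal_gen_sum[where G = "chow_gens E Et \<pi>", folded chow_ideal_eq]
lemmas CI_base = ideal_gen_base[where G = "chow_gens E Et \<pi>", folded chow_ideal_eq]

lemma finite_rays: "finite (rays E Et)"
  using finite_ground finite_Et by (auto simp: rays_def intro: finite_subset[of _ "Pow E"])

lemma non_cone_in_CI:
  assumes "\<tau> \<subseteq> rays E Et" "\<not> cone_a E Et \<pi> \<tau>"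
  shows "mono \<tau> \<in> CI"
  by (rule CI_base) (use assms finite_subset[OF assms(1) finite_rays] chow_gens_def in blast)

lemma lin_rel_in_CI: "j \<in> Et \<Longrightarrow> lin_rel E \<pi> j \<in> CI"
  by (rule CI_base) (auto simp: chow_gens_def)

lemma var_in_CI: "x \<notin> rays E Et \<Longrightarrow> var x \<in> CI"
  by (rule CI_base) (auto simp: chow_gens_def)

lemma monom_of_non_cone_in_CI:
  assumes "set_mset M \<subseteq> rays E Et" "\<not> cone_a E Et \<pi> (set_mset M)"
  shows "monom_of M \<in> CI"
proof -
  have "mset_set (set_mset M) \<subseteq># M" by (rule mset_set_set_mset_msubset)
  then obtain N where "M = N + mset_set (set_mset M)" by (metis subset_mset.diff_add)
  then have "monom_of M = monom_of N * mono (set_mset M)"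
    by (metis finite_set_mset image_mset_union mono_eq_monom_of monom_of_def prod_mset.union)
  then show ?thesis using CI_mult[OF non_cone_in_CI[OF assms]] by simp
qed

text \<open>The integer span of the monomials of k-dimensional cones, modulo the ideal. The
  inductive form provides the induction that \<open>top_class\<close> and
  \<open>deg_X_sigmaP\<close> use.\<close>

inductive_set cone_span :: "nat \<Rightarrow> ('a, 'b) chow_poly set" for k where
  in_CI: "f \<in> CI \<Longrightarrow> f \<in> cone_span k"
| cone: "cone_a E Et \<pi> \<sigma> \<Longrightarrow> card \<sigma> = k \<Longrightarrow> mono \<sigma> \<in> cone_span k"
| diff: "f \<in> cone_span k \<Longrightarrow> g \<in> cone_span k \<Longrightarrow> f - g \<in> cone_span k"

lemma cone_span_zero: "0 \<in> cone_span k"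
  by (rule cone_span.in_CI[OF CI_zero])

lemma cone_span_add: "f \<in> cone_span k \<Longrightarrow> g \<in> cone_span k \<Longrightarrow> f + g \<in> cone_span k"
  using cone_span.diff[OF _ cone_span.diff[OF cone_span_zero], of f k g] by simp

lemma cone_span_sum: "(\<And>i. i \<in> A \<Longrightarrow> f i \<in> cone_span k) \<Longrightarrow> (\<Sum>i\<in>A. f i) \<in> cone_span k"
  by (induction A rule: infinite_finite_induct) (simp_all add: cone_span_zero cone_span_add)

lemma cone_span_of_int_mult:
  assumes "f \<in> cone_span k"
  shows "of_int d * f \<in> cone_span k"
proof (induction d rule: int_induct[of _ 0])
  case (step1 i)
  then show ?case using cone_span_add[OF assms, of "of_int i * f"] by (simp add: algebra_simps)
next
  case (step2 i)
  then show ?case using cone_span.diff[OF _ assms, of "of_int i * f"] by (simp add: algebra_simps)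
qed (simp add: cone_span_zero)

lemma monom_of_exchange_RS:
  assumes j: "j \<in> Et" and F: "F \<subset> E" "\<pi> j \<notin> F"
  shows "monom_of (add_mset (RS F) M) = monom_of (add_mset (RE j) M)
     - (\<Sum>T\<in>{T. T \<subset> E \<and> \<pi> j \<notin> T} - {F}. monom_of (add_mset (RS T) M)) - monom_of M * lin_rel E \<pi> j"
proof -
  have fin: "finite {T. T \<subset> E \<and> \<pi> j \<notin> T}"
    by (rule finite_subset[of _ "Pow E"]) (use finite_ground in auto)
  have "(\<Sum>T\<in>{T. T \<subset> E \<and> \<pi> j \<notin> T}. var (RS T)) =
     var (RS F) + (\<Sum>T\<in>{T. T \<subset> E \<and> \<pi> j \<notin> T} - {F}. var (RS T) :: ('a, 'b) chow_poly)"
    by (rule sum.remove[OF fin]) (use F in simp)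
  then show ?thesis
    by (simp add: lin_rel_def sum_distrib_right[symmetric] sum_distrib_left[symmetric] algebra_simps)
qed

lemma monom_of_exchange_RE:
  "monom_of (add_mset (RE j) M) =
     (\<Sum>T\<in>{T. T \<subset> E \<and> \<pi> j \<notin> T}. monom_of (add_mset (RS T) M)) + monom_of M * lin_rel E \<pi> j"
  by (simp add: lin_rel_def sum_distrib_right[symmetric] sum_distrib_left[symmetric] algebra_simps)

text \<open>The linear relations of two elements of a fibre contain the same sum over S, so their
  variables agree modulo the ideal.\<close>

lemma monom_of_exchange_fibre:
  assumes "\<pi> j = \<pi> j'"
  shows "monom_of (add_mset (RE j) M) = monom_of (add_mset (RE j') M)
     + (monom_of M * lin_rel E \<pi> j - monom_of M * lin_rel E \<pi> j')"
  using assms by (simp add: lin_rel_def algebra_simps)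

text \<open>A repeated \<open>x_F\<close> is rewritten by the linear relation of some \<open>j\<close> with
  \<open>\<pi> j\<close> in the next member of the chain, which makes the sets that occur smaller or the support larger.\<close>

lemma monom_of_in_cone_span: "monom_of M \<in> cone_span (size M)"
\<comment> \<open>Lexicographic descent. Trading a repeated x_F for x_T or the variable of e_j
  lowers the number of \<open>RS\<close> factors (e_j), enlarges the chain (new T), or shrinks a set
  (old T). Exchanging a repeated e_j inside its fibre enlarges the \<open>RE\<close> support and
  changes nothing else.\<close>
proof (induction M rule: wf_induct[OF wf_measures[of "[num_RS, \<lambda>M. card (Pow E) - card (supp_RS M),
      size_RS, \<lambda>M. card Et - card (supp_RE M)]"]])
  case (1 M)
  have IH: "monom_of N \<in> cone_span (size M)"
    if "size N = size M" "(N, M) \<in> measures [num_RS, \<lambda>M. card (Pow E) - card (supp_RS M),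
      size_RS, \<lambda>M. card Et - card (supp_RE M)]" for N
    using 1 that by metis
  show ?case
  proof (cases "set_mset M \<subseteq> rays E Et")
    case False
    then obtain x N where "M = add_mset x N" "x \<notin> rays E Et" by (meson multi_member_split subsetI)
    then show ?thesis using CI_mult[OF var_in_CI, of x "monom_of N"]
      by (auto intro: cone_span.in_CI simp: mult.commute)
  next
    case rays: True
    show ?thesis
    proof (cases "cone_a E Et \<pi> (set_mset M)")
      case False
      then show ?thesis using monom_of_non_cone_in_CI[OF rays] cone_span.in_CI by blast
    next
      case cone: True
      have ch: "proper_chain E (supp_RS M)"
        and fib: "\<And>F i. F \<in> supp_RS M \<Longrightarrow> i \<in> E - F \<Longrightarrow> \<not> preim Et \<pi> {i} \<subseteq> supp_RE M"
        using cone unfolding cone_a_iff admissible_a_iff supp_RS_def supp_RE_def by blast+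
      show ?thesis
      proof (cases "\<exists>x\<in>#M. count M x \<noteq> 1")
        case False
        have "M = mset_set (set_mset M)"
          by (rule multiset_eqI) (use False in \<open>auto simp: count_mset_set' not_in_iff\<close>)
        then have "monom_of M = mono (set_mset M)" "card (set_mset M) = size M"
          by (metis finite_set_mset mono_eq_monom_of, metis size_mset_set)
        then show ?thesis using cone_span.cone[OF cone, of "size M"] by simp
      next
        case True
        then obtain x M' where M: "M = add_mset x M'" and x: "x \<in># M'"
          by (metis (no_types, lifting) count_add_mset multi_member_split not_in_iff One_nat_def)
        have finS: "finite (supp_RS M)" by (rule proper_chain_finite[OF finite_ground ch])
        have subS: "supp_RS M \<subseteq> Pow E" using ch by (auto simp: proper_chain_def)
        show ?thesis
        proof (cases x)
          case (RS F)
          have F: "F \<in> supp_RS M" "F \<subset> E"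
            using M RS ch by (auto simp: supp_RS_def proper_chain_def)
          let ?next = "first_set E {G \<in> supp_RS M. F \<subset> G}"
          have chn: "proper_chain E {G \<in> supp_RS M. F \<subset> G}"
            by (rule proper_chain_subset[OF ch]) auto
          have "F \<subset> ?next"
          proof (cases "{G \<in> supp_RS M. F \<subset> G} = {}")
            case True
            show ?thesis unfolding True using F(2) by simp
          next
            case False
            from first_set_in[OF finite_ground chn this] show ?thesis by blast
          qed
          then obtain i where i: "i \<in> ?next" "i \<notin> F" by blast
          have iE: "i \<in> E" by (rule subsetD[OF first_set_subset i(1)])
          obtain j where j: "j \<in> Et" "\<pi> j = i" "j \<notin> supp_RE M"
            using fib[OF F(1), of i] iE i(2) by (auto simp: preim_def)
          have suppM: "supp_RS M = supp_RS M'" using M RS x by (auto simp: supp_RS_def)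
          have "monom_of (add_mset (RE j) M') \<in> cone_span (size M)"
            by (rule IH) (auto simp: M RS num_RS_def)
          moreover have "monom_of (add_mset (RS T) M') \<in> cone_span (size M)"
            if T: "T \<in> {T. T \<subset> E \<and> \<pi> j \<notin> T} - {F}" for T
          proof (rule IH)
            have num: "num_RS (add_mset (RS T) M') = num_RS M" by (simp add: M RS num_RS_def)
            have supp: "supp_RS (add_mset (RS T) M') = insert T (supp_RS M)"
              unfolding suppM by (auto simp: supp_RS_def)
            show "(add_mset (RS T) M', M) \<in> measures [num_RS, \<lambda>M. card (Pow E) - card (supp_RS M),
              size_RS, \<lambda>M. card Et - card (supp_RE M)]"
            proof (cases "T \<in> supp_RS M")
              case False
              have "card (insert T (supp_RS M)) \<le> card (Pow E)"
                by (rule card_mono) (use finite_ground subS T in auto)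
              then have "card (Pow E) - card (supp_RS (add_mset (RS T) M')) < card (Pow E) - card (supp_RS M)"
                unfolding supp using False finS by simp
              then show ?thesis using num by simp
            next
              case True
              have "F \<subseteq> T \<or> T \<subseteq> F" using ch True F(1) by (auto simp: proper_chain_def)
              moreover have "\<not> F \<subset> T"
              proof
                assume "F \<subset> T"
                then have "?next \<subseteq> T" using True by (intro first_set_lower) simp
                then show False using i(1) T j(2) by blast
              qed
              ultimately have "T \<subset> F" using T by blast
              then have "card T < card F"
                by (rule psubset_card_mono[rotated]) (use F(2) finite_ground finite_subset in blast)
              then have "size_RS (add_mset (RS T) M') < size_RS M" by (simp add: M RS size_RS_def)
              moreover have "supp_RS (add_mset (RS T) M') = supp_RS M" using supp True by auto
              ultimately show ?thesis using num by simp
            qed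
          qed (simp add: M)
          moreover have "monom_of M' * lin_rel E \<pi> j \<in> cone_span (size M)"
            by (rule cone_span.in_CI[OF CI_mult[OF lin_rel_in_CI[OF j(1)]]])
          moreover have "\<pi> j \<notin> F" using i(2) j(2) by simp
          ultimately show ?thesis
            unfolding M RS monom_of_exchange_RS[OF j(1) F(2) \<open>\<pi> j \<notin> F\<close>]
            by (intro cone_span.diff cone_span_sum) (simp_all add: M RS)
        next
          case (RE j)
          have j: "j \<in> Et" using rays M RE by (auto simp: rays_def)
          have mul: "monom_of M' * lin_rel E \<pi> j' \<in> cone_span (size M)" if "j' \<in> Et" for j'
            by (rule cone_span.in_CI[OF CI_mult[OF lin_rel_in_CI[OF that]]])
          show ?thesis
          proof (cases "preim Et \<pi> {\<pi> j} \<subseteq> supp_RE M")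
            case False
            then obtain j' where j': "j' \<in> Et" "\<pi> j' = \<pi> j" "j' \<notin> supp_RE M"
              by (auto simp: preim_def)
            have supp: "supp_RE (add_mset (RE j') M') = insert j' (supp_RE M)"
              using M RE x by (auto simp: supp_RE_def)
            have sub: "supp_RE M \<subseteq> Et" using rays by (auto simp: supp_RE_def rays_def)
            then have "card (insert j' (supp_RE M)) \<le> card Et"
              by (intro card_mono) (use finite_Et j' in auto)
            then have "card Et - card (supp_RE (add_mset (RE j') M')) < card Et - card (supp_RE M)"
              unfolding supp using j'(3) finite_subset[OF sub finite_Et] by simp
            moreover have "num_RS (add_mset (RE j') M') = num_RS M"
              "size_RS (add_mset (RE j') M') = size_RS M"
              "supp_RS (add_mset (RE j') M') = supp_RS M"
              by (auto simp: M RE num_RS_def size_RS_def supp_RS_def)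
            ultimately have "monom_of (add_mset (RE j') M') \<in> cone_span (size M)"
              by (intro IH) (simp_all add: M RE)
            then show ?thesis
              unfolding M RE monom_of_exchange_fibre[OF j'(2)[symmetric]]
              by (intro cone_span_add cone_span.diff) (use mul[OF j] mul[OF j'(1)] in \<open>simp_all add: M RE\<close>)
          next
            case True
            \<comment> \<open>As \<open>RE j\<close> is repeated, the fibre stays full after
              removing one copy, so every x_T of the linear relation produces a non-cone and no
              recursion is required.\<close>
            have "monom_of (add_mset (RS T) M') \<in> cone_span (size M)"
              if T: "T \<in> {T. T \<subset> E \<and> \<pi> j \<notin> T}" for T
            proof (rule cone_span.in_CI, rule monom_of_non_cone_in_CI)
              show "set_mset (add_mset (RS T) M') \<subseteq> rays E Et" using rays M T by (auto simp: rays_def)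
              have sm: "{k. RE k \<in> set_mset (add_mset (RS T) M')} = supp_RE M"
                using M RE x by (auto simp: supp_RE_def)
              have "\<pi> j \<in> E - T" using T j \<pi>_Et by auto
              then show "\<not> cone_a E Et \<pi> (set_mset (add_mset (RS T) M'))"
                unfolding cone_a_iff admissible_a_iff sm using True by auto
            qed
            then show ?thesis
              unfolding M RE monom_of_exchange_RE
              by (intro cone_span_add cone_span_sum) (use mul[OF j] in \<open>simp_all add: M RE\<close>)
          qed
        qed
      qed
    qed
  qed
qed

lemma frag_of_eq_monom_of:
  fixes m :: "('a, 'b) ray \<Rightarrow>\<^sub>0 nat"
  shows "\<exists>M. frag_of m = monom_of M \<and> size M = total_deg m"
proof (induction "total_deg m" arbitrary: m)
  case 0
  then have "m = 0" by (intro poly_mapping_eqI) (auto simp: total_deg_def in_keys_iff)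
  then show ?case using 0 by (intro exI[of _ "{#}"]) (simp add: monom_of_def total_deg_def)
next
  case (Suc n)
  then obtain x where x: "x \<in> Poly_Mapping.keys m" by (fastforce simp: total_deg_def)
  define m' where "m' = m - Poly_Mapping.single x 1"
  have m: "m = Poly_Mapping.single x 1 + m'"
    by (rule poly_mapping_eqI)
      (use x in \<open>auto simp: m'_def lookup_add lookup_minus lookup_single when_def in_keys_iff\<close>)
  have "total_deg m = 1 + total_deg m'"
  proof -
    have "Poly_Mapping.keys m' \<subseteq> Poly_Mapping.keys m"
      by (auto simp: m in_keys_iff lookup_add)
    then have "total_deg m' = (\<Sum>y\<in>Poly_Mapping.keys m. Poly_Mapping.lookup m' y)"
      unfolding total_deg_def by (intro sum.mono_neutral_left) (auto simp: in_keys_iff)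
    moreover have "total_deg m = (\<Sum>y\<in>Poly_Mapping.keys m. (if y = x then 1 else 0) + Poly_Mapping.lookup m' y)"
      unfolding total_deg_def
      by (rule sum.cong) (auto simp: m lookup_add lookup_single)
    ultimately show ?thesis using x by (simp add: sum.distrib)
  qed
  with Suc(2) have "n = total_deg m'" by simp
  from Suc(1)[OF this] obtain M where M: "frag_of m' = monom_of M" "size M = total_deg m'" by blast
  have "frag_of m = monom_of (add_mset x M)"
    by (simp add: m var_def M(1)[symmetric] frag_of_mult)
  then show ?case using M(2) \<open>total_deg m = 1 + total_deg m'\<close> by (intro exI[of _ "add_mset x M"]) simp
qed

lemma homogeneous_in_cone_span:
  assumes "homogeneous k f"
  shows "f \<in> cone_span k"
proof -
  have "f = (\<Sum>m\<in>Poly_Mapping.keys f. frag_cmul (Poly_Mapping.lookup f m) (frag_of m))"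
    using frag_expansion[of f] by (simp add: frag_extend_def)
  also have "\<dots> \<in> cone_span k"
  proof (rule cone_span_sum)
    fix m assume "m \<in> Poly_Mapping.keys f"
    then have "total_deg m = k" using assms by (simp add: homogeneous_def)
    then have "frag_of m \<in> cone_span k"
      using frag_of_eq_monom_of[of m] monom_of_in_cone_span by metis
    moreover have "frag_cmul d g = of_int d * g" for d and g :: "('a, 'b) chow_poly"
      by (induction d rule: int_induct[of _ 0]) (simp_all add: frag_cmul_distrib frag_cmul_diff_distrib algebra_simps)
    ultimately show "frag_cmul (Poly_Mapping.lookup f m) (frag_of m) \<in> cone_span k"
      using cone_span_of_int_mult by simp
  qed
  finally show ?thesis .
qed

end

section \<open>Maximal cones and the degree map\<close>

lemma total_deg_superset:
  assumes "finite A" "Poly_Mapping.keys m \<subseteq> A"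
  shows "total_deg m = (\<Sum>x\<in>A. Poly_Mapping.lookup m x)"
  unfolding total_deg_def
  by (rule sum.mono_neutral_left) (use assms in \<open>auto simp: in_keys_iff\<close>)

lemma total_deg_add: "total_deg (a + b) = total_deg a + total_deg b"
proof -
  let ?A = "Poly_Mapping.keys a \<union> Poly_Mapping.keys b"
  have "total_deg (a + b) = (\<Sum>x\<in>?A. Poly_Mapping.lookup (a + b) x)"
    by (rule total_deg_superset) (auto simp: in_keys_iff lookup_add)
  also have "\<dots> = total_deg a + total_deg b"
    by (simp add: lookup_add sum.distrib total_deg_superset[of ?A])
  finally show ?thesis .
qed

lemma homogeneous_mult: "homogeneous k f \<Longrightarrow> homogeneous l g \<Longrightarrow> homogeneous (k + l) (f * g)"
  using keys_mult[of f g] unfolding homogeneous_def by (force simp: total_deg_add)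

lemma homogeneous_add: "homogeneous k f \<Longrightarrow> homogeneous k g \<Longrightarrow> homogeneous k (f + g)"
  using keys_add[of f g] unfolding homogeneous_def by blast

lemma homogeneous_sum: "(\<And>i. i \<in> A \<Longrightarrow> homogeneous k (f i)) \<Longrightarrow> homogeneous k (\<Sum>i\<in>A. f i)"
  by (induction A rule: infinite_finite_induct) (auto simp: homogeneous_add, auto simp: homogeneous_def)

lemma homogeneous_var: "homogeneous 1 (var x)"
  by (simp add: homogeneous_def var_def total_deg_def)

lemma homogeneous_prod:
  assumes "\<And>i. i \<in> A \<Longrightarrow> homogeneous 1 (f i)"
  shows "homogeneous (card A) (\<Prod>i\<in>A. f i)"
  using assms
proof (induction A rule: infinite_finite_induct)
  case (insert x A)
  then show ?case using homogeneous_mult[of 1 "f x" "card A"] by simp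
qed (simp_all add: homogeneous_def total_deg_def)

lemma homogeneous_mono: "homogeneous (card \<sigma>) (mono \<sigma>)"
  unfolding mono_def by (rule homogeneous_prod) (rule homogeneous_var)

lemma homogeneous_h_cls: "homogeneous 1 (h_cls E S)"
  unfolding h_cls_def x_cls_def by (rule homogeneous_sum) (rule homogeneous_var)

text \<open>The members of a chain have distinct cardinalities, at least that of the smallest member
  and less than that of E.\<close>

lemma card_chain_le:
  assumes fin: "finite E" and ch: "proper_chain E \<F>"
  shows "card \<F> \<le> card (E - first_set E \<F>)"
proof -
  have sub: "F \<subseteq> E" "finite F" if "F \<in> \<F>" for F
    using that ch fin finite_subset[of F E] by (auto simp: proper_chain_def)
  have inj: "inj_on card \<F>"
  proof (rule inj_onI)
    fix F G assume FG: "F \<in> \<F>" "G \<in> \<F>" "card F = card G"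
    have "F \<subseteq> G \<or> G \<subseteq> F" using ch FG by (simp add: proper_chain_def)
    then show "F = G" using card_subset_eq[OF sub(2)[OF FG(1)], of G]
      card_subset_eq[OF sub(2)[OF FG(2)], of F] FG(3) by auto
  qed
  have "card ` \<F> \<subseteq> {card (first_set E \<F>)..<card E}"
  proof
    fix n assume "n \<in> card ` \<F>"
    then obtain F where F: "F \<in> \<F>" "n = card F" by blast
    have "F \<subset> E" using F(1) ch by (simp add: proper_chain_def)
    then show "n \<in> {card (first_set E \<F>)..<card E}"
      using F(2) psubset_card_mono[OF fin] card_mono[OF sub(2)[OF F(1)] first_set_lower[OF F(1)]] by simp
  qed
  then have "card (card ` \<F>) \<le> card {card (first_set E \<F>)..<card E}"
    by (rule card_mono[rotated]) simp
  then show ?thesis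
    using card_image[OF inj] card_Diff_subset[of "first_set E \<F>" E] fin
      first_set_subset[of E \<F>] finite_subset[of "first_set E \<F>" E] by simp
qed

context polystellahedral
begin

text \<open>The smallest set belongs to the chain, so admissibility leaves a gap in the fibre over
  each point outside it. Choosing gaps in different fibres is injective.\<close>

lemma missing_section:
  assumes adm: "admissible_a E Et \<pi> I \<F>" and ne: "\<F> \<noteq> {}"
  obtains g where "\<And>i. i \<in> E - first_set E \<F> \<Longrightarrow> g i \<in> Et - I \<and> \<pi> (g i) = i"
    "inj_on g (E - first_set E \<F>)"
proof -
  have ch: "proper_chain E \<F>" using adm by (simp add: admissible_a_def)
  have "\<exists>j. j \<in> Et - I \<and> \<pi> j = i" if "i \<in> E - first_set E \<F>" for i
    using adm first_set_in[OF finite_ground ch ne] that unfolding admissible_a_iff preim_def by blast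
  then obtain g where g: "\<And>i. i \<in> E - first_set E \<F> \<Longrightarrow> g i \<in> Et - I \<and> \<pi> (g i) = i"
    by metis
  moreover have "inj_on g (E - first_set E \<F>)" by (rule inj_onI) (metis g)
  ultimately show thesis using that by blast
qed

lemma card_missing_le:
  assumes adm: "admissible_a E Et \<pi> I \<F>" and ne: "\<F> \<noteq> {}"
  shows "card (E - first_set E \<F>) \<le> card (Et - I)"
proof -
  obtain g where g: "\<And>i. i \<in> E - first_set E \<F> \<Longrightarrow> g i \<in> Et - I \<and> \<pi> (g i) = i"
    "inj_on g (E - first_set E \<F>)" using missing_section[OF adm ne] by blast
  have "card (g ` (E - first_set E \<F>)) \<le> card (Et - I)"
    by (rule card_mono) (use finite_Et g in auto)
  then show ?thesis using card_image[OF g(2)] by simp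
qed

text \<open>For a cone of full dimension the estimates of \<open>card_chain_le\<close> and
  \<open>card_missing_le\<close> are both equalities, so the section of gaps exhausts Et -
  I.\<close>

lemma maximal_cone_missing:
  assumes adm: "admissible_a E Et \<pi> I \<F>" and ne: "\<F> \<noteq> {}" and max: "card I + card \<F> = card Et"
  obtains "card (E - first_set E \<F>) = card \<F>"
    "\<And>j. j \<in> Et - I \<Longrightarrow> \<pi> j \<notin> first_set E \<F>"
    "\<And>j j'. j \<in> Et - I \<Longrightarrow> j' \<in> Et - I \<Longrightarrow> \<pi> j = \<pi> j' \<Longrightarrow> j = j'"
proof -
  have ch: "proper_chain E \<F>" and I: "I \<subseteq> Et" using adm by (simp_all add: admissible_a_def)
  have "card (Et - I) = card \<F>"
    using max card_Diff_subset[OF finite_subset[OF I finite_Et] I] by simp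
  then have c: "card (E - first_set E \<F>) = card \<F>" "card (Et - I) = card (E - first_set E \<F>)"
    using card_chain_le[OF finite_ground ch] card_missing_le[OF adm ne] by linarith+
  obtain g where g: "\<And>i. i \<in> E - first_set E \<F> \<Longrightarrow> g i \<in> Et - I \<and> \<pi> (g i) = i"
    "inj_on g (E - first_set E \<F>)" using missing_section[OF adm ne] by blast
  have "g ` (E - first_set E \<F>) = Et - I"
    by (rule card_subset_eq) (use finite_Et g card_image[OF g(2)] c in auto)
  then have j: "\<pi> j \<in> E - first_set E \<F> \<and> j = g (\<pi> j)" if "j \<in> Et - I" for j
    using that g by force
  show thesis
  proof (rule that[OF c(1)])
    show "\<pi> j \<notin> first_set E \<F>" if "j \<in> Et - I" for j using j[OF that] by blast
    show "j = j'" if "j \<in> Et - I" "j' \<in> Et - I" "\<pi> j = \<pi> j'" for j j'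
      using j that by metis
  qed
qed

text \<open>Moving the smallest member of the chain along the linear relation of the missing element
  above it trades the ray of that member for the ray of the missing element.\<close>

lemma maximal_cone_class:
  assumes "admissible_a E Et \<pi> I \<F>" "card I + card \<F> = card Et"
  shows "mono (cone_rays I \<F>) - mono (RE ` Et) \<in> CI"
  using assms
proof (induction "card \<F>" arbitrary: I \<F>)
  case 0
  have ch: "proper_chain E \<F>" and I: "I \<subseteq> Et" using 0(2) by (simp_all add: admissible_a_def)
  have "\<F> = {}" using 0(1) proper_chain_finite[OF finite_ground ch] by simp
  moreover have "I = Et" using card_subset_eq[OF finite_Et I] 0 by simp
  ultimately show ?case by (simp add: cone_rays_def CI_zero)
next
  case (Suc n)
  have ch: "proper_chain E \<F>" and I: "I \<subseteq> Et" using Suc(3) by (simp_all add: admissible_a_def)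
  have fin: "finite \<F>" "finite I"
    using proper_chain_finite[OF finite_ground ch] finite_subset[OF I finite_Et] by auto
  have ne: "\<F> \<noteq> {}" using Suc(2) by auto
  define F1 where "F1 = first_set E \<F>"
  define \<F>' where "\<F>' = \<F> - {F1}"
  define F2 where "F2 = first_set E \<F>'"
  have F1: "F1 \<in> \<F>" unfolding F1_def by (rule first_set_in[OF finite_ground ch ne])
  have \<F>: "\<F> = insert F1 \<F>'" "F1 \<notin> \<F>'" using F1 by (auto simp: \<F>'_def)
  have ch': "proper_chain E \<F>'" by (rule proper_chain_subset[OF ch]) (auto simp: \<F>'_def)
  have fin': "finite \<F>'" using fin by (simp add: \<F>'_def)
  have F12: "F1 \<subset> F2"
    unfolding F1_def F2_def \<F>'_def by (rule first_set_Diff[OF finite_ground ch ne])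
  have F2E: "F2 \<subseteq> E" unfolding F2_def by (rule first_set_subset)
  have F1E: "F1 \<subset> E" using F12 F2E by (rule psubset_subset_trans)
  obtain i where i: "i \<in> F2" "i \<notin> F1" using F12 by blast
  have iE: "i \<in> E" using i(1) F2E by blast
  have cF: "card (E - F1) = card \<F>" and miss: "\<And>j. j \<in> Et - I \<Longrightarrow> \<pi> j \<notin> F1"
    and uniq: "\<And>j j'. j \<in> Et - I \<Longrightarrow> j' \<in> Et - I \<Longrightarrow> \<pi> j = \<pi> j' \<Longrightarrow> j = j'"
    using maximal_cone_missing[OF Suc(3) ne Suc(4)] unfolding F1_def by blast+
  obtain j where j: "j \<in> Et" "j \<notin> I" "\<pi> j = i"
    using Suc(3) F1 i(2) iE unfolding admissible_a_iff preim_def by blast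
  let ?M = "mono (cone_rays I \<F>') :: ('a, 'b) chow_poly"
  let ?X = "{T. T \<subset> E \<and> \<pi> j \<notin> T}"
  have finX: "finite ?X" by (rule finite_subset[of _ "Pow E"]) (use finite_ground in auto)
  have insRS: "mono (cone_rays I (insert T \<F>')) = var (RS T) * ?M" if "T \<notin> \<F>'" for T
  proof -
    have "cone_rays I (insert T \<F>') = insert (RS T) (cone_rays I \<F>')" by (simp add: cone_rays_def)
    then show ?thesis using mono_var_mult[of "cone_rays I \<F>'" "RS T"] fin fin' that
      by (simp add: cone_rays_def image_iff)
  qed
  have insRE: "mono (cone_rays (insert j I) \<F>') = var (RE j) * ?M"
  proof -
    have "cone_rays (insert j I) \<F>' = insert (RE j) (cone_rays I \<F>')" by (auto simp: cone_rays_def)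
    then show ?thesis using mono_var_mult[of "cone_rays I \<F>'" "RE j"] fin fin' j(2)
      by (simp add: cone_rays_def image_iff)
  qed
  \<comment> \<open>If T \<noteq> F1 gave a cone, it would be maximal with the same I. The gaps of I
    then force F1 \<subseteq> T with equally large complements, hence T = F1.\<close>
  have other: "var (RS T) * ?M \<in> CI" if T: "T \<in> ?X - {F1}" for T
  proof -
    have notin: "T \<notin> \<F>'"
    proof
      assume "T \<in> \<F>'"
      then have "F2 \<subseteq> T" unfolding F2_def by (rule first_set_lower)
      then show False using i(1) T j(3) by blast
    qed
    have "\<not> cone_a E Et \<pi> (cone_rays I (insert T \<F>'))"
    proof
      assume "cone_a E Et \<pi> (cone_rays I (insert T \<F>'))"
      then have adm: "admissible_a E Et \<pi> I (insert T \<F>')"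
        by (simp only: cone_a_iff cone_rays_RS_iff cone_rays_RE_iff Collect_mem_eq)
      then have chT: "proper_chain E (insert T \<F>')" by (simp add: admissible_a_def)
      have "T \<subset> F2"
      proof (cases "\<F>' = {}")
        case True
        show ?thesis unfolding F2_def True using T by simp
      next
        case False
        have "F2 \<in> \<F>'" unfolding F2_def by (rule first_set_in[OF finite_ground ch' False])
        then have "T \<subseteq> F2 \<or> F2 \<subseteq> T" using chT by (simp add: proper_chain_def)
        then show ?thesis using i(1) T j(3) by blast
      qed
      then have first: "first_set E (insert T \<F>') = T" unfolding F2_def by (rule first_set_insert)
      have card: "card (insert T \<F>') = card \<F>" using notin \<F> fin' by simp
      have "card I + card (insert T \<F>') = card Et" using card Suc(4) by simp
      then have "card (E - T) = card \<F>"
        using maximal_cone_missing[OF adm] card first by (metis insert_not_empty)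
      \<comment> \<open>A point of F1 - T would have a gap of I in its fibre, but by
        \<open>miss\<close> all gaps lie over the complement of F1.\<close>
      moreover have "F1 \<subseteq> T"
      proof (rule ccontr)
        assume "\<not> F1 \<subseteq> T"
        then obtain e where e: "e \<in> F1" "e \<in> E - T" using F1E by blast
        then have "\<not> preim Et \<pi> {e} \<subseteq> I" using adm by (simp add: admissible_a_iff)
        then obtain k where "k \<in> Et - I" "\<pi> k = e" by (auto simp: preim_def)
        with miss[of k] e(1) show False by simp
      qed
      ultimately have "E - T = E - F1"
        using cF finite_ground by (intro card_subset_eq) auto
      then show False using T F1E by blast
    qed
    moreover have "cone_rays I (insert T \<F>') \<subseteq> rays E Et"
      using I ch' T by (auto simp: cone_rays_def rays_def proper_chain_def)
    ultimately show ?thesis using non_cone_in_CI insRS[OF notin] by metis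
  qed
  have "(\<Sum>T\<in>?X. var (RS T)) = var (RS F1) + (\<Sum>T\<in>?X - {F1}. var (RS T) :: ('a, 'b) chow_poly)"
    by (rule sum.remove[OF finX]) (use F1E i j in auto)
  then have "mono (cone_rays I \<F>) - mono (cone_rays (insert j I) \<F>') =
      - (?M * lin_rel E \<pi> j) - (\<Sum>T\<in>?X - {F1}. var (RS T) * ?M)"
    unfolding \<F>(1) insRS[OF \<F>(2)] insRE
    by (simp add: lin_rel_def sum_distrib_right[symmetric] sum_distrib_left[symmetric] algebra_simps)
  moreover have "- (?M * lin_rel E \<pi> j) - (\<Sum>T\<in>?X - {F1}. var (RS T) * ?M) \<in> CI"
    by (intro CI_diff CI_uminus CI_mult CI_sum lin_rel_in_CI j(1) other)
  ultimately have 1: "mono (cone_rays I \<F>) - mono (cone_rays (insert j I) \<F>') \<in> CI" by simp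
  have "admissible_a E Et \<pi> (insert j I) \<F>'"
    unfolding admissible_a_iff
  proof (intro conjI ballI notI)
    show "insert j I \<subseteq> Et" using I j by simp
    show "proper_chain E \<F>'" by (rule ch')
    fix F e assume F: "F \<in> \<F>'" and e: "e \<in> E - F" and sub: "preim Et \<pi> {e} \<subseteq> insert j I"
    \<comment> \<open>All remaining members of the chain contain i, so filling the fibre over i with
      j does not affect admissibility.\<close>
    have "i \<in> F" using first_set_lower[OF F, of E] i(1) unfolding F2_def by blast
    then have "preim Et \<pi> {e} \<subseteq> I" using sub e j(3) by (auto simp: preim_def)
    then show False using Suc(3) F e unfolding admissible_a_iff \<F>'_def by blast
  qed
  moreover have "n = card \<F>'" using Suc(2) \<F> fin' by simp
  moreover have "card (insert j I) + card \<F>' = card Et" using Suc(4) \<F> fin fin' j(2) by simp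
  ultimately have "mono (cone_rays (insert j I) \<F>') - mono (RE ` Et) \<in> CI"
    using Suc(1) by blast
  from CI_add[OF 1 this] show ?case by simp
qed

lemma maximal_cone_class':
  assumes "cone_a E Et \<pi> \<sigma>" "card \<sigma> = card Et"
  shows "mono \<sigma> - mono (RE ` Et) \<in> CI"
proof -
  obtain I \<F> where adm: "admissible_a E Et \<pi> I \<F>" and \<sigma>: "\<sigma> = cone_rays I \<F>"
    using assms(1) by (auto simp: cone_a_def)
  have "finite I" "finite \<F>"
    using adm finite_subset[OF _ finite_Et] proper_chain_finite[OF finite_ground]
    by (auto simp: admissible_a_def)
  then have "card \<sigma> = card I + card \<F>" using card_cone_rays \<sigma> by metis
  then show ?thesis using maximal_cone_class[OF adm] assms(2) \<sigma> by simp
qed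

lemma top_class:
  assumes "f \<in> cone_span (card Et)"
  shows "\<exists>d. f - of_int d * mono (RE ` Et) \<in> CI"
  using assms
proof induction
  case (in_CI f)
  then show ?case by (intro exI[of _ 0]) simp
next
  case (cone \<sigma>)
  then show ?case using maximal_cone_class' by (intro exI[of _ 1]) simp
next
  case (diff f g)
  then obtain d e where "f - of_int d * mono (RE ` Et) \<in> CI" "g - of_int e * mono (RE ` Et) \<in> CI" by blast
  from CI_diff[OF this] have "(f - g) - of_int (d - e) * mono (RE ` Et) \<in> CI" by (simp add: algebra_simps)
  then show ?case by blast
qed

text \<open>The free polymatroid of the given type. Its rank is \<open>card Et\<close>, so its
  indicator function tests polynomials of top degree.\<close>

definition free_rk :: "'a set \<Rightarrow> nat" where
  "free_rk A = card (preim Et \<pi> A)"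

lemma finite_preim: "finite (preim Et \<pi> A)"
  using finite_Et by (simp add: preim_def)

sublocale free: polyrank E free_rk
proof
  show "finite E" by (rule finite_ground)
  show "free_rk {} = 0" by (simp add: free_rk_def preim_def)
  show "free_rk A \<le> free_rk B" if "A \<subseteq> B" for A B
    unfolding free_rk_def by (rule card_mono[OF finite_preim]) (use that in \<open>auto simp: preim_def\<close>)
  show "free_rk (A \<union> B) + free_rk (A \<inter> B) \<le> free_rk A + free_rk B" for A B
  proof -
    have "preim Et \<pi> (A \<union> B) = preim Et \<pi> A \<union> preim Et \<pi> B"
      "preim Et \<pi> (A \<inter> B) = preim Et \<pi> A \<inter> preim Et \<pi> B" by (auto simp: preim_def)
    then show ?thesis unfolding free_rk_def using card_Un_Int[OF finite_preim finite_preim] by simp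
  qed
qed

lemma free_rk_ground: "free_rk E = card Et"
proof -
  have "preim Et \<pi> E = Et" using \<pi>_Et by (auto simp: preim_def)
  then show ?thesis by (simp add: free_rk_def)
qed

definition top_deg :: "('a, 'b) chow_poly \<Rightarrow> int" where
  "top_deg f = pact E Et \<pi> f (free.chain_fun {}) {#}"

lemma top_deg_diff: "top_deg (f - g) = top_deg f - top_deg g"
  by (simp add: top_deg_def pact_diff)

lemma top_deg_of_int_mult: "top_deg (of_int d * f) = d * top_deg f"
  by (simp add: top_deg_def pact_mult pact_of_int)

lemma top_deg_CI:
  assumes "\<And>i. i \<in> E \<Longrightarrow> 0 < card (preim Et \<pi> {i})" "f \<in> CI"
  shows "top_deg f = 0"
  using free.pact_chow_ideal[OF finite_Et \<pi>_Et _ assms] by (simp add: top_deg_def free_rk_def)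

lemma top_deg_point: "top_deg (mono (RE ` Et)) = 1"
proof -
  have ch: "proper_chain E {}" by (simp add: proper_chain_def)
  let ?m = "image_mset (\<lambda>j. {\<pi> j}) (mset_set Et)"
  have "(RE ` Et :: ('a, 'b) ray set) = cone_rays Et {}" by (simp add: cone_rays_def)
  then have "top_deg (mono (RE ` Et)) = free.chain_fun {} ?m"
    using free.pact_cone_rays[OF ch finite_Et subset_refl, of \<pi> "{#}"] by (simp add: top_deg_def)
  also have "\<dots> = 1"
  proof -
    have "hall_rado free_rk ?m"
      unfolding hall_rado_image_iff[OF finite_Et] free_rk_def
      by (intro allI impI card_mono finite_preim) (auto simp: preim_def)
    then show ?thesis using finite_Et \<pi>_Et free_rk_ground by (auto simp: free.chain_fun_eq[OF ch])
  qed
  finally show ?thesis .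
qed

text \<open>\<open>top_class\<close> gives existence. Uniqueness holds because
  \<open>top_deg\<close> vanishes on the ideal and is 1 at every maximal cone.\<close>

lemma deg_X_eq_top_deg:
  assumes a: "\<And>i. i \<in> E \<Longrightarrow> 0 < card (preim Et \<pi> {i})" and f: "f \<in> cone_span (card Et)"
  shows "deg_X E Et \<pi> f = top_deg f"
  unfolding deg_X_def
proof (rule the_equality)
  have point: "cone_a E Et \<pi> (RE ` Et)" "card (RE ` Et :: ('a, 'b) ray set) = card Et"
  proof -
    show "cone_a E Et \<pi> (RE ` Et)"
      unfolding cone_a_iff admissible_a_iff by (auto simp: proper_chain_def)
    show "card (RE ` Et :: ('a, 'b) ray set) = card Et" by (rule card_image) (simp add: inj_on_def)
  qed
  have val: "d = top_deg f" if "cone_a E Et \<pi> \<sigma>" "card \<sigma> = card Et" "f - of_int d * mono \<sigma> \<in> CI" for d \<sigma>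
  proof -
    have "top_deg (mono \<sigma>) = 1"
      using top_deg_CI[OF a maximal_cone_class'[OF that(1,2)]] by (simp add: top_deg_diff top_deg_point)
    then show ?thesis
      using top_deg_CI[OF a that(3)] by (simp add: top_deg_diff top_deg_of_int_mult)
  qed
  obtain d where d: "f - of_int d * mono (RE ` Et) \<in> CI" using top_class[OF f] by blast
  with val[OF point] have "d = top_deg f" by blast
  then show "\<exists>\<sigma>. cone_a E Et \<pi> \<sigma> \<and> card \<sigma> = card Et \<and> f - of_int (top_deg f) * mono \<sigma> \<in> CI"
    using d point by blast
  show "d = top_deg f" if "\<exists>\<sigma>. cone_a E Et \<pi> \<sigma> \<and> card \<sigma> = card Et \<and> f - of_int d * mono \<sigma> \<in> CI" for d
    using that val by blast
qed

end

section \<open>The Bergman class\<close>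

locale polymatroid_of_type = polystellahedral E Et \<pi>
  for E :: "'a set" and Et :: "'b set" and \<pi> :: "'b \<Rightarrow> 'a" +
  fixes a :: "'a \<Rightarrow> nat" and rk :: "'a set \<Rightarrow> nat"
  assumes card_fibre: "\<forall>i\<in>E. card (preim Et \<pi> {i}) = a i"
    and polymatroid_rk: "polymatroid E a rk"
    and loopless_rk: "loopless E rk"
begin

text \<open>Monotonicity and submodularity of this extension hold for all sets, without side conditions.\<close>

definition erk :: "'a set \<Rightarrow> nat" where
  "erk A = rk (A \<inter> E)"

sublocale P: polyrank E erk
proof
  show "finite E" by (rule finite_ground)
  show "erk {} = 0" using polymatroid_rk by (simp add: erk_def polymatroid_def)
  show "erk A \<le> erk B" if "A \<subseteq> B" for A B
  proof -
    have "A \<inter> E \<subseteq> B \<inter> E" "B \<inter> E \<subseteq> E" using that by auto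
    then show ?thesis using polymatroid_rk unfolding erk_def polymatroid_def by blast
  qed
  show "erk (A \<union> B) + erk (A \<inter> B) \<le> erk A + erk B" for A B
  proof -
    have "(A \<union> B) \<inter> E = (A \<inter> E) \<union> (B \<inter> E)" "(A \<inter> B) \<inter> E = (A \<inter> E) \<inter> (B \<inter> E)" by auto
    then show ?thesis using polymatroid_rk unfolding erk_def polymatroid_def by simp
  qed
qed

lemma erk_subset: "A \<subseteq> E \<Longrightarrow> erk A = rk A"
  by (simp add: erk_def Int_absorb2)

lemma erk_single_le: "i \<in> E \<Longrightarrow> erk {i} \<le> card (preim Et \<pi> {i})"
  using polymatroid_rk card_fibre by (simp add: erk_subset polymatroid_def)

lemma card_fibre_pos: "i \<in> E \<Longrightarrow> 0 < card (preim Et \<pi> {i})"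
  using loopless_rk erk_single_le[of i] by (fastforce simp: erk_subset loopless_def)

lemma free_rk_disjoint: "A \<inter> B = {} \<Longrightarrow> free_rk (A \<union> B) = free_rk A + free_rk B"
  unfolding free_rk_def
  by (subst card_Un_disjoint[symmetric]) (use finite_preim in \<open>auto simp: preim_def intro: arg_cong[where f = card]\<close>)

lemma free_rk_Int: "free_rk (A \<inter> E) = free_rk A"
  using \<pi>_Et by (auto simp: free_rk_def preim_def intro!: arg_cong[where f = card])

lemma erk_le_free_rk: "erk A \<le> free_rk A"
proof -
  have "erk B \<le> free_rk B" if "finite B" "B \<subseteq> E" for B
    using that
  proof (induction B rule: finite_induct)
    case (insert i B)
    have "erk (B \<union> {i}) + erk (B \<inter> {i}) \<le> erk B + erk {i}" by (rule P.rk_submod)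
    moreover have "free_rk (B \<union> {i}) = free_rk B + free_rk {i}"
      by (rule free_rk_disjoint) (use insert in auto)
    moreover have "erk {i} \<le> free_rk {i}" using erk_single_le insert by (simp add: free_rk_def)
    ultimately show ?case using insert by simp
  qed (simp add: P.rk_empty)
  from this[of "A \<inter> E"] have "erk (A \<inter> E) \<le> free_rk (A \<inter> E)" using finite_ground by simp
  then show ?thesis unfolding free_rk_Int by (simp add: erk_def)
qed

text \<open>The nullity \<open>free_rk\<close> - \<open>erk\<close> is monotone, written without
  subtraction: the rank of B - A is at most its free rank. Both the submodularity of the lifts and
  the quotient relation between consecutive lifts depend on this.\<close>

lemma nullity_mono:
  assumes "A \<subseteq> B"
  shows "erk B + free_rk A \<le> erk A + free_rk B"
proof -
  have B: "A \<union> (B - A) = B" using assms by auto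
  have "erk B \<le> erk A + erk (B - A)" using P.rk_submod[of A "B - A"] unfolding B by simp
  also have "\<dots> \<le> erk A + free_rk (B - A)" using erk_le_free_rk by simp
  finally show ?thesis using free_rk_disjoint[of A "B - A"] unfolding B by simp
qed

text \<open>Higgs lifts: each one is an elementary quotient of the next, from \<open>erk\<close> up to \<open>free_rk\<close>.\<close>

definition lift_rk :: "nat \<Rightarrow> 'a set \<Rightarrow> nat" where
  "lift_rk k A = min (erk A + k) (free_rk A)"

text \<open>The minimum of two submodular functions is submodular if their difference is monotone,
  here by \<open>nullity_mono\<close>.\<close>

lemma polyrank_lift: "polyrank E (lift_rk k)"
proof
  show "finite E" by (rule finite_ground)
  show "lift_rk k {} = 0" by (simp add: lift_rk_def free.rk_empty)
  show "lift_rk k A \<le> lift_rk k B" if "A \<subseteq> B" for A B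
    using P.rk_mono[OF that] free.rk_mono[OF that] unfolding lift_rk_def by linarith
  show "lift_rk k (A \<union> B) + lift_rk k (A \<inter> B) \<le> lift_rk k A + lift_rk k B" for A B
    using P.rk_submod[of A B] free.rk_submod[of A B]
      nullity_mono[of "A \<inter> B" A] nullity_mono[of "A \<inter> B" B]
    unfolding lift_rk_def by simp
qed

lemma lift_rk_0: "lift_rk 0 = erk"
  using erk_le_free_rk by (simp add: lift_rk_def fun_eq_iff min_def)

lemma erk_ground_le: "erk E \<le> card Et"
  using erk_le_free_rk[of E] free_rk_ground by simp

text \<open>The index is the nullity of E, which bounds the nullity of every A, so the minimum is
  always \<open>free_rk\<close>.\<close>

lemma lift_rk_top: "lift_rk (card Et - erk E) = free_rk"
proof
  fix A
  have "erk (A \<union> E) = erk E" "free_rk (A \<union> E) = free_rk E"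
    using free_rk_Int[of "A \<union> E"] by (simp_all add: erk_def Int_commute)
  then have "erk E + free_rk A \<le> erk A + card Et"
    using nullity_mono[of A "A \<union> E"] free_rk_ground by simp
  then show "lift_rk (card Et - erk E) A = free_rk A"
    using erk_ground_le unfolding lift_rk_def by linarith
qed

text \<open>The two lifts agree at T exactly if T has nullity at most k.\<close>

definition lift_div :: "nat \<Rightarrow> ('a, 'b) chow_poly" where
  "lift_div k = (\<Sum>T\<in>{T. T \<subset> E \<and> lift_rk (Suc k) T = lift_rk k T}. var (RS T))"

definition bergman :: "('a, 'b) chow_poly" where
  "bergman = (\<Prod>k<card Et - erk E. lift_div k)"

lemma homogeneous_bergman: "homogeneous (card Et - erk E) bergman"
proof -
  have "homogeneous (card {..<card Et - erk E}) bergman"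
    unfolding bergman_def lift_div_def
    by (rule homogeneous_prod) (rule homogeneous_sum, rule homogeneous_var)
  then show ?thesis by simp
qed

lemma pact_lift_div:
  assumes "k < card Et - erk E"
  shows "pact E Et \<pi> (lift_div k) (polyrank.chain_fun E (lift_rk (Suc k)) {}) = polyrank.chain_fun E (lift_rk k) {}"
proof
  fix m
  interpret L: polyrank E "lift_rk (Suc k)" by (rule polyrank_lift)
  have "pact E Et \<pi> (lift_div k) (L.chain_fun {}) m =
      (\<Sum>T\<in>{T. T \<subset> E \<and> lift_rk (Suc k) T = lift_rk k T}. xop E T (L.chain_fun {}) m)"
    unfolding lift_div_def pact_sum by (rule sum.cong[OF refl]) (simp add: pact_var_RS)
  also have "\<dots> = polyrank.chain_fun E (lift_rk k) {} m"
  proof (rule elementary_quotient[OF polyrank_lift polyrank_lift])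
    show "lift_rk k A \<le> lift_rk (Suc k) A" "lift_rk (Suc k) A \<le> lift_rk k A + 1" for A
      by (simp_all add: lift_rk_def min_def)
    \<comment> \<open>The lifts differ exactly at the sets of nullity greater than k, and these are
      closed under supersets.\<close>
    show "lift_rk (Suc k) B = lift_rk k B + 1" if "A \<subseteq> B" "lift_rk (Suc k) A = lift_rk k A + 1" for A B
      using nullity_mono[OF that(1)] that(2) unfolding lift_rk_def by linarith
    show "lift_rk (Suc k) E = lift_rk k E + 1"
      using assms free_rk_ground unfolding lift_rk_def by linarith
  qed
  finally show "pact E Et \<pi> (lift_div k) (L.chain_fun {}) m = polyrank.chain_fun E (lift_rk k) {} m" .
qed

lemma pact_bergman: "pact E Et \<pi> bergman (free.chain_fun {}) = P.chain_fun {}"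
proof -
  have "pact E Et \<pi> (\<Prod>k<d. lift_div k) (polyrank.chain_fun E (lift_rk d) {}) = P.chain_fun {}"
    if "d \<le> card Et - erk E" for d
    using that
  \<comment> \<open>The factor with the largest index acts first, on the highest lift, and every
    factor descends by one.\<close>
  proof (induction d)
    case (Suc d)
    then show ?case using pact_lift_div[of d] by (simp add: pact_mult)
  qed (simp add: lift_rk_0)
  from this[of "card Et - erk E"] show ?thesis by (simp add: bergman_def lift_rk_top)
qed

section \<open>The cones of the augmented Bergman fan\<close>

lemma flat_in_erk_iff:
  assumes "F \<subset> E"
  shows "flat_in erk E F \<longleftrightarrow> is_flat E rk F"
proof -
  have "erk F = rk F" "\<And>e. e \<in> E - F \<Longrightarrow> erk (insert e F) = rk (F \<union> {e})"
    using assms by (auto intro!: arg_cong[where f = rk] simp: erk_def)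
  then show ?thesis using assms by (auto simp: flat_in_def is_flat_def)
qed

lemma hall_rado_erk_iff:
  assumes "I \<subseteq> Et"
  shows "hall_rado erk (image_mset (\<lambda>j. {\<pi> j}) (mset_set I)) \<longleftrightarrow> (\<forall>T. T \<subseteq> I \<longrightarrow> card T \<le> rk (\<pi> ` T))"
proof -
  have "erk (\<Union>j\<in>T. {\<pi> j}) = rk (\<pi> ` T)" if "T \<subseteq> I" for T
  proof -
    have "\<pi> ` T \<subseteq> E" using that assms \<pi>_Et by blast
    then show ?thesis by (simp add: UNION_singleton_eq_range erk_subset)
  qed
  then show ?thesis unfolding hall_rado_image_iff[OF finite_subset[OF assms finite_Et]] by simp
qed

lemma dragon_erk_iff:
  assumes "I \<subseteq> Et" "F \<subset> E"
  shows "dragon erk F (outside F (image_mset (\<lambda>j. {\<pi> j}) (mset_set I))) \<longleftrightarrow>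
    (\<forall>T. T \<subseteq> I - preim Et \<pi> F \<and> T \<noteq> {} \<longrightarrow> rk F + card T < rk (F \<union> \<pi> ` T))"
proof -
  let ?I = "I - preim Et \<pi> F"
  have fin: "finite I" "finite ?I" using finite_subset[OF assms(1) finite_Et] by auto
  have *: "erk (F \<union> (\<Union>j\<in>T. {\<pi> j})) = rk (F \<union> \<pi> ` T)" if "T \<subseteq> ?I" for T
  proof -
    have "F \<union> \<pi> ` T \<subseteq> E" using that assms \<pi>_Et by blast
    then show ?thesis by (simp add: UNION_singleton_eq_range erk_subset)
  qed
  have "outside F (image_mset (\<lambda>j. {\<pi> j}) (mset_set I)) = image_mset (\<lambda>j. {\<pi> j}) (mset_set ?I)"
  proof -
    have "?I = {j \<in> I. \<not> {\<pi> j} \<subseteq> F}" using assms by (auto simp: preim_def)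
    then show ?thesis using fin by (simp add: filter_mset_image_mset filter_mset_mset_set)
  qed
  then show ?thesis
    using * erk_subset[of F] assms(2) by (auto simp: dragon_image_iff[OF fin(2)])
qed

text \<open>At the multiset of singletons {\<pi> j} with j in I, the clauses of
  \<open>chain_fun_eq\<close> are the defining conditions of \<Sigma>_P, and its size clause is the
  dimension of the cone.\<close>

lemma pact_cone_P:
  assumes "cone_a E Et \<pi> \<sigma>" "card \<sigma> = erk E"
  shows "pact E Et \<pi> (mono \<sigma>) (P.chain_fun {}) {#} = (if cone_P E Et \<pi> rk \<sigma> then 1 else 0)"
proof -
  obtain I \<F> where adm: "admissible_a E Et \<pi> I \<F>" and \<sigma>: "\<sigma> = cone_rays I \<F>"
    using assms(1) by (auto simp: cone_a_def)
  have I: "I \<subseteq> Et" and ch: "proper_chain E \<F>" using adm by (auto simp: admissible_a_def)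
  have fin: "finite I" "finite \<F>"
    using I finite_subset[OF _ finite_Et] proper_chain_finite[OF finite_ground ch] by auto
  have proper: "F \<subset> E" if "F \<in> \<F>" for F using ch that by (simp add: proper_chain_def)
  let ?m = "image_mset (\<lambda>j. {\<pi> j}) (mset_set I)"
  have "size ?m + card \<F> = erk E" using assms(2) card_cone_rays[OF fin] \<sigma> by simp
  moreover have "\<forall>S\<in>#?m. S \<subseteq> E" using I \<pi>_Et fin by auto
  ultimately have "P.chain_fun \<F> ?m = of_bool (hall_rado erk ?m \<and>
     (\<forall>F\<in>\<F>. flat_in erk E F \<and> dragon erk F (outside F ?m)))"
    unfolding P.chain_fun_eq[OF ch] by (intro arg_cong[where f = of_bool]) blast
  also have "(hall_rado erk ?m \<and> (\<forall>F\<in>\<F>. flat_in erk E F \<and> dragon erk F (outside F ?m))) \<longleftrightarrow>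
     cone_P E Et \<pi> rk \<sigma>"
    unfolding cone_P_def \<sigma> cone_rays_eq_iff hall_rado_erk_iff[OF I]
    using adm proper flat_in_erk_iff dragon_erk_iff[OF I] by fastforce
  finally show ?thesis
    using P.pact_cone_rays[OF ch fin(1) I, of \<pi> "{#}"] \<sigma> by simp
qed

lemma top_deg_bergman_mult: "top_deg (bergman * f) = pact E Et \<pi> f (P.chain_fun {}) {#}"
  by (simp add: top_deg_def mult.commute[of bergman] pact_mult pact_bergman)

lemma deg_X_homogeneous:
  "homogeneous (card Et) f \<Longrightarrow> deg_X E Et \<pi> f = top_deg f"
  by (rule deg_X_eq_top_deg[OF card_fibre_pos homogeneous_in_cone_span])

lemma deg_X_complementary:
  assumes "homogeneous (card Et - erk E) c" "homogeneous (erk E) f"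
  shows "deg_X E Et \<pi> (c * f) = top_deg (c * f)"
  using homogeneous_mult[OF assms] erk_ground_le by (intro deg_X_homogeneous) simp

text \<open>The choice is legitimate because \<open>bergman\<close> has the prescribed
  degrees.\<close>

lemma sigmaP_cls_spec:
  "homogeneous (card Et - erk E) (sigmaP_cls E Et \<pi> rk :: ('a, 'b) chow_poly)"
  "cone_a E Et \<pi> \<sigma> \<Longrightarrow> card \<sigma> = erk E \<Longrightarrow>
     deg_X E Et \<pi> (sigmaP_cls E Et \<pi> rk * mono \<sigma>) = (if cone_P E Et \<pi> rk \<sigma> then 1 else 0)"
proof -
  have rkE: "rk E = erk E" by (simp add: erk_def)
  let ?Q = "\<lambda>c. homogeneous (card Et - rk E) c \<and> (\<forall>\<sigma>. cone_a E Et \<pi> \<sigma> \<and> card \<sigma> = rk E \<longrightarrow>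
        deg_X E Et \<pi> (c * mono \<sigma>) = (if cone_P E Et \<pi> rk \<sigma> then 1 else 0))"
  have "deg_X E Et \<pi> (bergman * mono \<sigma>) = (if cone_P E Et \<pi> rk \<sigma> then 1 else 0)"
    if "cone_a E Et \<pi> \<sigma>" "card \<sigma> = erk E" for \<sigma>
    using deg_X_complementary[OF homogeneous_bergman, of "mono \<sigma>"] homogeneous_mono[of \<sigma>] that
    by (simp add: top_deg_bergman_mult pact_cone_P)
  then have "?Q bergman" using homogeneous_bergman rkE by simp
  then have "?Q (sigmaP_cls E Et \<pi> rk)" unfolding sigmaP_cls_def by (rule someI)
  then show "homogeneous (card Et - erk E) (sigmaP_cls E Et \<pi> rk :: ('a, 'b) chow_poly)"
    "cone_a E Et \<pi> \<sigma> \<Longrightarrow> card \<sigma> = erk E \<Longrightarrow>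
     deg_X E Et \<pi> (sigmaP_cls E Et \<pi> rk * mono \<sigma>) = (if cone_P E Et \<pi> rk \<sigma> then 1 else 0)"
    using rkE by simp_all
qed

text \<open>The chosen class may differ from \<open>bergman\<close> as a polynomial, but both have
  the same degrees against cone monomials, and these span the complementary degree modulo the
  ideal.\<close>

lemma deg_X_sigmaP:
  assumes f: "homogeneous (erk E) f"
  shows "deg_X E Et \<pi> (sigmaP_cls E Et \<pi> rk * f) = pact E Et \<pi> f (P.chain_fun {}) {#}"
proof -
  have "top_deg (sigmaP_cls E Et \<pi> rk * f) = top_deg (bergman * f)"
    using homogeneous_in_cone_span[OF f]
  proof induction
    case (in_CI f)
    then show ?case using top_deg_CI[OF card_fibre_pos CI_mult[OF in_CI]] by simp
  next
    case (cone \<sigma>)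
    have "top_deg (sigmaP_cls E Et \<pi> rk * mono \<sigma>) = deg_X E Et \<pi> (sigmaP_cls E Et \<pi> rk * mono \<sigma>)"
      using deg_X_complementary[OF sigmaP_cls_spec(1), of "mono \<sigma>"] homogeneous_mono[of \<sigma>] cone(2) by simp
    then show ?case
      using sigmaP_cls_spec(2)[OF cone] pact_cone_P[OF cone] by (simp add: top_deg_bergman_mult)
  next
    case (diff f g)
    then show ?case by (simp add: right_diff_distrib top_deg_diff)
  qed
  then show ?thesis
    using deg_X_complementary[OF sigmaP_cls_spec(1) f] by (simp add: top_deg_bergman_mult)
qed

text \<open>Multiplying by x_{} produces the function of the one-element chain {{}}, and the h
  classes evaluate it at the multiset of the S_j.\<close>

lemma deg_dragon:
  assumes ne: "E \<noteq> {}" and S: "\<forall>j\<in>{1..erk E - 1}. S j \<noteq> {} \<and> S j \<subseteq> E"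
  shows "deg_X E Et \<pi> ((\<Prod>j\<in>{1..erk E - 1}. h_cls E (S j)) * sigmaP_cls E Et \<pi> rk * x_cls {})
     = (if dragon_hall_rado rk (erk E) S then 1 else 0)"
proof -
  let ?A = "{1..erk E - 1}"
  let ?f = "(\<Prod>j\<in>?A. h_cls E (S j)) * x_cls {} :: ('a, 'b) chow_poly"
  let ?m = "image_mset S (mset_set ?A)"
  obtain i where i: "i \<in> E" using ne by blast
  have "0 < erk {i}" using loopless_rk i by (simp add: erk_subset loopless_def)
  \<comment> \<open>Positive rank makes the truncated subtraction harmless: the r - 1 factors h and
    the factor x_{} have total degree r.\<close>
  then have pos: "0 < erk E" using P.rk_mono[of "{i}" E] i by simp
  have E0: "{} \<subset> E" using ne by blast
  have ch: "proper_chain E {{}}" using E0 by (simp add: proper_chain_def)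
  have ch0: "proper_chain E {}" by (simp add: proper_chain_def)
  have x: "pact E Et \<pi> (var (RS {})) (P.chain_fun {}) = P.chain_fun {{}}"
    using pact_var_RS[OF E0, of "P.chain_fun {}"] P.xop_chain_fun[OF ch0, of "{}"] E0
    by (simp add: fun_eq_iff)
  have "homogeneous (card ?A + 1) ?f"
    unfolding x_cls_def
    by (intro homogeneous_mult homogeneous_prod homogeneous_h_cls homogeneous_var)
  then have "homogeneous (erk E) ?f" using pos by simp
  then have "deg_X E Et \<pi> (sigmaP_cls E Et \<pi> rk * ?f) = pact E Et \<pi> ?f (P.chain_fun {}) {#}"
    by (rule deg_X_sigmaP)
  also have "\<dots> = pact E Et \<pi> (\<Prod>j\<in>?A. h_cls E (S j)) (P.chain_fun {{}}) {#}"
    by (simp add: pact_mult x_cls_def x)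
  also have "\<dots> = P.chain_fun {{}} ?m"
    by (subst pact_prod_h_cls) (use S finite_ground in auto)
  also have "\<dots> = of_bool (dragon_hall_rado rk (erk E) S)"
  proof -
    have sub: "\<forall>S\<in>#?m. S \<subseteq> E" using S by auto
    have out: "outside {} ?m = ?m" using S by (auto simp: filter_mset_eq_conv)
    have size: "size ?m + card {{}} = erk E" using pos by simp
    have flat: "flat_in erk E {}"
      using loopless_rk by (auto simp: flat_in_def P.rk_empty erk_subset loopless_def)
    \<comment> \<open>For the chain {{}} the Hall-Rado clause of \<open>chain_fun_eq\<close> follows
      from the stronger dragon clause.\<close>
    have hr: "hall_rado erk ?m" if "dragon erk {} ?m"
      unfolding hall_rado_def
    proof (intro allI impI)
      fix J assume J: "J \<subseteq># ?m"
      show "size J \<le> erk (un J)"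
        using dragonD[OF that J] by (cases "J = {#}") simp_all
    qed
    have "erk (\<Union>j\<in>T. S j) = rk (\<Union>j\<in>T. S j)" if T: "T \<subseteq> ?A" for T
      by (rule erk_subset) (use S T in blast)
    then have "dragon erk {} ?m \<longleftrightarrow> dragon_hall_rado rk (erk E) S"
      unfolding dragon_image_iff[OF finite_atLeastAtMost] dragon_hall_rado_def
      by (auto simp: P.rk_empty Suc_le_eq)
    moreover have "(\<forall>F\<in>{{}}. flat_in erk E F \<and> dragon erk F (outside F ?m)) \<longleftrightarrow> dragon erk {} ?m"
      by (simp only: ball_simps out flat simp_thms)
    ultimately show ?thesis
      using sub size hr unfolding P.chain_fun_eq[OF ch] by (intro arg_cong[where f = of_bool]) blast
  qed
  finally show ?thesis by (simp add: mult_ac)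
qed

end

theorem theorem6p4:
  fixes E :: "'a set" and a :: "'a \<Rightarrow> nat" and rk :: "'a set \<Rightarrow> nat"
    and Et :: "'b set" and \<pi> :: "'b \<Rightarrow> 'a" and r :: nat and S :: "nat \<Rightarrow> 'a set"
  assumes "finite E" and "E \<noteq> {}"
    and "finite Et" and "\<pi> ` Et \<subseteq> E" and "\<forall>i\<in>E. card (preim Et \<pi> {i}) = a i"
    and "polymatroid E a rk" and "loopless E rk" and "r = rk E"
    and "\<forall>j\<in>{1..r-1}. S j \<noteq> {} \<and> S j \<subseteq> E"
  shows "deg_X E Et \<pi> ((\<Prod>j\<in>{1..r-1}. h_cls E (S j)) * sigmaP_cls E Et \<pi> rk * x_cls {})
         = (if dragon_hall_rado rk r S then 1 else 0)"
proof -
  interpret polymatroid_of_type E Et \<pi> a rk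
    by unfold_locales (use assms in auto)
  have "r = erk E" using assms(8) by (simp add: erk_def)
  then show ?thesis using deg_dragon[OF assms(2), of S] assms(9) by simp
qed

end
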